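(* Let $\mathcal{C}$ be a congruence-modular and semi-degenerate variety such that, for each member $M$ of $\mathcal{C}$, $\mathcal{K}(M)$ is closed with respect to the commutator of $M$. Let $A$ be a member of $\mathcal{C}$. Then the following are equivalent: (1) $A$ is hyperarchimedean; (2) $A/\rho_A(\Delta_A)$ is hyperarchimedean; (3) $\mathrm{Max}(A)=\mathrm{Spec}(A)$; (4) $\mathcal{L}(A)$ is a Boolean lattice; (5) the lattice $\mathcal{L}(A)$ is isomorphic to $\mathcal{B}(\mathrm{Con}(A))$; (6) the lattice $\mathcal{L}(A)$ is isomorphic to $\mathcal{B}(\mathrm{Con}(A/\rho_A(\Delta_A)))$.
   Context: $\mathcal{C}$ is a variety (equational class) of algebras of some signature; congruence-modular means every member has a modular congruence lattice; semi-degenerate means no non-trivial algebra in $\mathcal{C}$ has one-element subalgebras (equivalently, $\nabla_M$ is a compact congruence for all members $M$). For a member $M$, $\mathrm{Con}(M)$ is the complete lattice of congruences of $M$, with meet $\cap$, join $\vee$, least element $\Delta_M$ and greatest element $\nabla_M=M^2$; $\mathrm{PCon}(M)$ is the set of principal congruences and $\mathcal{K}(M)$ the set of finitely generated (equivalently, compact) congruences of $M$; $\mathrm{Max}(M)$ is the set of maximal elements of $\mathrm{Con}(M)\setminus\{\nabla_M\}$. Commutator: for $\alpha,\beta,\mu\in\mathrm{Con}(M)$, $C(\alpha,\beta;\mu)$ means: for all $n,k\in\mathbb{N}$ and every term $t$ of arity $n+k$, if $(a_i,b_i)\in\alpha$ for $1\le i\le n$ and $(c_j,d_j)\in\beta$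 for $1\le j\le k$, then $(t^M(\vec a,\vec c),t^M(\vec a,\vec d))\in\mu$ iff $(t^M(\vec b,\vec c),t^M(\vec b,\vec d))\in\mu$. Put $[\alpha,\beta]_M=\bigcap\{\mu\mid C(\alpha,\beta;\mu)\}$, $[\alpha,\beta]_M^1=[\alpha,\beta]_M$ and $[\alpha,\beta]_M^{n+1}=[[\alpha,\beta]_M^n,[\alpha,\beta]_M^n]_M$ for $n\ge1$. Known facts: in a congruence-modular variety the commutator is commutative and distributive with respect to arbitrary joins in both arguments; if the variety is moreover semi-degenerate, then $[\theta,\nabla_M]_M=\theta$ for all $\theta\in\mathrm{Con}(M)$, every proper congruence is contained in a maximal one, and maximal congruences are prime. A congruence $\phi\neq\nabla_M$ is prime iff $[\alpha,\beta]_M\subseteq\phi$ implies $\alpha\subseteq\phi$ or $\beta\subseteq\phi$; $\mathrm{Spec}(M)$ is the set of prime congruences; $\rho_M(\theta)=\bigcap\{\phi\in\mathrm{Spec}(M)\mid\theta\subseteq\phi\}$ (empty intersection $=\nabla_M$); $\alpha\equiv_M\beta$ iff $\rho_M(\alpha)=\rho_M(\beta)$; $\widehat\alpha$ is the $\equiv_M$-class of $\alpha$. $\mathcal{L}(M)=\{\widehat\alpha\mid\alpha\in\mathcal{K}(M)\}$ is a bounded distributive lattice with $\widehat\alpha\vee\widehat\beta=\widehat{\alpha\vee\beta}$, $\widehat\alpha\wedge\widehat\beta=\widehat{[\alpha,\beta]_M}$, $\mathbf 0=\widehat{\Delta_M}$, $\mathbf 1=\widehat{\nabla_M}$. For a bounded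 lattice $L$, $\mathcal{B}(L)$ is the set of complemented elements of $L$. In this setting $\mathcal{B}(\mathrm{Con}(M))$ is a Boolean algebra, as a bounded sublattice of $\mathrm{Con}(M)$. $M$ is hyperarchimedean iff, for all $\alpha\in\mathrm{PCon}(M)$, there exists an $n\ge1$ such that $[\alpha,\alpha]_M^n\in\mathcal{B}(\mathrm{Con}(M))$. *)

theory Defs
  imports "HOL-Algebra.Congruence"
begin

section \<open>Signatures, terms, algebras, equational classes\<close>

text \<open>The operation symbols form a set rather than all of the type \<open>'f\<close>, so that the empty
  signature is covered.\<close>

record 'f signature =
  ops :: "'f set"
  arity :: "'f \<Rightarrow> nat"

datatype ('f, 'v) trm = Var 'v | Fn 'f "('f, 'v) trm list"

fun wf_trm :: "'f signature \<Rightarrow> 'v set \<Rightarrow> ('f, 'v) trm \<Rightarrow> bool" where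
  "wf_trm S V (Var x) \<longleftrightarrow> x \<in> V"
| "wf_trm S V (Fn f ts) \<longleftrightarrow> f \<in> ops S \<and> length ts = arity S f \<and> (\<forall>t\<in>set ts. wf_trm S V t)"

record ('f, 'a) algebra = "'a partial_object" +
  opn :: "'f \<Rightarrow> 'a list \<Rightarrow> 'a"

definition is_algebra :: "'f signature \<Rightarrow> ('f, 'a) algebra \<Rightarrow> bool" where
  "is_algebra S M \<longleftrightarrow> carrier M \<noteq> {} \<and>
     (\<forall>f\<in>ops S. \<forall>xs. length xs = arity S f \<and> set xs \<subseteq> carrier M \<longrightarrow> opn M f xs \<in> carrier M)"

fun eval :: "('f, 'a) algebra \<Rightarrow> ('v \<Rightarrow> 'a) \<Rightarrow> ('f, 'v) trm \<Rightarrow> 'a" where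
  "eval M v (Var x) = v x"
| "eval M v (Fn f ts) = opn M f (map (eval M v) ts)"

type_synonym 'f identities = "(('f, nat) trm \<times> ('f, nat) trm) set"

definition wf_identities :: "'f signature \<Rightarrow> 'f identities \<Rightarrow> bool" where
  "wf_identities S E \<longleftrightarrow> (\<forall>(s, t)\<in>E. wf_trm S UNIV s \<and> wf_trm S UNIV t)"

text \<open>HOL has no class of all algebras, so the variety axiomatised by \<open>E\<close> is represented by its
  members with carrier in a universe type \<open>'a\<close>.  If \<open>'a\<close> is infinite and has at least as many
  elements as there are operation symbols, then it has room for isomorphic copies of the free
  algebras on at most countably many generators and of the finite powers of each of these members.\<close>

definition variety :: "'f signature \<Rightarrow> 'f identities \<Rightarrow> ('f, 'a) algebra set" where
  "variety S E = {M. is_algebra S M \<and>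
     (\<forall>(s, t)\<in>E. \<forall>v. (\<forall>i. v i \<in> carrier M) \<longrightarrow> eval M v s = eval M v t)}"

definition large_universe :: "'f signature \<Rightarrow> 'a itself \<Rightarrow> bool" where
  "large_universe S _ \<longleftrightarrow> infinite (UNIV :: 'a set) \<and> (\<exists>g :: 'f \<Rightarrow> 'a. inj_on g (ops S))"

definition subuniverse :: "'f signature \<Rightarrow> ('f, 'a) algebra \<Rightarrow> 'a set \<Rightarrow> bool" where
  "subuniverse S M B \<longleftrightarrow> B \<subseteq> carrier M \<and>
     (\<forall>f\<in>ops S. \<forall>xs. length xs = arity S f \<and> set xs \<subseteq> B \<longrightarrow> opn M f xs \<in> B)"

definition semi_degenerate :: "'f signature \<Rightarrow> ('f, 'a) algebra set \<Rightarrow> bool" where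
  "semi_degenerate S \<C> \<longleftrightarrow>
     \<not> (\<exists>M\<in>\<C>. (\<nexists>x. carrier M = {x}) \<and> (\<exists>x. subuniverse S M {x}))"


section \<open>Bounded lattices given by their operations\<close>

record 'a lattice_ops = "'a partial_object" +
  jn :: "'a \<Rightarrow> 'a \<Rightarrow> 'a"
  mt :: "'a \<Rightarrow> 'a \<Rightarrow> 'a"
  bt :: 'a
  tp :: 'a

locale bdd_lattice =
  fixes L :: "'a lattice_ops"
  assumes jn_closed: "x \<in> carrier L \<Longrightarrow> y \<in> carrier L \<Longrightarrow> jn L x y \<in> carrier L"
    and mt_closed: "x \<in> carrier L \<Longrightarrow> y \<in> carrier L \<Longrightarrow> mt L x y \<in> carrier L"
    and bt_closed: "bt L \<in> carrier L"
    and tp_closed: "tp L \<in> carrier L"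
    and jn_assoc: "x \<in> carrier L \<Longrightarrow> y \<in> carrier L \<Longrightarrow> z \<in> carrier L \<Longrightarrow>
          jn L (jn L x y) z = jn L x (jn L y z)"
    and mt_assoc: "x \<in> carrier L \<Longrightarrow> y \<in> carrier L \<Longrightarrow> z \<in> carrier L \<Longrightarrow>
          mt L (mt L x y) z = mt L x (mt L y z)"
    and jn_comm: "x \<in> carrier L \<Longrightarrow> y \<in> carrier L \<Longrightarrow> jn L x y = jn L y x"
    and mt_comm: "x \<in> carrier L \<Longrightarrow> y \<in> carrier L \<Longrightarrow> mt L x y = mt L y x"
    and jn_absorb: "x \<in> carrier L \<Longrightarrow> y \<in> carrier L \<Longrightarrow> jn L x (mt L x y) = x"
    and mt_absorb: "x \<in> carrier L \<Longrightarrow> y \<in> carrier L \<Longrightarrow> mt L x (jn L x y) = x"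
    and jn_bt: "x \<in> carrier L \<Longrightarrow> jn L x (bt L) = x"
    and mt_tp: "x \<in> carrier L \<Longrightarrow> mt L x (tp L) = x"

locale modular_lattice = bdd_lattice +
  assumes modular: "x \<in> carrier L \<Longrightarrow> y \<in> carrier L \<Longrightarrow> z \<in> carrier L \<Longrightarrow> mt L x z = x \<Longrightarrow>
      jn L x (mt L y z) = mt L (jn L x y) z"

definition complemented :: "'a lattice_ops \<Rightarrow> 'a set" where
  "complemented L = {x \<in> carrier L. \<exists>y\<in>carrier L. jn L x y = tp L \<and> mt L x y = bt L}"

locale boolean_lattice = bdd_lattice +
  assumes distrib: "x \<in> carrier L \<Longrightarrow> y \<in> carrier L \<Longrightarrow> z \<in> carrier L \<Longrightarrow>
      mt L x (jn L y z) = jn L (mt L x y) (mt L x z)"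
    and all_complemented: "complemented L = carrier L"

definition boolean_center :: "'a lattice_ops \<Rightarrow> 'a lattice_ops" where
  "boolean_center L = L\<lparr>carrier := complemented L\<rparr>"

definition lattice_isomorphic :: "'a lattice_ops \<Rightarrow> 'b lattice_ops \<Rightarrow> bool" where
  "lattice_isomorphic L L' \<longleftrightarrow> (\<exists>h. bij_betw h (carrier L) (carrier L') \<and>
     (\<forall>x\<in>carrier L. \<forall>y\<in>carrier L.
        h (jn L x y) = jn L' (h x) (h y) \<and> h (mt L x y) = mt L' (h x) (h y)))"


section \<open>Congruences and quotients\<close>

definition Con :: "'f signature \<Rightarrow> ('f, 'a) algebra \<Rightarrow> 'a rel set" where
  "Con S M = {\<theta>. equiv (carrier M) \<theta> \<and>
     (\<forall>f\<in>ops S. \<forall>xs ys. length xs = arity S f \<and> list_all2 (\<lambda>x y. (x, y) \<in> \<theta>) xs ys \<longrightarrow>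
        (opn M f xs, opn M f ys) \<in> \<theta>)}"

definition Delta :: "('f, 'a) algebra \<Rightarrow> 'a rel" where
  "Delta M = Id_on (carrier M)"

definition Nabla :: "('f, 'a) algebra \<Rightarrow> 'a rel" where
  "Nabla M = carrier M \<times> carrier M"

definition Cg :: "'f signature \<Rightarrow> ('f, 'a) algebra \<Rightarrow> 'a rel \<Rightarrow> 'a rel" where
  "Cg S M X = \<Inter>{\<theta> \<in> Con S M. X \<subseteq> \<theta>}"

definition Con_lattice :: "'f signature \<Rightarrow> ('f, 'a) algebra \<Rightarrow> 'a rel lattice_ops" where
  "Con_lattice S M = \<lparr>carrier = Con S M, jn = (\<lambda>\<alpha> \<beta>. Cg S M (\<alpha> \<union> \<beta>)), mt = (\<inter>),
     bt = Delta M, tp = Nabla M\<rparr>"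

definition PCon :: "'f signature \<Rightarrow> ('f, 'a) algebra \<Rightarrow> 'a rel set" where
  "PCon S M = {Cg S M {(a, b)} | a b. a \<in> carrier M \<and> b \<in> carrier M}"

definition KCon :: "'f signature \<Rightarrow> ('f, 'a) algebra \<Rightarrow> 'a rel set" where
  "KCon S M = {Cg S M X | X. finite X \<and> X \<subseteq> Nabla M}"

definition Max_Con :: "'f signature \<Rightarrow> ('f, 'a) algebra \<Rightarrow> 'a rel set" where
  "Max_Con S M = {\<theta> \<in> Con S M - {Nabla M}. \<forall>\<phi>\<in>Con S M - {Nabla M}. \<theta> \<subseteq> \<phi> \<longrightarrow> \<phi> = \<theta>}"

text \<open>For a congruence \<open>\<theta>\<close> all the classes united below are equal: each is the class of the value of
  the operation at some choice of representatives.\<close>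

definition quot_alg :: "('f, 'a) algebra \<Rightarrow> 'a rel \<Rightarrow> ('f, 'a set) algebra" where
  "quot_alg M \<theta> = \<lparr>carrier = carrier M // \<theta>,
     opn = (\<lambda>f Xs. \<Union>xs\<in>listset Xs. \<theta> `` {opn M f xs})\<rparr>"


section \<open>Commutator, prime congruences, the reticulation\<close>

text \<open>The variables \<open>0, \<dots>, n + k - 1\<close> of \<open>t\<close> are evaluated at the entries of a list of length
  \<open>n + k\<close>.\<close>

definition centralizes ::
  "'f signature \<Rightarrow> ('f, 'a) algebra \<Rightarrow> 'a rel \<Rightarrow> 'a rel \<Rightarrow> 'a rel \<Rightarrow> bool" where
  "centralizes S M \<alpha> \<beta> \<mu> \<longleftrightarrow>
     (\<forall>n k. \<forall>t. wf_trm S {..<n + k} t \<longrightarrow>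
        (\<forall>as bs cs ds. length as = n \<and> length cs = k \<and>
             list_all2 (\<lambda>a b. (a, b) \<in> \<alpha>) as bs \<and> list_all2 (\<lambda>c d. (c, d) \<in> \<beta>) cs ds \<longrightarrow>
           ((eval M ((!) (as @ cs)) t, eval M ((!) (as @ ds)) t) \<in> \<mu> \<longleftrightarrow>
            (eval M ((!) (bs @ cs)) t, eval M ((!) (bs @ ds)) t) \<in> \<mu>)))"

definition commutator ::
  "'f signature \<Rightarrow> ('f, 'a) algebra \<Rightarrow> 'a rel \<Rightarrow> 'a rel \<Rightarrow> 'a rel" where
  "commutator S M \<alpha> \<beta> = \<Inter>{\<mu> \<in> Con S M. centralizes S M \<alpha> \<beta> \<mu>}"

text \<open>Only meaningful for exponents \<open>n \<ge> 1\<close>.\<close>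

definition comm_pow ::
  "'f signature \<Rightarrow> ('f, 'a) algebra \<Rightarrow> 'a rel \<Rightarrow> 'a rel \<Rightarrow> nat \<Rightarrow> 'a rel" where
  "comm_pow S M \<alpha> \<beta> n = ((\<lambda>\<gamma>. commutator S M \<gamma> \<gamma>) ^^ (n - 1)) (commutator S M \<alpha> \<beta>)"

definition Spec :: "'f signature \<Rightarrow> ('f, 'a) algebra \<Rightarrow> 'a rel set" where
  "Spec S M = {\<phi> \<in> Con S M. \<phi> \<noteq> Nabla M \<and>
     (\<forall>\<alpha>\<in>Con S M. \<forall>\<beta>\<in>Con S M. commutator S M \<alpha> \<beta> \<subseteq> \<phi> \<longrightarrow> \<alpha> \<subseteq> \<phi> \<or> \<beta> \<subseteq> \<phi>)}"

text \<open>Intersecting with \<open>Nabla M\<close> only matters when no prime congruence contains \<open>\<theta>\<close>.\<close>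

definition radical :: "'f signature \<Rightarrow> ('f, 'a) algebra \<Rightarrow> 'a rel \<Rightarrow> 'a rel" where
  "radical S M \<theta> = Nabla M \<inter> \<Inter>{\<phi> \<in> Spec S M. \<theta> \<subseteq> \<phi>}"

definition rad_class :: "'f signature \<Rightarrow> ('f, 'a) algebra \<Rightarrow> 'a rel \<Rightarrow> 'a rel set" where
  "rad_class S M \<alpha> = {\<beta> \<in> Con S M. radical S M \<alpha> = radical S M \<beta>}"

text \<open>The operations on classes are those induced by join and commutator of representatives; in a
  congruence-modular variety all the classes united below are equal.\<close>

definition reticulation :: "'f signature \<Rightarrow> ('f, 'a) algebra \<Rightarrow> 'a rel set lattice_ops" where
  "reticulation S M = \<lparr>carrier = rad_class S M ` KCon S M,
     jn = (\<lambda>X Y. \<Union>\<alpha>\<in>X. \<Union>\<beta>\<in>Y. rad_class S M (Cg S M (\<alpha> \<union> \<beta>))),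
     mt = (\<lambda>X Y. \<Union>\<alpha>\<in>X. \<Union>\<beta>\<in>Y. rad_class S M (commutator S M \<alpha> \<beta>)),
     bt = rad_class S M (Delta M), tp = rad_class S M (Nabla M)\<rparr>"

definition hyperarchimedean :: "'f signature \<Rightarrow> ('f, 'a) algebra \<Rightarrow> bool" where
  "hyperarchimedean S M \<longleftrightarrow>
     (\<forall>\<alpha>\<in>PCon S M. \<exists>n\<ge>1. comm_pow S M \<alpha> \<alpha> n \<in> complemented (Con_lattice S M))"

end

theory Submission
  imports Defs
begin

text \<open>The implications (1) \<open>\<Rightarrow>\<close> (3) \<open>\<Rightarrow>\<close> (4) and the passage to \<open>A/\<rho>(\<Delta>)\<close> are as for commutative rings.
  The crucial point is (4) \<open>\<Rightarrow>\<close> (1): if \<open>\<alpha> \<or> \<beta> = \<nabla>\<close> and \<open>[\<alpha>, \<beta>]\<close> is nilpotent, then some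
  \<open>[\<alpha>, \<alpha>]\<^sup>n\<close> and \<open>[\<beta>, \<beta>]\<^sup>n\<close> have intersection \<open>\<Delta>\<close>.  Since the commutator is not associative, this
  is not a formal consequence of its lattice-theoretic properties.  It follows from
  \<open>[\<sigma>, \<alpha>] \<inter> [\<sigma>, \<beta>] \<subseteq> [\<alpha> \<inter> \<beta>, \<sigma>]\<close>, valid for compact \<open>\<alpha>\<close>, \<open>\<beta>\<close> with join \<open>\<nabla>\<close> and all \<open>\<sigma>\<close>: with
  \<open>\<sigma> = \<beta>, \<alpha>, \<alpha> \<inter> \<beta>\<close> in turn it gives \<open>[\<alpha>, \<alpha>] \<inter> [\<beta>, \<beta>] \<subseteq> [\<alpha> \<inter> \<beta>, \<alpha> \<inter> \<beta>]\<close>, where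
  \<open>\<alpha> \<inter> \<beta> = [\<alpha>, \<beta>]\<close>.  This inclusion uses the closure of \<open>\<K>\<close> under the commutator not in \<open>A\<close> but
  in the algebra of eventually constant sequences of \<open>\<sigma>\<close>-related elements of \<open>A\<close>.\<close>

section \<open>Terms, congruences and unary polynomials\<close>

text \<open>Symmetry and distributivity of the commutator,
  \<open>[\<theta>, \<nabla>] = \<theta>\<close> and compactness of \<open>\<nabla>\<close> are not
  among the hypotheses; they are derived from modularity and semi-degeneracy of suitable subalgebras
  of powers. These live on function types, whereas the hypotheses speak only of algebras on
  \<open>'u\<close>, so each one must be shown small enough to be copied into \<open>'u\<close>.
  This decides the constructions: finite powers, an algebra generated by two elements of a huge
  power, and eventually constant sequences instead of all sequences. The quotient by the radical of
  \<open>\<Delta>\<close> has sets as elements and is never treated as a member of the variety. Its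
  congruences are read as the congruences of \<open>A\<close> above that radical, and its commutator
  as the commutator of \<open>A\<close> joined with the radical. Conditions (5) and (6) are then the
  cases \<open>r = \<Delta>\<close> and \<open>r = \<rho>(\<Delta>)\<close> of one statement about
  the interval from \<open>r\<close> to \<open>\<nabla>\<close>, for \<open>r\<close> below the
  radical. All conditions are compared with \<open>compl_mod_rad\<close>, a statement about compact
  congruences of \<open>A\<close>.\<close>

lemma eval_cong:
  "wf_trm S V t \<Longrightarrow> (\<And>x. x \<in> V \<Longrightarrow> u x = w x) \<Longrightarrow> eval M u t = eval M w t"
  by (induction t) (auto cong: map_cong)

lemma eval_map_trm: "eval M v (map_trm id g t) = eval M (v \<circ> g) t"
  by (induction t) (auto simp: comp_def cong: map_cong)

lemma wf_map_trm: "wf_trm S V t \<Longrightarrow> g ` V \<subseteq> W \<Longrightarrow> wf_trm S W (map_trm id g t)"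
  by (induction t) auto

lemma wf_trm_mono: "wf_trm S V t \<Longrightarrow> V \<subseteq> W \<Longrightarrow> wf_trm S W t"
  by (induction t) auto

lemma wf_trm_vars: "wf_trm S V t \<Longrightarrow> finite (set2_trm t) \<and> set2_trm t \<subseteq> V \<and> wf_trm S (set2_trm t) t"
proof (induction t)
  case (Fn f ts)
  then have *: "finite (set2_trm t)" "set2_trm t \<subseteq> V" "wf_trm S (set2_trm t) t" if "t \<in> set ts" for t
    using that by simp_all
  have "wf_trm S (set2_trm (Fn f ts)) t" if "t \<in> set ts" for t
    by (rule wf_trm_mono[OF *(3)]) (use that in auto)
  with * Fn.prems show ?case by (auto simp: subset_iff)
qed simp

lemma eval_closed:
  "is_algebra S M \<Longrightarrow> wf_trm S V t \<Longrightarrow> (\<And>x. x \<in> V \<Longrightarrow> v x \<in> carrier M) \<Longrightarrow> eval M v t \<in> carrier M"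
proof (induction t)
  case (Fn f ts)
  then have "set (map (eval M v) ts) \<subseteq> carrier M" by auto
  with Fn.prems show ?case unfolding is_algebra_def by auto
qed simp

lemma algebra_op:
  "is_algebra S M \<Longrightarrow> f \<in> ops S \<Longrightarrow> length xs = arity S f \<Longrightarrow> set xs \<subseteq> carrier M \<Longrightarrow>
    opn M f xs \<in> carrier M"
  by (simp add: is_algebra_def)

lemma Con_sub: "\<theta> \<in> Con S M \<Longrightarrow> (x, y) \<in> \<theta> \<Longrightarrow> x \<in> carrier M \<and> y \<in> carrier M"
  unfolding Con_def equiv_def by blast

lemma Con_Nabla: "\<theta> \<in> Con S M \<Longrightarrow> \<theta> \<subseteq> Nabla M"
  unfolding Nabla_def using Con_sub by fastforce

lemma Con_refl: "\<theta> \<in> Con S M \<Longrightarrow> x \<in> carrier M \<Longrightarrow> (x, x) \<in> \<theta>"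
  unfolding Con_def equiv_def refl_on_def by blast

lemma Con_sym: "\<theta> \<in> Con S M \<Longrightarrow> (x, y) \<in> \<theta> \<Longrightarrow> (y, x) \<in> \<theta>"
  unfolding Con_def equiv_def by (blast dest: symD)

lemma Con_trans: "\<theta> \<in> Con S M \<Longrightarrow> (x, y) \<in> \<theta> \<Longrightarrow> (y, z) \<in> \<theta> \<Longrightarrow> (x, z) \<in> \<theta>"
  unfolding Con_def equiv_def by (blast dest: transD)

lemma Con_op:
  "\<theta> \<in> Con S M \<Longrightarrow> f \<in> ops S \<Longrightarrow> length xs = arity S f \<Longrightarrow>
    list_all2 (\<lambda>x y. (x, y) \<in> \<theta>) xs ys \<Longrightarrow> (opn M f xs, opn M f ys) \<in> \<theta>"
  unfolding Con_def by blast

lemma ConI: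
  assumes "\<theta> \<subseteq> Nabla M" "\<And>x. x \<in> carrier M \<Longrightarrow> (x, x) \<in> \<theta>"
    and "\<And>x y. (x, y) \<in> \<theta> \<Longrightarrow> (y, x) \<in> \<theta>"
    and "\<And>x y z. (x, y) \<in> \<theta> \<Longrightarrow> (y, z) \<in> \<theta> \<Longrightarrow> (x, z) \<in> \<theta>"
    and "\<And>f xs ys. f \<in> ops S \<Longrightarrow> length xs = arity S f \<Longrightarrow>
      list_all2 (\<lambda>x y. (x, y) \<in> \<theta>) xs ys \<Longrightarrow> (opn M f xs, opn M f ys) \<in> \<theta>"
  shows "\<theta> \<in> Con S M"
proof -
  have "refl_on (carrier M) \<theta>" using assms(2) by (auto simp: refl_on_def)
  moreover have "sym \<theta>" using assms(3) by (auto intro: symI)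
  moreover have "trans \<theta>" using assms(4) by (blast intro: transI)
  ultimately show ?thesis using assms(1,5) unfolding Con_def equiv_def Nabla_def by blast
qed

lemma list_all2_carrier:
  assumes "\<theta> \<subseteq> Nabla M"
  shows "list_all2 (\<lambda>x y. (x, y) \<in> \<theta>) xs ys \<Longrightarrow>
    set xs \<subseteq> carrier M \<and> set ys \<subseteq> carrier M \<and> length ys = length xs"
  by (induction rule: list_all2_induct) (use assms in \<open>auto simp: Nabla_def\<close>)

text \<open>Arguments are exchanged one at a time from the left, \<open>us\<close> collecting those
  already exchanged, and transitivity joins the steps. The criterion suits \<open>Syn\<close>, which
  controls only unary polynomials.\<close>

lemma Con_translationI:
  assumes alg: "is_algebra S M" and sub: "\<theta> \<subseteq> Nabla M"
    and refl: "\<And>x. x \<in> carrier M \<Longrightarrow> (x, x) \<in> \<theta>"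
    and sym: "\<And>x y. (x, y) \<in> \<theta> \<Longrightarrow> (y, x) \<in> \<theta>"
    and trans: "\<And>x y z. (x, y) \<in> \<theta> \<Longrightarrow> (y, z) \<in> \<theta> \<Longrightarrow> (x, z) \<in> \<theta>"
    and op: "\<And>f us vs x y. f \<in> ops S \<Longrightarrow> length (us @ x # vs) = arity S f \<Longrightarrow>
      set us \<subseteq> carrier M \<Longrightarrow> set vs \<subseteq> carrier M \<Longrightarrow> (x, y) \<in> \<theta> \<Longrightarrow>
      (opn M f (us @ x # vs), opn M f (us @ y # vs)) \<in> \<theta>"
  shows "\<theta> \<in> Con S M"
proof (rule ConI[OF sub refl sym trans])
  fix f and xs ys :: "'b list"
  assume f: "f \<in> ops S" and len: "length xs = arity S f"
    and rel: "list_all2 (\<lambda>x y. (x, y) \<in> \<theta>) xs ys"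
  have "set us \<subseteq> carrier M \<Longrightarrow> set xs \<subseteq> carrier M \<Longrightarrow> length (us @ xs) = arity S f \<Longrightarrow>
      (opn M f (us @ xs), opn M f (us @ ys)) \<in> \<theta>" for us
    using rel
  proof (induction xs ys arbitrary: us rule: list_all2_induct)
    case Nil
    then show ?case using f by (auto intro!: refl algebra_op[OF alg])
  next
    case (Cons x xs y ys)
    have y: "y \<in> carrier M" using sub Cons by (auto simp: Nabla_def)
    have "(opn M f (us @ x # xs), opn M f (us @ y # xs)) \<in> \<theta>"
      using Cons f by (intro op) auto
    moreover have "(opn M f ((us @ [y]) @ xs), opn M f ((us @ [y]) @ ys)) \<in> \<theta>"
      using Cons y by (intro Cons.IH) auto
    ultimately show ?case using trans by auto
  qed
  from this[of "[]"] show "(opn M f xs, opn M f ys) \<in> \<theta>"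
    using list_all2_carrier[OF sub rel] len by simp
qed

lemma Con_eval:
  assumes "\<theta> \<in> Con S M"
  shows "wf_trm S V t \<Longrightarrow> (\<And>x. x \<in> V \<Longrightarrow> (u x, w x) \<in> \<theta>) \<Longrightarrow> (eval M u t, eval M w t) \<in> \<theta>"
proof (induction t)
  case (Fn f ts)
  then have "list_all2 (\<lambda>x y. (x, y) \<in> \<theta>) (map (eval M u) ts) (map (eval M w) ts)"
    by (auto simp: list_all2_conv_all_nth)
  then show ?case using Fn.prems by (auto intro: Con_op[OF assms])
qed simp

lemma Nabla_Con: "is_algebra S M \<Longrightarrow> Nabla M \<in> Con S M"
proof (rule ConI)
  fix f xs ys assume "is_algebra S M" "f \<in> ops S" "length xs = arity S f"
    "list_all2 (\<lambda>x y. (x, y) \<in> Nabla M) xs ys"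
  with list_all2_carrier[of "Nabla M" M xs ys]
  show "(opn M f xs, opn M f ys) \<in> Nabla M"
    using algebra_op[of S M f xs] algebra_op[of S M f ys] by (auto simp: Nabla_def)
qed (auto simp: Nabla_def)

lemma Delta_Con: "is_algebra S M \<Longrightarrow> Delta M \<in> Con S M"
proof (rule ConI)
  fix f xs ys assume *: "is_algebra S M" "f \<in> ops S" "length xs = arity S f"
    "list_all2 (\<lambda>x y. (x, y) \<in> Delta M) xs ys"
  then have "xs = ys" by (auto simp: list_all2_conv_all_nth Delta_def intro!: nth_equalityI)
  moreover have "set xs \<subseteq> carrier M"
    using *(4) list_all2_carrier[of "Delta M" M xs ys] by (auto simp: Delta_def Nabla_def)
  ultimately show "(opn M f xs, opn M f ys) \<in> Delta M"
    using * algebra_op[of S M f xs] by (auto simp: Delta_def)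
qed (auto simp: Delta_def Nabla_def)

lemma Delta_least: "\<theta> \<in> Con S M \<Longrightarrow> Delta M \<subseteq> \<theta>"
  by (auto simp: Delta_def intro: Con_refl)

lemma Delta_iff: "(x, y) \<in> Delta M \<longleftrightarrow> x \<in> carrier M \<and> x = y"
  by (auto simp: Delta_def)

lemma Inter_Con:
  assumes "X \<noteq> {}" "X \<subseteq> Con S M"
  shows "\<Inter>X \<in> Con S M"
proof (rule ConI)
  show "\<Inter>X \<subseteq> Nabla M" using assms Con_Nabla by blast
  show "(x, x) \<in> \<Inter>X" if "x \<in> carrier M" for x using assms that by (auto intro: Con_refl)
  show "(y, x) \<in> \<Inter>X" if "(x, y) \<in> \<Inter>X" for x y using assms that by (blast intro: Con_sym)
  show "(x, z) \<in> \<Inter>X" if "(x, y) \<in> \<Inter>X" "(y, z) \<in> \<Inter>X" for x y z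
    using assms that by (blast intro: Con_trans)
  fix f xs ys assume *: "f \<in> ops S" "length xs = arity S f" "list_all2 (\<lambda>x y. (x, y) \<in> \<Inter>X) xs ys"
  show "(opn M f xs, opn M f ys) \<in> \<Inter>X"
  proof
    fix \<theta> assume "\<theta> \<in> X"
    then have "list_all2 (\<lambda>x y. (x, y) \<in> \<theta>) xs ys"
      using *(3) by (auto elim!: list_all2_mono)
    with * assms \<open>\<theta> \<in> X\<close> show "(opn M f xs, opn M f ys) \<in> \<theta>" by (blast intro: Con_op)
  qed
qed

lemma Int_Con: "\<alpha> \<in> Con S M \<Longrightarrow> \<beta> \<in> Con S M \<Longrightarrow> \<alpha> \<inter> \<beta> \<in> Con S M"
  using Inter_Con[of "{\<alpha>, \<beta>}" S M] by auto

lemma Cg_Con: "is_algebra S M \<Longrightarrow> X \<subseteq> Nabla M \<Longrightarrow> Cg S M X \<in> Con S M"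
  unfolding Cg_def using Nabla_Con by (intro Inter_Con) blast+

lemma Cg_ge: "X \<subseteq> Cg S M X"
  unfolding Cg_def by blast

lemma Cg_least: "\<theta> \<in> Con S M \<Longrightarrow> X \<subseteq> \<theta> \<Longrightarrow> Cg S M X \<subseteq> \<theta>"
  unfolding Cg_def by blast

lemma Cg_mono: "X \<subseteq> Y \<Longrightarrow> Cg S M X \<subseteq> Cg S M Y"
  unfolding Cg_def by blast

lemma chain_Union_Con:
  assumes "X \<noteq> {}" "X \<subseteq> Con S M" "subset.chain Y X"
  shows "\<Union>X \<in> Con S M"
proof (rule ConI)
  have dir: "\<exists>\<theta>\<in>X. F \<subseteq> \<theta>" if "finite F" "F \<subseteq> \<Union>X" for F
    using finite_subset_Union_chain[OF that assms(1,3)] by blast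
  show "\<Union>X \<subseteq> Nabla M" using assms Con_Nabla by blast
  show "(x, x) \<in> \<Union>X" if "x \<in> carrier M" for x using assms that by (blast intro: Con_refl)
  show "(y, x) \<in> \<Union>X" if "(x, y) \<in> \<Union>X" for x y using assms that by (blast intro: Con_sym)
  show "(x, z) \<in> \<Union>X" if "(x, y) \<in> \<Union>X" "(y, z) \<in> \<Union>X" for x y z
  proof -
    from that dir[of "{(x, y), (y, z)}"] obtain \<theta> where "\<theta> \<in> X" "(x, y) \<in> \<theta>" "(y, z) \<in> \<theta>" by auto
    with assms show ?thesis by (blast intro: Con_trans)
  qed
  fix f xs ys assume *: "f \<in> ops S" "length xs = arity S f" "list_all2 (\<lambda>x y. (x, y) \<in> \<Union>X) xs ys"
  then obtain \<theta> where "\<theta> \<in> X" "set (zip xs ys) \<subseteq> \<theta>"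
    using dir[of "set (zip xs ys)"] by (auto simp: list_all2_iff)
  then have "list_all2 (\<lambda>x y. (x, y) \<in> \<theta>) xs ys" using *(3) by (auto simp: list_all2_iff)
  with * assms \<open>\<theta> \<in> X\<close> show "(opn M f xs, opn M f ys) \<in> \<Union>X" by (blast intro: Con_op)
qed

text \<open>The union \<open>\<theta>\<close> of the congruences generated by finite subsets of
  \<open>X\<close> is itself a congruence: each closure condition involves finitely many pairs, and
  by \<open>dir\<close> these lie in one of the generated congruences.\<close>

lemma Cg_finitary:
  assumes alg: "is_algebra S M" and X: "X \<subseteq> Nabla M" and xy: "(x, y) \<in> Cg S M X"
  shows "\<exists>F. finite F \<and> F \<subseteq> X \<and> (x, y) \<in> Cg S M F"
proof -
  define \<theta> where "\<theta> = {p. \<exists>F. finite F \<and> F \<subseteq> X \<and> p \<in> Cg S M F}"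
  have con: "Cg S M F \<in> Con S M" if "F \<subseteq> X" for F using Cg_Con[OF alg] that X by blast
  have dir: "\<exists>F. finite F \<and> F \<subseteq> X \<and> P \<subseteq> Cg S M F" if "finite P" "P \<subseteq> \<theta>" for P
    using that
  proof induction
    case empty
    then show ?case by blast
  next
    case (insert p P)
    then obtain F G where "finite F" "F \<subseteq> X" "P \<subseteq> Cg S M F" "finite G" "G \<subseteq> X" "p \<in> Cg S M G"
      by (auto simp: \<theta>_def)
    then show ?case
      using Cg_mono[of F "F \<union> G" S M] Cg_mono[of G "F \<union> G" S M] by (intro exI[of _ "F \<union> G"]) auto
  qed
  have "\<theta> \<in> Con S M"
  proof (rule ConI)
    show "\<theta> \<subseteq> Nabla M" using con Con_Nabla unfolding \<theta>_def by blast
    show "(x, x) \<in> \<theta>" if "x \<in> carrier M" for x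
      using Con_refl[OF con[of "{}"] that] unfolding \<theta>_def by blast
    show "(y, x) \<in> \<theta>" if "(x, y) \<in> \<theta>" for x y
      using that Con_sym[OF con] unfolding \<theta>_def by blast
    show "(x, z) \<in> \<theta>" if "(x, y) \<in> \<theta>" "(y, z) \<in> \<theta>" for x y z
    proof -
      from dir[of "{(x, y), (y, z)}"] that obtain F where
        F: "finite F" "F \<subseteq> X" "(x, y) \<in> Cg S M F" "(y, z) \<in> Cg S M F" by auto
      then have "(x, z) \<in> Cg S M F" using Con_trans[OF con] by blast
      with F show ?thesis unfolding \<theta>_def by blast
    qed
    fix f xs ys assume *: "f \<in> ops S" "length xs = arity S f" "list_all2 (\<lambda>x y. (x, y) \<in> \<theta>) xs ys"
    then obtain F where F: "finite F" "F \<subseteq> X" "set (zip xs ys) \<subseteq> Cg S M F"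
      using dir[of "set (zip xs ys)"] by (auto simp: list_all2_iff)
    then have "list_all2 (\<lambda>x y. (x, y) \<in> Cg S M F) xs ys" using *(3) by (auto simp: list_all2_iff)
    then have "(opn M f xs, opn M f ys) \<in> Cg S M F" using * Con_op[OF con[OF F(2)]] by blast
    with F show "(opn M f xs, opn M f ys) \<in> \<theta>" unfolding \<theta>_def by blast
  qed
  moreover have "X \<subseteq> \<theta>"
  proof
    fix p assume "p \<in> X"
    then show "p \<in> \<theta>" unfolding \<theta>_def using Cg_ge[of "{p}" S M] by (auto intro!: exI[of _ "{p}"])
  qed
  ultimately have "(x, y) \<in> \<theta>" using xy Cg_least by blast
  then show ?thesis by (simp add: \<theta>_def)
qed

text \<open>Polynomials are taken as functions, not as terms with parameters: only their values
  enter \<open>Syn\<close>, and composition needs no renaming of variables.\<close>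

inductive pol :: "'f signature \<Rightarrow> ('f, 'a) algebra \<Rightarrow> ('a \<Rightarrow> 'a) \<Rightarrow> bool" for S M where
  pol_id: "pol S M (\<lambda>x. x)"
| pol_const: "c \<in> carrier M \<Longrightarrow> pol S M (\<lambda>_. c)"
| pol_op: "f \<in> ops S \<Longrightarrow> length ps = arity S f \<Longrightarrow> \<forall>p\<in>set ps. pol S M p \<Longrightarrow>
    pol S M (\<lambda>x. opn M f (map (\<lambda>p. p x) ps))"

lemma pol_comp: "pol S M p \<Longrightarrow> pol S M q \<Longrightarrow> pol S M (\<lambda>x. p (q x))"
proof (induction rule: pol.induct)
  case (pol_op f ps)
  have "pol S M (\<lambda>x. opn M f (map (\<lambda>p. p x) (map (\<lambda>p x. p (q x)) ps)))"
    using pol_op by (intro pol.pol_op) auto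
  then show ?case by (simp add: comp_def)
qed (auto intro: pol.intros)

lemma pol_Con:
  assumes "\<theta> \<in> Con S M"
  shows "pol S M p \<Longrightarrow> (x, y) \<in> \<theta> \<Longrightarrow> (p x, p y) \<in> \<theta>"
proof (induction rule: pol.induct)
  case (pol_op f ps)
  then show ?case by (intro Con_op[OF assms]) (auto simp: list_all2_conv_all_nth)
qed (auto intro: Con_refl[OF assms])

text \<open>The syntactic congruence of \<open>D\<close>: the largest congruence of which \<open>D\<close> is a union of
  classes.\<close>

definition Syn :: "'f signature \<Rightarrow> ('f, 'a) algebra \<Rightarrow> 'a set \<Rightarrow> 'a rel" where
  "Syn S M D = {(x, y) \<in> carrier M \<times> carrier M. \<forall>p. pol S M p \<longrightarrow> (p x \<in> D \<longleftrightarrow> p y \<in> D)}"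

lemma Syn_Con:
  assumes alg: "is_algebra S M"
  shows "Syn S M D \<in> Con S M"
proof (rule Con_translationI[OF alg])
  fix f us vs x y
  assume *: "f \<in> ops S" "length (us @ x # vs) = arity S f" "set us \<subseteq> carrier M" "set vs \<subseteq> carrier M"
    "(x, y) \<in> Syn S M D"
  define q where "q = (\<lambda>z. opn M f (us @ z # vs))"
  have "pol S M (\<lambda>x. opn M f (map (\<lambda>p. p x) (map (\<lambda>u _. u) us @ (\<lambda>x. x) # map (\<lambda>u _. u) vs)))"
    using * by (intro pol_op) (auto intro: pol.intros)
  then have q: "pol S M q" by (simp add: q_def comp_def)
  have "q x \<in> carrier M" "q y \<in> carrier M"
    using * unfolding q_def by (auto simp: Syn_def intro!: algebra_op[OF alg])
  moreover have "p (q x) \<in> D \<longleftrightarrow> p (q y) \<in> D" if "pol S M p" for p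
    using *(5) pol_comp[OF that q] unfolding Syn_def by auto
  ultimately show "(opn M f (us @ x # vs), opn M f (us @ y # vs)) \<in> Syn S M D"
    unfolding Syn_def q_def by auto
qed (auto simp: Syn_def Nabla_def)

lemma Syn_saturated: "(x, y) \<in> Syn S M D \<Longrightarrow> x \<in> D \<longleftrightarrow> y \<in> D"
  unfolding Syn_def using pol_id by blast

text \<open>One direction suffices, since \<open>\<theta>\<close> is symmetric and unary polynomials
  preserve it. Facts about a generated congruence are later proved by finding a set \<open>D\<close>
  that its generators preserve.\<close>

lemma Con_le_Syn:
  assumes "\<theta> \<in> Con S M" "\<And>x y. (x, y) \<in> \<theta> \<Longrightarrow> x \<in> D \<Longrightarrow> y \<in> D"
  shows "\<theta> \<subseteq> Syn S M D"
proof
  fix p assume "p \<in> \<theta>"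
  then obtain x y where p: "p = (x, y)" "(x, y) \<in> \<theta>" by (cases p) auto
  have "q x \<in> D \<longleftrightarrow> q y \<in> D" if "pol S M q" for q
    using assms(2) pol_Con[OF assms(1) that p(2)] Con_sym[OF assms(1)] by blast
  then show "p \<in> Syn S M D" using p Con_sub[OF assms(1)] unfolding Syn_def by blast
qed

section \<open>Homomorphisms\<close>

definition alg_hom :: "'f signature \<Rightarrow> ('f, 'a) algebra \<Rightarrow> ('f, 'b) algebra \<Rightarrow> ('a \<Rightarrow> 'b) \<Rightarrow> bool" where
  "alg_hom S M N \<pi> \<longleftrightarrow> \<pi> ` carrier M \<subseteq> carrier N \<and>
     (\<forall>f\<in>ops S. \<forall>xs. length xs = arity S f \<and> set xs \<subseteq> carrier M \<longrightarrow>
        \<pi> (opn M f xs) = opn N f (map \<pi> xs))"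

definition pre :: "('f, 'a) algebra \<Rightarrow> ('a \<Rightarrow> 'b) \<Rightarrow> 'b rel \<Rightarrow> 'a rel" where
  "pre M \<pi> \<theta> = {(x, y) \<in> carrier M \<times> carrier M. (\<pi> x, \<pi> y) \<in> \<theta>}"

definition img :: "('a \<Rightarrow> 'b) \<Rightarrow> 'a rel \<Rightarrow> 'b rel" where
  "img \<pi> \<theta> = (\<lambda>(x, y). (\<pi> x, \<pi> y)) ` \<theta>"

lemma alg_hom_op:
  "alg_hom S M N \<pi> \<Longrightarrow> f \<in> ops S \<Longrightarrow> length xs = arity S f \<Longrightarrow> set xs \<subseteq> carrier M \<Longrightarrow>
    \<pi> (opn M f xs) = opn N f (map \<pi> xs)"
  unfolding alg_hom_def by blast

lemma pre_mono: "\<alpha> \<subseteq> \<beta> \<Longrightarrow> pre M \<pi> \<alpha> \<subseteq> pre M \<pi> \<beta>"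
  unfolding pre_def by blast

lemma pre_Int: "pre M \<pi> (\<alpha> \<inter> \<beta>) = pre M \<pi> \<alpha> \<inter> pre M \<pi> \<beta>"
  unfolding pre_def by blast

lemma pre_Con:
  assumes alg: "is_algebra S M" and hom: "alg_hom S M N \<pi>" and \<theta>: "\<theta> \<in> Con S N"
  shows "pre M \<pi> \<theta> \<in> Con S M"
proof (rule ConI)
  show "pre M \<pi> \<theta> \<subseteq> Nabla M" by (auto simp: pre_def Nabla_def)
  show "(x, x) \<in> pre M \<pi> \<theta>" if "x \<in> carrier M" for x
    using that hom by (auto simp: pre_def alg_hom_def intro: Con_refl[OF \<theta>])
  show "(y, x) \<in> pre M \<pi> \<theta>" if "(x, y) \<in> pre M \<pi> \<theta>" for x y
    using that by (auto simp: pre_def intro: Con_sym[OF \<theta>])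
  show "(x, z) \<in> pre M \<pi> \<theta>" if "(x, y) \<in> pre M \<pi> \<theta>" "(y, z) \<in> pre M \<pi> \<theta>" for x y z
    using that by (auto simp: pre_def intro: Con_trans[OF \<theta>])
  fix f xs ys assume *: "f \<in> ops S" "length xs = arity S f" "list_all2 (\<lambda>x y. (x, y) \<in> pre M \<pi> \<theta>) xs ys"
  have c: "set xs \<subseteq> carrier M \<and> set ys \<subseteq> carrier M \<and> length ys = length xs"
    by (rule list_all2_carrier[OF _ *(3)]) (auto simp: pre_def Nabla_def)
  have "list_all2 (\<lambda>x y. (x, y) \<in> \<theta>) (map \<pi> xs) (map \<pi> ys)"
    using *(3) by (auto simp: list_all2_conv_all_nth pre_def)
  then have "(opn N f (map \<pi> xs), opn N f (map \<pi> ys)) \<in> \<theta>"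
    using * by (intro Con_op[OF \<theta>]) auto
  then show "(opn M f xs, opn M f ys) \<in> pre M \<pi> \<theta>"
    using c * alg_hom_op[OF hom] algebra_op[OF alg] by (auto simp: pre_def)
qed

lemma eval_hom:
  assumes alg: "is_algebra S M" and hom: "alg_hom S M N \<pi>"
  shows "wf_trm S V t \<Longrightarrow> (\<And>x. x \<in> V \<Longrightarrow> v x \<in> carrier M) \<Longrightarrow>
    \<pi> (eval M v t) = eval N (\<lambda>x. \<pi> (v x)) t"
proof (induction t)
  case (Fn f ts)
  have "set (map (eval M v) ts) \<subseteq> carrier M"
    using Fn.prems eval_closed[OF alg, of V _ v] by auto
  then have "\<pi> (eval M v (Fn f ts)) = opn N f (map \<pi> (map (eval M v) ts))"
    using Fn.prems by (simp add: alg_hom_op[OF hom])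
  also have "map \<pi> (map (eval M v) ts) = map (eval N (\<lambda>x. \<pi> (v x))) ts"
    using Fn by auto
  finally show ?case by simp
qed simp

lemma list_all2_img:
  "list_all2 (\<lambda>x y. (x, y) \<in> img \<pi> \<theta>) us vs \<Longrightarrow>
    \<exists>xs ys. us = map \<pi> xs \<and> vs = map \<pi> ys \<and> list_all2 (\<lambda>x y. (x, y) \<in> \<theta>) xs ys"
proof (induction rule: list_all2_induct)
  case (Cons u us v vs)
  then obtain xs ys x y where "us = map \<pi> xs" "vs = map \<pi> ys" "list_all2 (\<lambda>x y. (x, y) \<in> \<theta>) xs ys"
    "(x, y) \<in> \<theta>" "u = \<pi> x" "v = \<pi> y" by (auto simp: img_def)
  then show ?case by (intro exI[of _ "x # xs"] exI[of _ "y # ys"]) auto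
qed simp

text \<open>An arbitrary onto homomorphism rather than a quotient map: copies in the universe,
  images with a prescribed kernel and \<open>quot_alg\<close> are all instances.\<close>

locale onto_hom =
  fixes S :: "'f signature" and M :: "('f, 'a) algebra" and N :: "('f, 'b) algebra" and \<pi> :: "'a \<Rightarrow> 'b"
  assumes alg: "is_algebra S M" and algN: "is_algebra S N"
    and hom: "alg_hom S M N \<pi>" and onto: "\<pi> ` carrier M = carrier N"
begin

abbreviation ker :: "'a rel" where "ker \<equiv> pre M \<pi> (Delta N)"

lemma ker_Con: "ker \<in> Con S M"
  by (rule pre_Con[OF alg hom Delta_Con[OF algN]])

lemma ker_iff: "(x, y) \<in> ker \<longleftrightarrow> x \<in> carrier M \<and> y \<in> carrier M \<and> \<pi> x = \<pi> y"
  using onto by (auto simp: pre_def Delta_def)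

lemma ker_le_pre: "\<theta> \<in> Con S N \<Longrightarrow> ker \<subseteq> pre M \<pi> \<theta>"
  by (intro pre_mono Delta_least)

lemma pre_Nabla: "pre M \<pi> (Nabla N) = Nabla M"
  using onto by (auto simp: pre_def Nabla_def)

lemma img_pre: "\<theta> \<subseteq> Nabla N \<Longrightarrow> img \<pi> (pre M \<pi> \<theta>) = \<theta>"
proof
  assume \<theta>: "\<theta> \<subseteq> Nabla N"
  show "img \<pi> (pre M \<pi> \<theta>) \<subseteq> \<theta>" by (auto simp: img_def pre_def)
  show "\<theta> \<subseteq> img \<pi> (pre M \<pi> \<theta>)"
  proof (rule subrelI)
    fix u v assume uv: "(u, v) \<in> \<theta>"
    then have "u \<in> \<pi> ` carrier M" "v \<in> \<pi> ` carrier M" using \<theta> onto by (auto simp: Nabla_def)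
    then obtain x y where "x \<in> carrier M" "y \<in> carrier M" "u = \<pi> x" "v = \<pi> y" by blast
    with uv have "(x, y) \<in> pre M \<pi> \<theta>" "(u, v) = (\<lambda>(x, y). (\<pi> x, \<pi> y)) (x, y)"
      by (auto simp: pre_def)
    then show "(u, v) \<in> img \<pi> (pre M \<pi> \<theta>)" unfolding img_def by blast
  qed
qed

lemma pre_inj: "\<alpha> \<in> Con S N \<Longrightarrow> \<beta> \<in> Con S N \<Longrightarrow> pre M \<pi> \<alpha> = pre M \<pi> \<beta> \<Longrightarrow> \<alpha> = \<beta>"
  using img_pre Con_Nabla by metis

lemma pre_img:
  assumes "\<theta> \<in> Con S M" "ker \<subseteq> \<theta>"
  shows "pre M \<pi> (img \<pi> \<theta>) = \<theta>"
proof
  show "\<theta> \<subseteq> pre M \<pi> (img \<pi> \<theta>)" using Con_sub[OF assms(1)] by (auto simp: pre_def img_def)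
  show "pre M \<pi> (img \<pi> \<theta>) \<subseteq> \<theta>"
  proof (rule subrelI)
    fix x y assume "(x, y) \<in> pre M \<pi> (img \<pi> \<theta>)"
    then obtain x' y' where *: "x \<in> carrier M" "y \<in> carrier M" "(x', y') \<in> \<theta>" "\<pi> x = \<pi> x'" "\<pi> y = \<pi> y'"
      by (auto simp: pre_def img_def)
    then have "(x, x') \<in> \<theta>" "(y', y) \<in> \<theta>"
      using assms(2) Con_sub[OF assms(1)] by (auto intro!: subsetD[OF assms(2)] simp: ker_iff)
    with * show "(x, y) \<in> \<theta>" using Con_trans[OF assms(1)] by blast
  qed
qed

lemma img_Con:
  assumes "\<theta> \<in> Con S M" "ker \<subseteq> \<theta>"
  shows "img \<pi> \<theta> \<in> Con S N"
proof (rule ConI)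
  show "img \<pi> \<theta> \<subseteq> Nabla N"
    using Con_sub[OF assms(1)] onto by (auto simp: img_def Nabla_def)
  show "(x, x) \<in> img \<pi> \<theta>" if "x \<in> carrier N" for x
    using that Con_refl[OF assms(1)] unfolding onto[symmetric] img_def by force
  show "(y, x) \<in> img \<pi> \<theta>" if "(x, y) \<in> img \<pi> \<theta>" for x y
    using that Con_sym[OF assms(1)] unfolding img_def by force
  show "(x, z) \<in> img \<pi> \<theta>" if xy: "(x, y) \<in> img \<pi> \<theta>" "(y, z) \<in> img \<pi> \<theta>" for x y z
  proof -
    from xy obtain a b c d where *: "(a, b) \<in> \<theta>" "(c, d) \<in> \<theta>" "x = \<pi> a" "y = \<pi> b" "y = \<pi> c" "z = \<pi> d"
      by (auto simp: img_def)
    then have "(b, c) \<in> \<theta>" using Con_sub[OF assms(1)] by (auto intro!: subsetD[OF assms(2)] simp: ker_iff)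
    with * have "(a, d) \<in> \<theta>" using Con_trans[OF assms(1)] by blast
    with * show ?thesis unfolding img_def by force
  qed
  fix f us vs assume *: "f \<in> ops S" "length us = arity S f" "list_all2 (\<lambda>x y. (x, y) \<in> img \<pi> \<theta>) us vs"
  from list_all2_img[OF *(3)] obtain xs ys where
    xs: "us = map \<pi> xs" "vs = map \<pi> ys" "list_all2 (\<lambda>x y. (x, y) \<in> \<theta>) xs ys" by blast
  have c: "set xs \<subseteq> carrier M \<and> set ys \<subseteq> carrier M \<and> length ys = length xs"
    by (rule list_all2_carrier[OF Con_Nabla[OF assms(1)] xs(3)])
  have "(opn M f xs, opn M f ys) \<in> \<theta>" using * xs by (intro Con_op[OF assms(1)]) auto
  moreover have "opn N f us = \<pi> (opn M f xs)" "opn N f vs = \<pi> (opn M f ys)"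
    using * xs c alg_hom_op[OF hom] by auto
  ultimately show "(opn N f us, opn N f vs) \<in> img \<pi> \<theta>" unfolding img_def by force
qed

text \<open>By \<open>img_Con\<close>, \<open>img_pre\<close> and \<open>pre_img\<close>, taking
  preimages and taking images are inverse isomorphisms between the congruences of \<open>N\<close>
  and those of \<open>M\<close> above the kernel, so least congruences correspond.\<close>

lemma pre_Cg:
  assumes Y: "Y \<subseteq> Nabla N"
  shows "pre M \<pi> (Cg S N Y) = Cg S M (pre M \<pi> Y \<union> ker)"
proof
  let ?X = "pre M \<pi> Y \<union> ker"
  have X: "?X \<subseteq> Nabla M" by (auto simp: pre_def Nabla_def)
  have C: "Cg S M ?X \<in> Con S M" by (rule Cg_Con[OF alg X])
  have k: "ker \<subseteq> Cg S M ?X" using Cg_ge[of ?X S M] by simp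
  have "img \<pi> (pre M \<pi> Y) \<subseteq> img \<pi> (Cg S M ?X)" using Cg_ge[of ?X S M] unfolding img_def by blast
  then have "Cg S N Y \<subseteq> img \<pi> (Cg S M ?X)"
    unfolding img_pre[OF Y] by (rule Cg_least[OF img_Con[OF C k]])
  then show "pre M \<pi> (Cg S N Y) \<subseteq> Cg S M ?X"
    using pre_mono pre_img[OF C k] by metis
  show "Cg S M ?X \<subseteq> pre M \<pi> (Cg S N Y)"
    using ker_le_pre[OF Cg_Con[OF algN Y]] pre_mono[OF Cg_ge[of Y S N], of M \<pi>]
    by (intro Cg_least pre_Con[OF alg hom] Cg_Con[OF algN Y]) auto
qed

lemma pre_join:
  assumes "\<alpha> \<in> Con S N" "\<beta> \<in> Con S N"
  shows "pre M \<pi> (Cg S N (\<alpha> \<union> \<beta>)) = Cg S M (pre M \<pi> \<alpha> \<union> pre M \<pi> \<beta>)"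
proof -
  have "pre M \<pi> (\<alpha> \<union> \<beta>) \<union> ker = pre M \<pi> \<alpha> \<union> pre M \<pi> \<beta>"
    using ker_le_pre[OF assms(1)] by (auto simp: pre_def)
  then show ?thesis using pre_Cg[of "\<alpha> \<union> \<beta>"] assms Con_Nabla by fastforce
qed

end

lemma (in onto_hom) variety_image:
  assumes E: "wf_identities S E" and M: "M \<in> variety S E"
  shows "N \<in> variety S E"
proof -
  have "eval N v s = eval N v t" if st: "(s, t) \<in> E" and v: "\<forall>i. v i \<in> carrier N" for s t v
  proof -
    have "\<exists>w. \<forall>i. w i \<in> carrier M \<and> v i = \<pi> (w i)"
      using v onto by (intro choice) blast
    then obtain w where w: "\<And>i. w i \<in> carrier M" and v: "v = (\<lambda>i. \<pi> (w i))" by blast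
    have wf: "wf_trm S UNIV s" "wf_trm S UNIV t" using E st by (auto simp: wf_identities_def)
    have "eval M w s = eval M w t" using M st w unfolding variety_def by blast
    then show ?thesis unfolding v using eval_hom[OF alg hom wf(1), of w] eval_hom[OF alg hom wf(2), of w] w by simp
  qed
  then show ?thesis using algN by (auto simp: variety_def)
qed

text \<open>\<open>\<phi>\<close> need not be injective. Operations use representatives chosen by
  \<open>inv_into\<close>, which is harmless when the kernel of \<open>\<phi>\<close> is a
  congruence. Injective maps into the universe give copies, other maps give quotients that stay in
  it.\<close>

definition image_alg :: "('a \<Rightarrow> 'b) \<Rightarrow> ('f, 'a) algebra \<Rightarrow> ('f, 'b) algebra" where
  "image_alg \<phi> M = \<lparr>carrier = \<phi> ` carrier M,
     opn = (\<lambda>f ys. \<phi> (opn M f (map (inv_into (carrier M) \<phi>) ys)))\<rparr>"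

lemma onto_hom_image_alg:
  assumes alg: "is_algebra S M" and \<Theta>: "\<Theta> \<in> Con S M"
    and ker: "\<And>x y. x \<in> carrier M \<Longrightarrow> y \<in> carrier M \<Longrightarrow> \<phi> x = \<phi> y \<longleftrightarrow> (x, y) \<in> \<Theta>"
  shows "onto_hom S M (image_alg \<phi> M) \<phi>"
proof
  show "is_algebra S (image_alg \<phi> M)"
    unfolding is_algebra_def image_alg_def
  proof (intro conjI ballI allI impI)
    fix f xs
    assume f: "f \<in> ops S"
      and xs: "length xs = arity S f \<and> set xs \<subseteq> carrier \<lparr>carrier = \<phi> ` carrier M,
        opn = (\<lambda>f ys. \<phi> (opn M f (map (inv_into (carrier M) \<phi>) ys)))\<rparr>"
    then have "set (map (inv_into (carrier M) \<phi>) xs) \<subseteq> carrier M"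
      by (auto intro!: inv_into_into)
    then show "opn \<lparr>carrier = \<phi> ` carrier M, opn = (\<lambda>f ys. \<phi> (opn M f (map (inv_into (carrier M) \<phi>) ys)))\<rparr> f xs
      \<in> carrier \<lparr>carrier = \<phi> ` carrier M, opn = (\<lambda>f ys. \<phi> (opn M f (map (inv_into (carrier M) \<phi>) ys)))\<rparr>"
      using xs f by (auto intro!: imageI algebra_op[OF alg])
  qed (use alg in \<open>auto simp: is_algebra_def\<close>)
  show "alg_hom S M (image_alg \<phi> M) \<phi>"
    unfolding alg_hom_def
  proof (intro conjI ballI allI impI)
    fix f xs assume f: "f \<in> ops S" and xs: "length xs = arity S f \<and> set xs \<subseteq> carrier M"
    let ?ys = "map (inv_into (carrier M) \<phi>) (map \<phi> xs)"
    have ys: "set ?ys \<subseteq> carrier M" using xs by (auto intro!: inv_into_into)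
    have "(x, inv_into (carrier M) \<phi> (\<phi> x)) \<in> \<Theta>" if "x \<in> carrier M" for x
      using that ker[of x "inv_into (carrier M) \<phi> (\<phi> x)"] inv_into_into[of "\<phi> x" \<phi> "carrier M"]
        f_inv_into_f[of "\<phi> x" \<phi> "carrier M"] by auto
    then have "list_all2 (\<lambda>x y. (x, y) \<in> \<Theta>) xs ?ys"
      using xs by (auto simp: list_all2_conv_all_nth subset_iff)
    then have "(opn M f xs, opn M f ?ys) \<in> \<Theta>" using f xs by (intro Con_op[OF \<Theta>]) auto
    then have "\<phi> (opn M f xs) = \<phi> (opn M f ?ys)"
      using ker Con_sub[OF \<Theta>] by blast
    then show "\<phi> (opn M f xs) = opn (image_alg \<phi> M) f (map \<phi> xs)"
      by (simp add: image_alg_def)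
  qed (simp add: image_alg_def)
qed (use alg in \<open>auto simp: image_alg_def\<close>)

section \<open>Subalgebras of powers\<close>

definition sub_pow :: "('f, 'a) algebra \<Rightarrow> ('i \<Rightarrow> 'a) set \<Rightarrow> ('f, 'i \<Rightarrow> 'a) algebra" where
  "sub_pow M B = \<lparr>carrier = B, opn = (\<lambda>f xs i. opn M f (map (\<lambda>x. x i) xs))\<rparr>"

definition is_sub_pow :: "'f signature \<Rightarrow> ('f, 'a) algebra \<Rightarrow> ('i \<Rightarrow> 'a) set \<Rightarrow> bool" where
  "is_sub_pow S M B \<longleftrightarrow> B \<noteq> {} \<and> (\<forall>x\<in>B. \<forall>i. x i \<in> carrier M) \<and>
     (\<forall>f\<in>ops S. \<forall>xs. length xs = arity S f \<and> set xs \<subseteq> B \<longrightarrow>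
        (\<lambda>i. opn M f (map (\<lambda>x. x i) xs)) \<in> B)"

lemma carrier_sub_pow [simp]: "carrier (sub_pow M B) = B"
  by (simp add: sub_pow_def)

lemma opn_sub_pow [simp]: "opn (sub_pow M B) f xs = (\<lambda>i. opn M f (map (\<lambda>x. x i) xs))"
  by (simp add: sub_pow_def)

lemma eval_sub_pow: "eval (sub_pow M B) v t i = eval M (\<lambda>x. v x i) t"
  by (induction t) (auto simp: comp_def cong: map_cong)

lemma is_algebra_sub_pow: "is_sub_pow S M B \<Longrightarrow> is_algebra S (sub_pow M B)"
  by (auto simp: is_algebra_def is_sub_pow_def)

lemma variety_sub_pow:
  assumes "M \<in> variety S E" "is_sub_pow S M B"
  shows "sub_pow M B \<in> variety S E"
proof -
  have "eval (sub_pow M B) v s = eval (sub_pow M B) v t"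
    if "(s, t) \<in> E" "\<forall>i. v i \<in> B" for s t v
  proof
    fix i
    have "\<forall>n. v n i \<in> carrier M" using that assms(2) unfolding is_sub_pow_def by blast
    then show "eval (sub_pow M B) v s i = eval (sub_pow M B) v t i"
      unfolding eval_sub_pow using assms(1) that unfolding variety_def by auto
  qed
  then show ?thesis using is_algebra_sub_pow[OF assms(2)] by (auto simp: variety_def)
qed

lemma list_all_choice: "(\<And>x. x \<in> set xs \<Longrightarrow> \<exists>y. R x y) \<Longrightarrow> \<exists>ys. list_all2 R xs ys"
proof (induction xs)
  case (Cons x xs)
  moreover from Cons.prems obtain y where "R x y" by auto
  ultimately obtain ys where "list_all2 R xs ys" "R x y" by auto
  then show ?case by (intro exI[of _ "y # ys"]) simp
qed auto

text \<open>This is the subalgebra generated by the tuples \<open>\<lambda>i. v i x\<close> for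
  \<open>x \<in> V\<close>. The term \<open>t0\<close> secures that it is nonempty, as
  \<open>V\<close> may be empty and the signature may have no constants.\<close>

lemma is_sub_pow_terms:
  assumes alg: "is_algebra S M" and "wf_trm S V t0" and v: "\<And>i x. x \<in> V \<Longrightarrow> v i x \<in> carrier M"
  shows "is_sub_pow S M ((\<lambda>t i. eval M (v i) t) ` {t. wf_trm S V t})" (is "is_sub_pow S M (?val ` ?T)")
  unfolding is_sub_pow_def
proof (intro conjI ballI allI impI)
  show "?val ` ?T \<noteq> {}" using assms(2) by blast
  show "x i \<in> carrier M" if "x \<in> ?val ` ?T" for x i
    using that v by (auto intro!: eval_closed[OF alg])
  fix f xs assume f: "f \<in> ops S" and xs: "length xs = arity S f \<and> set xs \<subseteq> ?val ` ?T"
  have "\<exists>ts. list_all2 (\<lambda>x t. wf_trm S V t \<and> x = ?val t) xs ts"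
    using xs by (intro list_all_choice) auto
  then obtain ts where ts: "list_all2 (\<lambda>x t. wf_trm S V t \<and> x = ?val t) xs ts" by blast
  then have "length ts = length xs" by (simp add: list_all2_lengthD)
  with ts xs f have "wf_trm S V (Fn f ts)"
    by (auto simp: list_all2_conv_all_nth all_set_conv_all_nth)
  moreover have "xs = map ?val ts"
    using ts by (auto simp: list_all2_conv_all_nth intro!: nth_equalityI)
  then have "(\<lambda>i. opn M f (map (\<lambda>x. x i) xs)) = ?val (Fn f ts)"
    by (simp add: fun_eq_iff comp_def cong: map_cong)
  ultimately show "(\<lambda>i. opn M f (map (\<lambda>x. x i) xs)) \<in> ?val ` ?T" by blast
qed

lemma proj_hom: "is_sub_pow S M B \<Longrightarrow> alg_hom S (sub_pow M B) M (\<lambda>x. x i)"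
  by (auto simp: alg_hom_def is_sub_pow_def)

lemma reindex_hom:
  "(\<And>x. x \<in> B \<Longrightarrow> (\<lambda>i. x (r i)) \<in> B') \<Longrightarrow> alg_hom S (sub_pow M B) (sub_pow M B') (\<lambda>x i. x (r i))"
  by (auto simp: alg_hom_def comp_def)

lemma const_hom:
  "(\<And>x. x \<in> carrier M \<Longrightarrow> (\<lambda>_. x) \<in> B) \<Longrightarrow> alg_hom S M (sub_pow M B) (\<lambda>x _. x)"
  by (auto simp: alg_hom_def comp_def)

text \<open>Pairs are functions on \<open>bool\<close>, so that the square of an algebra is one of its powers.\<close>

definition pair :: "'a \<Rightarrow> 'a \<Rightarrow> bool \<Rightarrow> 'a" where
  "pair x y = (\<lambda>b. if b then y else x)"

lemma pair_simps [simp]: "pair x y False = x" "pair x y True = y"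
  by (simp_all add: pair_def)

definition pairs :: "'a rel \<Rightarrow> (bool \<Rightarrow> 'a) set" where
  "pairs \<beta> = {z. (z False, z True) \<in> \<beta>}"

lemma pair_in_pairs [simp]: "pair x y \<in> pairs \<beta> \<longleftrightarrow> (x, y) \<in> \<beta>"
  by (simp add: pairs_def)

lemma is_sub_pow_pairs:
  assumes alg: "is_algebra S M" and \<beta>: "\<beta> \<in> Con S M"
  shows "is_sub_pow S M (pairs \<beta>)"
  unfolding is_sub_pow_def
proof (intro conjI ballI allI impI)
  obtain c where "c \<in> carrier M" using alg by (auto simp: is_algebra_def)
  then have "pair c c \<in> pairs \<beta>" using Con_refl[OF \<beta>] by simp
  then show "pairs \<beta> \<noteq> {}" by blast
  show "x i \<in> carrier M" if "x \<in> pairs \<beta>" for x i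
    using that Con_sub[OF \<beta>] by (cases i) (auto simp: pairs_def)
  fix f xs assume "f \<in> ops S" "length xs = arity S f \<and> set xs \<subseteq> pairs \<beta>"
  then have "(opn M f (map (\<lambda>x. x False) xs), opn M f (map (\<lambda>x. x True) xs)) \<in> \<beta>"
    by (intro Con_op[OF \<beta>]) (auto simp: list_all2_conv_all_nth pairs_def subset_iff)
  then show "(\<lambda>i. opn M f (map (\<lambda>x. x i) xs)) \<in> pairs \<beta>" by (simp add: pairs_def)
qed

section \<open>The term condition\<close>

definition sel :: "bool \<Rightarrow> 'a \<times> 'a \<Rightarrow> 'a" where
  "sel i p = (if i then snd p else fst p)"

lemma sel_simps [simp]: "sel False p = fst p" "sel True p = snd p" "sel i (x, x) = x"
  by (simp_all add: sel_def)

text \<open>The variables of \<open>T\<close> are themselves pairs, of \<open>\<alpha>\<close> or of \<open>\<beta>\<close>; \<open>i\<close> and \<open>j\<close> tell which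
  components of the pairs to insert.  This gives the entry \<open>(i, j)\<close> of the square of values in the
  term condition.\<close>

definition entry :: "('f, 'a) algebra \<Rightarrow> bool \<Rightarrow> bool \<Rightarrow> ('f, 'a \<times> 'a + 'a \<times> 'a) trm \<Rightarrow> 'a" where
  "entry M i j T = eval M (case_sum (sel i) (sel j)) T"

text \<open>Naming each variable by the pair it stands for removes positions and lengths from the
  term condition: the four corners of a square differ only in the valuation. A term has finitely
  many variables, so listing the pairs that occur recovers the original form.\<close>

lemma centralizes_iff:
  "centralizes S M \<alpha> \<beta> \<mu> \<longleftrightarrow> (\<forall>T. wf_trm S (Inl ` \<alpha> \<union> Inr ` \<beta>) T \<longrightarrow>
     ((entry M False False T, entry M False True T) \<in> \<mu> \<longleftrightarrow>
      (entry M True False T, entry M True True T) \<in> \<mu>))" (is "_ \<longleftrightarrow> ?R")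
proof
  assume C: "centralizes S M \<alpha> \<beta> \<mu>"
  show ?R
  proof (intro allI impI)
    fix T assume wf: "wf_trm S (Inl ` \<alpha> \<union> Inr ` \<beta>) T"
    define V where "V = set2_trm T"
    have V: "finite V" "V \<subseteq> Inl ` \<alpha> \<union> Inr ` \<beta>" "wf_trm S V T"
      using wf_trm_vars[OF wf] by (simp_all add: V_def)
    obtain ps where ps: "set ps = {p. Inl p \<in> V}"
      using finite_list[of "Inl -` V"] finite_vimageI[OF V(1), of Inl] by (auto simp: vimage_def)
    obtain qs where qs: "set qs = {p. Inr p \<in> V}"
      using finite_list[of "Inr -` V"] finite_vimageI[OF V(1), of Inr] by (auto simp: vimage_def)
    \<comment> \<open>A position of each occurring pair in \<open>ps\<close> or in
      \<open>qs\<close>, the latter shifted past \<open>ps\<close>.\<close>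
    define idx where "idx = case_sum (\<lambda>p. SOME i. i < length ps \<and> ps ! i = p)
      (\<lambda>q. length ps + (SOME i. i < length qs \<and> qs ! i = q))"
    have idx1: "idx (Inl p) < length ps \<and> ps ! idx (Inl p) = p" if "Inl p \<in> V" for p
    proof -
      have "\<exists>i. i < length ps \<and> ps ! i = p" using that ps by (metis in_set_conv_nth mem_Collect_eq)
      from someI_ex[OF this] show ?thesis by (simp add: idx_def)
    qed
    have idx2: "\<exists>k. idx (Inr q) = length ps + k \<and> k < length qs \<and> qs ! k = q" if "Inr q \<in> V" for q
    proof -
      have "\<exists>i. i < length qs \<and> qs ! i = q" using that qs by (metis in_set_conv_nth mem_Collect_eq)
      from someI_ex[OF this] show ?thesis by (simp add: idx_def)
    qed
    define t where "t = map_trm id idx T"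
    have t: "wf_trm S {..<length ps + length qs} t"
      unfolding t_def
    proof (rule wf_map_trm[OF V(3)], rule image_subsetI)
      fix x assume "x \<in> V"
      then show "idx x \<in> {..<length ps + length qs}"
        using idx1 idx2 by (cases x) fastforce+
    qed
    have ev: "eval M ((!) (map (sel i) ps @ map (sel j) qs)) t = entry M i j T" for i j
      unfolding t_def eval_map_trm entry_def
    proof (rule eval_cong[OF V(3)])
      fix x assume "x \<in> V"
      then show "((!) (map (sel i) ps @ map (sel j) qs) \<circ> idx) x = case_sum (sel i) (sel j) x"
        using idx1 idx2 by (cases x) (fastforce simp: nth_append)+
    qed
    have "p \<in> \<alpha>" if "p \<in> set ps" for p using that ps V(2) by blast
    moreover have "q \<in> \<beta>" if "q \<in> set qs" for q using that qs V(2) by blast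
    ultimately have rel: "list_all2 (\<lambda>a b. (a, b) \<in> \<alpha>) (map (sel False) ps) (map (sel True) ps)"
      "list_all2 (\<lambda>a b. (a, b) \<in> \<beta>) (map (sel False) qs) (map (sel True) qs)"
      by (simp_all add: list_all2_conv_all_nth)
    show "(entry M False False T, entry M False True T) \<in> \<mu> \<longleftrightarrow>
        (entry M True False T, entry M True True T) \<in> \<mu>"
      unfolding ev[symmetric]
      using C[unfolded centralizes_def, rule_format, OF t, of "map (sel False) ps"
        "map (sel False) qs" "map (sel True) ps" "map (sel True) qs"] rel by simp
  qed
next
  assume R: ?R
  show "centralizes S M \<alpha> \<beta> \<mu>"
    unfolding centralizes_def
  proof (intro allI impI)
    fix n k t as bs cs ds
    assume t: "wf_trm S {..<n + k} t"
      and *: "length as = n \<and> length cs = k \<and>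
        list_all2 (\<lambda>a b. (a, b) \<in> \<alpha>) as bs \<and> list_all2 (\<lambda>c d. (c, d) \<in> \<beta>) cs ds"
    then have len: "length as = n" "length bs = n" "length cs = k" "length ds = k"
      by (auto dest: list_all2_lengthD)
    define g where "g i = (if i < n then Inl (as ! i, bs ! i) else Inr (cs ! (i - n), ds ! (i - n)))" for i
    define T where "T = map_trm id g t"
    have wf: "wf_trm S (Inl ` \<alpha> \<union> Inr ` \<beta>) T"
      unfolding T_def
      by (rule wf_map_trm[OF t]) (use * len in \<open>auto simp: g_def list_all2_conv_all_nth\<close>)
    have "entry M i j T = eval M ((!) ((if i then bs else as) @ (if j then ds else cs))) t" for i j
      unfolding T_def entry_def eval_map_trm
      by (rule eval_cong[OF t]) (use len in \<open>auto simp: g_def nth_append sel_def\<close>)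
    with R[rule_format, OF wf]
    show "(eval M ((!) (as @ cs)) t, eval M ((!) (as @ ds)) t) \<in> \<mu> \<longleftrightarrow>
        (eval M ((!) (bs @ cs)) t, eval M ((!) (bs @ ds)) t) \<in> \<mu>" by simp
  qed
qed

lemma entry_Fn: "entry M i j (Fn f Ts) = opn M f (map (entry M i j) Ts)"
  by (simp add: entry_def cong: map_cong)

lemma entry_closed:
  assumes "is_algebra S M" "\<alpha> \<subseteq> Nabla M" "\<beta> \<subseteq> Nabla M" "wf_trm S (Inl ` \<alpha> \<union> Inr ` \<beta>) T"
  shows "entry M i j T \<in> carrier M"
  unfolding entry_def
  by (rule eval_closed[OF assms(1,4)]) (use assms(2,3) in \<open>auto simp: sel_def Nabla_def\<close>)

lemma entry_left:
  assumes \<alpha>: "\<alpha> \<in> Con S M" and "\<beta> \<subseteq> Nabla M" "wf_trm S (Inl ` \<alpha> \<union> Inr ` \<beta>) T"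
  shows "(entry M False j T, entry M True j T) \<in> \<alpha>"
  unfolding entry_def
  by (rule Con_eval[OF \<alpha> assms(3)]) (use assms(2) in \<open>auto simp: sel_def Nabla_def intro!: Con_refl[OF \<alpha>]\<close>)

lemma entry_right:
  assumes \<beta>: "\<beta> \<in> Con S M" and "\<alpha> \<subseteq> Nabla M" "wf_trm S (Inl ` \<alpha> \<union> Inr ` \<beta>) T"
  shows "(entry M i False T, entry M i True T) \<in> \<beta>"
  unfolding entry_def
  by (rule Con_eval[OF \<beta> assms(3)]) (use assms(2) in \<open>auto simp: sel_def Nabla_def intro!: Con_refl[OF \<beta>]\<close>)

lemma centralizes_Inter:
  "(\<And>\<mu>. \<mu> \<in> X \<Longrightarrow> centralizes S M \<alpha> \<beta> \<mu>) \<Longrightarrow> centralizes S M \<alpha> \<beta> (\<Inter>X)"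
  unfolding centralizes_iff by blast

lemma centralizes_mono:
  assumes "centralizes S M \<alpha> \<beta> \<mu>" "\<alpha>' \<subseteq> \<alpha>" "\<beta>' \<subseteq> \<beta>"
  shows "centralizes S M \<alpha>' \<beta>' \<mu>"
proof -
  have "wf_trm S (Inl ` \<alpha> \<union> Inr ` \<beta>) T" if "wf_trm S (Inl ` \<alpha>' \<union> Inr ` \<beta>') T" for T
    by (rule wf_trm_mono[OF that]) (use assms in blast)
  with assms(1) show ?thesis unfolding centralizes_iff by blast
qed

lemma centralizes_left:
  assumes "\<alpha> \<in> Con S M" "\<beta> \<subseteq> Nabla M"
  shows "centralizes S M \<alpha> \<beta> \<alpha>"
  unfolding centralizes_iff
  using entry_left[OF assms] Con_sym[OF assms(1)] Con_trans[OF assms(1)] by meson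

lemma centralizes_right:
  assumes "\<beta> \<in> Con S M" "\<alpha> \<subseteq> Nabla M"
  shows "centralizes S M \<alpha> \<beta> \<beta>"
  unfolding centralizes_iff using entry_right[OF assms] by blast

lemma commutator_Con:
  assumes "\<alpha> \<in> Con S M" "\<beta> \<subseteq> Nabla M"
  shows "commutator S M \<alpha> \<beta> \<in> Con S M"
  unfolding commutator_def using centralizes_left[OF assms] assms by (intro Inter_Con) auto

lemma centralizes_commutator: "centralizes S M \<alpha> \<beta> (commutator S M \<alpha> \<beta>)"
  unfolding commutator_def by (rule centralizes_Inter) simp

lemma commutator_least: "\<delta> \<in> Con S M \<Longrightarrow> centralizes S M \<alpha> \<beta> \<delta> \<Longrightarrow> commutator S M \<alpha> \<beta> \<subseteq> \<delta>"
  unfolding commutator_def by blast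

lemma commutator_le_Int:
  assumes "\<alpha> \<in> Con S M" "\<beta> \<in> Con S M"
  shows "commutator S M \<alpha> \<beta> \<subseteq> \<alpha> \<inter> \<beta>"
  using commutator_least[OF assms(1) centralizes_left[OF assms(1) Con_Nabla[OF assms(2)]]]
    commutator_least[OF assms(2) centralizes_right[OF assms(2) Con_Nabla[OF assms(1)]]] by blast

lemma commutator_mono: "\<alpha>' \<subseteq> \<alpha> \<Longrightarrow> \<beta>' \<subseteq> \<beta> \<Longrightarrow> commutator S M \<alpha>' \<beta>' \<subseteq> commutator S M \<alpha> \<beta>"
  unfolding commutator_def using centralizes_mono by blast

context onto_hom
begin

text \<open>Squares are carried over by renaming variables: \<open>\<pi>\<close> applied to the
  pairs takes squares of \<open>M\<close> to squares of \<open>N\<close>, and a section of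
  \<open>\<pi>\<close> lifts each square of \<open>N\<close>.\<close>

lemma centralizes_pre:
  assumes \<alpha>: "\<alpha> \<subseteq> Nabla N" and \<beta>: "\<beta> \<subseteq> Nabla N"
  shows "centralizes S N \<alpha> \<beta> \<mu> \<longleftrightarrow> centralizes S M (pre M \<pi> \<alpha>) (pre M \<pi> \<beta>) (pre M \<pi> \<mu>)"
proof -
  let ?VM = "Inl ` pre M \<pi> \<alpha> \<union> Inr ` pre M \<pi> \<beta>" and ?VN = "Inl ` \<alpha> \<union> Inr ` \<beta>"
  have sub: "pre M \<pi> \<alpha> \<subseteq> Nabla M" "pre M \<pi> \<beta> \<subseteq> Nabla M" by (auto simp: pre_def Nabla_def)
  define g where "g = map_sum (map_prod \<pi> \<pi>) (map_prod \<pi> \<pi>)"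
  have down: "wf_trm S ?VN (map_trm id g T)" "entry N i j (map_trm id g T) = \<pi> (entry M i j T)"
    if T: "wf_trm S ?VM T" for T i j
  proof -
    show "wf_trm S ?VN (map_trm id g T)" by (rule wf_map_trm[OF T]) (auto simp: g_def pre_def)
    have "\<pi> (entry M i j T) = eval N (\<lambda>x. \<pi> (case_sum (sel i) (sel j) x)) T"
      unfolding entry_def by (rule eval_hom[OF alg hom T]) (use sub in \<open>auto simp: sel_def Nabla_def\<close>)
    also have "(\<lambda>x. \<pi> (case_sum (sel i) (sel j) x)) = case_sum (sel i) (sel j) \<circ> g"
      by (rule ext) (auto simp: g_def sel_def split: sum.split)
    finally show "entry N i j (map_trm id g T) = \<pi> (entry M i j T)"
      by (simp only: entry_def eval_map_trm)
  qed
  have up: "\<exists>T. wf_trm S ?VM T \<and> (\<forall>i j. entry N i j U = \<pi> (entry M i j T))"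
    if U: "wf_trm S ?VN U" for U
  proof -
    define s where "s = inv_into (carrier M) \<pi>"
    have s: "s u \<in> carrier M" "\<pi> (s u) = u" if "u \<in> carrier N" for u
      using that onto inv_into_into[of u \<pi> "carrier M"] f_inv_into_f[of u \<pi> "carrier M"]
      by (auto simp: s_def)
    define h where "h = map_sum (map_prod s s) (map_prod s s)"
    define T where "T = map_trm id h U"
    have "(map_prod s s) p \<in> pre M \<pi> \<gamma>" if "p \<in> \<gamma>" "\<gamma> \<subseteq> Nabla N" for p \<gamma>
      using that s by (cases p) (auto simp: pre_def Nabla_def)
    then have T: "wf_trm S ?VM T"
      unfolding T_def using \<alpha> \<beta> by (intro wf_map_trm[OF U]) (auto simp: h_def)
    have "entry N i j U = \<pi> (entry M i j T)" for i j
    proof -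
      have "\<pi> (entry M i j T) = entry N i j (map_trm id g T)" using down[OF T] by simp
      also have "\<dots> = eval N (case_sum (sel i) (sel j) \<circ> g \<circ> h) U"
        by (simp add: entry_def T_def eval_map_trm)
      also have "\<dots> = entry N i j U"
        unfolding entry_def
      proof (rule eval_cong[OF U])
        fix x assume "x \<in> ?VN"
        then show "(case_sum (sel i) (sel j) \<circ> g \<circ> h) x = case_sum (sel i) (sel j) x"
          using \<alpha> \<beta> s by (auto simp: g_def h_def sel_def Nabla_def)
      qed
      finally show ?thesis by simp
    qed
    with T show ?thesis by blast
  qed
  have mem: "(\<pi> (entry M i j T), \<pi> (entry M i' j' T)) \<in> \<mu> \<longleftrightarrow> (entry M i j T, entry M i' j' T) \<in> pre M \<pi> \<mu>"
    if "wf_trm S ?VM T" for T i j i' j'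
    using entry_closed[OF alg sub that] by (auto simp: pre_def)
  show ?thesis
  proof
    assume C: "centralizes S N \<alpha> \<beta> \<mu>"
    show "centralizes S M (pre M \<pi> \<alpha>) (pre M \<pi> \<beta>) (pre M \<pi> \<mu>)"
      unfolding centralizes_iff
    proof (intro allI impI)
      fix T assume T: "wf_trm S ?VM T"
      then show "((entry M False False T, entry M False True T) \<in> pre M \<pi> \<mu>) =
          ((entry M True False T, entry M True True T) \<in> pre M \<pi> \<mu>)"
        using C[unfolded centralizes_iff, rule_format, OF down(1)[OF T]]
        by (simp add: mem[OF T, symmetric] down(2)[OF T])
    qed
  next
    assume C: "centralizes S M (pre M \<pi> \<alpha>) (pre M \<pi> \<beta>) (pre M \<pi> \<mu>)"
    show "centralizes S N \<alpha> \<beta> \<mu>"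
      unfolding centralizes_iff
    proof (intro allI impI)
      fix U assume "wf_trm S ?VN U"
      from up[OF this] obtain T where T: "wf_trm S ?VM T" "\<And>i j. entry N i j U = \<pi> (entry M i j T)"
        by blast
      then show "((entry N False False U, entry N False True U) \<in> \<mu>) =
          ((entry N True False U, entry N True True U) \<in> \<mu>)"
        using C[unfolded centralizes_iff, rule_format, OF T(1)] by (simp add: mem)
    qed
  qed
qed

text \<open>The defining intersection is translated by the correspondence of congruences. It is not
  yet the join of a commutator with the kernel: for that, the term condition modulo
  \<open>\<delta>\<close> must be equivalent to the commutator lying below \<open>\<delta>\<close>,
  which will come from modularity.\<close>

lemma pre_commutator:
  assumes "\<alpha> \<in> Con S N" "\<beta> \<in> Con S N"
  shows "pre M \<pi> (commutator S N \<alpha> \<beta>) =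
    \<Inter>{\<delta> \<in> Con S M. ker \<subseteq> \<delta> \<and> centralizes S M (pre M \<pi> \<alpha>) (pre M \<pi> \<beta>) \<delta>}"
proof -
  let ?X = "{\<mu> \<in> Con S N. centralizes S N \<alpha> \<beta> \<mu>}"
  have sub: "\<alpha> \<subseteq> Nabla N" "\<beta> \<subseteq> Nabla N" using assms Con_Nabla by blast+
  have "pre M \<pi> ` ?X = {\<delta> \<in> Con S M. ker \<subseteq> \<delta> \<and> centralizes S M (pre M \<pi> \<alpha>) (pre M \<pi> \<beta>) \<delta>}"
  proof (intro equalityI subsetI)
    fix \<delta> assume "\<delta> \<in> {\<delta> \<in> Con S M. ker \<subseteq> \<delta> \<and> centralizes S M (pre M \<pi> \<alpha>) (pre M \<pi> \<beta>) \<delta>}"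
    then have "img \<pi> \<delta> \<in> ?X" "pre M \<pi> (img \<pi> \<delta>) = \<delta>"
      using img_Con pre_img centralizes_pre[OF sub] by auto
    then show "\<delta> \<in> pre M \<pi> ` ?X" by force
  qed (auto simp: centralizes_pre[OF sub, symmetric] intro!: pre_Con[OF alg hom] dest: ker_le_pre)
  moreover have "\<alpha> \<in> ?X" using centralizes_left[OF assms(1)] sub assms by blast
  then have "pre M \<pi> (\<Inter>?X) = \<Inter>(pre M \<pi> ` ?X)" by (auto simp: pre_def)
  ultimately show ?thesis unfolding commutator_def by simp
qed

end

text \<open>The annihilator of \<open>\<beta>\<close> modulo \<open>\<delta>\<close>, i.e. the largest \<open>\<alpha>\<close> such that the term condition
  for \<open>\<alpha>\<close>, \<open>\<beta>\<close> holds modulo \<open>\<delta>\<close>.\<close>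

definition ann :: "'f signature \<Rightarrow> ('f, 'a) algebra \<Rightarrow> 'a rel \<Rightarrow> 'a rel \<Rightarrow> 'a rel" where
  "ann S M \<beta> \<delta> = pre M (\<lambda>x _. x) (Syn S (sub_pow M (pairs \<beta>)) {z. (z False, z True) \<in> \<delta>})"

lemma diag_hom: "\<beta> \<in> Con S M \<Longrightarrow> alg_hom S M (sub_pow M (pairs \<beta>)) (\<lambda>x _. x)"
  by (rule const_hom) (auto simp: pairs_def intro: Con_refl)

lemma ann_Con:
  assumes "is_algebra S M" "\<beta> \<in> Con S M"
  shows "ann S M \<beta> \<delta> \<in> Con S M"
  unfolding ann_def
  by (intro pre_Con[OF assms(1) diag_hom[OF assms(2)]] Syn_Con is_algebra_sub_pow is_sub_pow_pairs assms)

text \<open>A unary polynomial of the algebra of \<open>\<beta>\<close>-pairs, taken at the constant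
  pairs of \<open>x\<close> and of \<open>y\<close>, yields the two rows of a square, and
  \<open>Syn\<close> asks that both rows or neither lie in \<open>\<delta>\<close>. Since
  \<open>Syn\<close> is a congruence, several pairs from \<open>\<alpha>\<close> may be exchanged at
  once. Hence the term condition, as a condition on \<open>\<alpha>\<close>, is containment in a
  single congruence.\<close>

lemma centralizes_iff_ann:
  fixes M :: "('f, 'a) algebra"
  assumes alg: "is_algebra S M" and \<alpha>: "\<alpha> \<subseteq> Nabla M" and \<beta>: "\<beta> \<in> Con S M"
  shows "centralizes S M \<alpha> \<beta> \<delta> \<longleftrightarrow> \<alpha> \<subseteq> ann S M \<beta> \<delta>"
proof -
  let ?P = "sub_pow M (pairs \<beta>)" and ?D = "{z. (z False, z True) \<in> \<delta>}"
  have Syn: "Syn S ?P ?D \<in> Con S ?P"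
    by (intro Syn_Con is_algebra_sub_pow is_sub_pow_pairs alg \<beta>)
  have const: "(\<lambda>_. x) \<in> pairs \<beta>" if "x \<in> carrier M" for x
    using that by (auto simp: pairs_def intro: Con_refl[OF \<beta>])
  show ?thesis
  proof
    assume C: "centralizes S M \<alpha> \<beta> \<delta>"
    show "\<alpha> \<subseteq> ann S M \<beta> \<delta>"
    proof (rule subrelI)
      fix x y assume xy: "(x, y) \<in> \<alpha>"
      let ?V = "Inl ` {(x, y)} \<union> Inr ` \<beta>"
      have T: "\<exists>T. wf_trm S ?V T \<and> (\<forall>j. p (\<lambda>_. x) j = entry M False j T \<and> p (\<lambda>_. y) j = entry M True j T)"
        if "pol S ?P p" for p
        using that
      proof induction
        case pol_id
        then show ?case by (intro exI[of _ "Var (Inl (x, y))"]) (simp add: entry_def)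
      next
        case (pol_const c)
        then have "(c False, c True) \<in> \<beta>" by (simp add: pairs_def)
        then show ?case
          by (intro exI[of _ "Var (Inr (c False, c True))"]) (auto simp: entry_def sel_def)
      next
        case (pol_op f ps)
        let ?R = "\<lambda>p T. wf_trm S ?V T \<and>
          (\<forall>j. p (\<lambda>_. x) j = entry M False j T \<and> p (\<lambda>_. y) j = entry M True j T)"
        have "\<exists>Ts. list_all2 ?R ps Ts" using pol_op by (intro list_all_choice) blast
        then obtain Ts where Ts: "list_all2 ?R ps Ts" by blast
        then have "length Ts = length ps" by (simp add: list_all2_lengthD)
        with Ts pol_op have "wf_trm S ?V (Fn f Ts)" by (auto simp: list_all2_conv_all_nth all_set_conv_all_nth)
        moreover have "map (\<lambda>p. p (\<lambda>_. x) j) ps = map (entry M False j) Ts"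
          "map (\<lambda>p. p (\<lambda>_. y) j) ps = map (entry M True j) Ts" for j
          using Ts by (auto simp: list_all2_conv_all_nth intro!: nth_equalityI)
        ultimately show ?case
          by (intro exI[of _ "Fn f Ts"]) (simp add: comp_def entry_Fn)
      qed
      have "p (\<lambda>_. x) \<in> ?D \<longleftrightarrow> p (\<lambda>_. y) \<in> ?D" if p: "pol S ?P p" for p
      proof -
        from T[OF p] obtain T where T: "wf_trm S ?V T"
          "\<And>j. p (\<lambda>_. x) j = entry M False j T" "\<And>j. p (\<lambda>_. y) j = entry M True j T" by blast
        have "wf_trm S (Inl ` \<alpha> \<union> Inr ` \<beta>) T" by (rule wf_trm_mono[OF T(1)]) (use xy in auto)
        with C T(2,3) show ?thesis unfolding centralizes_iff by simp
      qed
      then show "(x, y) \<in> ann S M \<beta> \<delta>"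
        using xy \<alpha> const by (auto simp: ann_def pre_def Syn_def Nabla_def)
    qed
  next
    assume sub: "\<alpha> \<subseteq> ann S M \<beta> \<delta>"
    show "centralizes S M \<alpha> \<beta> \<delta>"
      unfolding centralizes_iff
    proof (intro allI impI)
      fix T assume T: "wf_trm S (Inl ` \<alpha> \<union> Inr ` \<beta>) T"
      \<comment> \<open>Pairs from \<open>\<alpha>\<close> enter as constant pairs of their
        component \<open>i\<close>, pairs from \<open>\<beta>\<close> as elements of the algebra of
        pairs; the value is row \<open>i\<close> of the square.\<close>
      define v :: "bool \<Rightarrow> 'a \<times> 'a + 'a \<times> 'a \<Rightarrow> bool \<Rightarrow> 'a"
        where "v i = case_sum (\<lambda>p _. sel i p) (\<lambda>q j. sel j q)" for i
      have z: "eval ?P (v i) T j = entry M i j T" for i j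
      proof -
        have "(\<lambda>x. v i x j) = case_sum (sel i) (sel j)"
          by (rule ext) (auto simp: v_def split: sum.split)
        then show ?thesis by (simp add: eval_sub_pow entry_def)
      qed
      have "(eval ?P (v False) T, eval ?P (v True) T) \<in> Syn S ?P ?D"
      proof (rule Con_eval[OF Syn T])
        fix x assume x: "x \<in> Inl ` \<alpha> \<union> Inr ` \<beta>"
        have "(\<lambda>j. sel j q) \<in> pairs \<beta>" if "q \<in> \<beta>" for q using that by (simp add: pairs_def)
        then show "(v False x, v True x) \<in> Syn S ?P ?D"
          using x sub by (auto simp: v_def ann_def pre_def intro!: Con_refl[OF Syn])
      qed
      from Syn_saturated[OF this]
      show "((entry M False False T, entry M False True T) \<in> \<delta>) =
          ((entry M True False T, entry M True True T) \<in> \<delta>)" by (simp add: z)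
    qed
  qed
qed

section \<open>Congruence-modular semi-degenerate varieties\<close>

definition embeds :: "'u itself \<Rightarrow> 'b set \<Rightarrow> bool" where
  "embeds _ X \<longleftrightarrow> (\<exists>\<phi> :: 'b \<Rightarrow> 'u. inj_on \<phi> X)"

text \<open>A member of the variety with carrier in any type, provided that it has a copy in the
  universe \<open>'u\<close>.\<close>

abbreviation member ::
  "'f signature \<Rightarrow> 'f identities \<Rightarrow> 'u itself \<Rightarrow> ('f, 'b) algebra \<Rightarrow> bool" where
  "member S E U M \<equiv> M \<in> variety S E \<and> embeds U (carrier M)"

locale cm_variety =
  fixes S :: "'f signature" and E :: "'f identities" and \<C> :: "('f, 'u) algebra set"
  assumes universe: "large_universe S TYPE('u)"
    and identities: "wf_identities S E"
    and variety: "\<C> = variety S E"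
    and congruence_modular: "\<forall>M\<in>\<C>. modular_lattice (Con_lattice S M)"
    and semi_degenerate: "semi_degenerate S \<C>"
    and commutator_closed:
      "\<forall>M\<in>\<C>. \<forall>\<alpha>\<in>KCon S M. \<forall>\<beta>\<in>KCon S M. commutator S M \<alpha> \<beta> \<in> KCon S M"
begin

lemma mem_algebra: "member S E TYPE('u) M \<Longrightarrow> is_algebra S M"
  by (simp add: variety_def)

lemma obtain_copy:
  assumes "member S E TYPE('u) M"
  obtains N \<phi> where "N \<in> \<C>" "onto_hom S M N \<phi>" "inj_on \<phi> (carrier M)" "pre M \<phi> (Delta N) = Delta M"
proof -
  obtain \<phi> :: "_ \<Rightarrow> 'u" where \<phi>: "inj_on \<phi> (carrier M)" using assms by (auto simp: embeds_def)
  interpret onto_hom S M "image_alg \<phi> M" \<phi>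
    by (rule onto_hom_image_alg[OF mem_algebra[OF assms] Delta_Con[OF mem_algebra[OF assms]]])
      (use \<phi> in \<open>auto simp: Delta_def inj_on_def\<close>)
  have "image_alg \<phi> M \<in> \<C>" using variety_image[OF identities] assms variety by blast
  moreover have "ker = Delta M"
    using \<phi> by (auto simp: ker_iff Delta_iff inj_on_def)
  ultimately show ?thesis using that \<phi> onto_hom_axioms by blast
qed

lemma modular:
  assumes M: "member S E TYPE('u) M" and con: "\<alpha> \<in> Con S M" "\<beta> \<in> Con S M" "\<gamma> \<in> Con S M" and le: "\<alpha> \<subseteq> \<gamma>"
  shows "\<gamma> \<inter> Cg S M (\<alpha> \<union> \<beta>) \<subseteq> Cg S M (\<alpha> \<union> (\<beta> \<inter> \<gamma>))"
proof -
  obtain N \<phi> where N: "N \<in> \<C>" and "onto_hom S M N \<phi>" and k: "pre M \<phi> (Delta N) = Delta M"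
    using obtain_copy[OF M] by metis
  then interpret onto_hom S M N \<phi> by simp
  have k: "ker \<subseteq> \<theta>" if "\<theta> \<in> Con S M" for \<theta> using k Delta_least[OF that] by simp
  let ?i = "img \<phi>"
  have i: "?i \<theta> \<in> Con S N" "pre M \<phi> (?i \<theta>) = \<theta>" if "\<theta> \<in> Con S M" for \<theta>
    using img_Con pre_img k[OF that] that by auto
  interpret L: modular_lattice "Con_lattice S N" using congruence_modular N by blast
  have "?i \<alpha> \<subseteq> ?i \<gamma>" using le by (auto simp: img_def)
  then have "Cg S N (?i \<alpha> \<union> (?i \<beta> \<inter> ?i \<gamma>)) = Cg S N (?i \<alpha> \<union> ?i \<beta>) \<inter> ?i \<gamma>"
    using L.modular[of "?i \<alpha>" "?i \<beta>" "?i \<gamma>"] i con by (auto simp: Con_lattice_def)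
  then have "pre M \<phi> (Cg S N (?i \<alpha> \<union> (?i \<beta> \<inter> ?i \<gamma>))) = pre M \<phi> (Cg S N (?i \<alpha> \<union> ?i \<beta>)) \<inter> \<gamma>"
    using i con by (simp add: pre_Int)
  then show ?thesis using i con by (simp add: pre_join Int_Con pre_Int)
qed

text \<open>Gumm's shifting lemma. The path \<open>z\<close>, \<open>x\<close>, \<open>y\<close>,
  \<open>u\<close> shows that \<open>(z, u)\<close> lies in \<open>\<eta>\<close> and in the join of
  \<open>\<eta> \<inter> \<Theta>\<close> with \<open>\<zeta>\<close>; the modular law replaces
  \<open>\<zeta>\<close> by \<open>\<zeta> \<inter> \<eta>\<close>, which is below
  \<open>\<Theta>\<close>.\<close>

lemma shifting:
  assumes M: "member S E TYPE('u) M" and con: "\<eta> \<in> Con S M" "\<zeta> \<in> Con S M" "\<Theta> \<in> Con S M" and le: "\<eta> \<inter> \<zeta> \<subseteq> \<Theta>"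
    and "(x, y) \<in> \<eta>" "(z, u) \<in> \<eta>" "(x, z) \<in> \<zeta>" "(y, u) \<in> \<zeta>" "(x, y) \<in> \<Theta>"
  shows "(z, u) \<in> \<Theta>"
proof -
  let ?J = "Cg S M ((\<eta> \<inter> \<Theta>) \<union> \<zeta>)"
  have J: "?J \<in> Con S M" and J': "\<eta> \<inter> \<Theta> \<union> \<zeta> \<subseteq> ?J"
    using Cg_ge[of "(\<eta> \<inter> \<Theta>) \<union> \<zeta>" S M] Con_Nabla[OF con(1)] Con_Nabla[OF con(2)]
    by (auto intro!: Cg_Con[OF mem_algebra[OF M]])
  have "(z, x) \<in> ?J" "(x, y) \<in> ?J" "(y, u) \<in> ?J" using assms J' Con_sym[OF J] by blast+
  then have "(z, u) \<in> ?J" using Con_trans[OF J] by blast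
  then have "(z, u) \<in> Cg S M ((\<eta> \<inter> \<Theta>) \<union> (\<zeta> \<inter> \<eta>))"
    using modular[OF M Int_Con[OF con(1,3)] con(2,1)] assms by blast
  moreover have "Cg S M ((\<eta> \<inter> \<Theta>) \<union> (\<zeta> \<inter> \<eta>)) \<subseteq> \<Theta>" using con le by (intro Cg_least) auto
  ultimately show ?thesis by blast
qed

text \<open>The kernel of a copy is trivial, so finite generating sets and commutators correspond
  along it, and the hypothesis on algebras in the universe carries over.\<close>

lemma commutator_KCon:
  assumes M: "member S E TYPE('u) M" and "\<alpha> \<in> KCon S M" "\<beta> \<in> KCon S M"
  shows "commutator S M \<alpha> \<beta> \<in> KCon S M"
proof -
  obtain N \<phi> where N: "N \<in> \<C>" and "onto_hom S M N \<phi>" and inj: "inj_on \<phi> (carrier M)"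
    and k: "pre M \<phi> (Delta N) = Delta M"
    using obtain_copy[OF M] by metis
  then interpret onto_hom S M N \<phi> by simp
  have Cg_Delta: "Cg S M (Y \<union> Delta M) = Cg S M Y" if "Y \<subseteq> Nabla M" for Y
    using Cg_Con[OF alg that] Cg_ge[of Y S M] Delta_least[of "Cg S M Y" S M]
    by (intro equalityI Cg_least Cg_mono) auto
  have *: "\<exists>\<theta>'\<in>KCon S N. pre M \<phi> \<theta>' = \<theta>" if \<theta>: "\<theta> \<in> KCon S M" for \<theta>
  proof -
    obtain X where X: "finite X" "X \<subseteq> Nabla M" "\<theta> = Cg S M X" using \<theta> by (auto simp: KCon_def)
    have 1: "img \<phi> X \<subseteq> Nabla N" using X(2) onto by (auto simp: img_def Nabla_def)
    have 2: "pre M \<phi> (img \<phi> X) = X"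
    proof (intro equalityI subrelI)
      fix x y assume "(x, y) \<in> pre M \<phi> (img \<phi> X)"
      then obtain u v where *: "x \<in> carrier M" "y \<in> carrier M" "(u, v) \<in> X" "\<phi> x = \<phi> u" "\<phi> y = \<phi> v"
        by (auto simp: pre_def img_def)
      moreover from * X(2) have "u \<in> carrier M" "v \<in> carrier M" by (auto simp: Nabla_def)
      ultimately show "(x, y) \<in> X" using inj by (metis inj_onD)
    qed (use X(2) in \<open>auto simp: pre_def img_def Nabla_def\<close>)
    have "pre M \<phi> (Cg S N (img \<phi> X)) = \<theta>"
      unfolding pre_Cg[OF 1] 2 k X(3) by (rule Cg_Delta[OF X(2)])
    moreover have "finite (img \<phi> X)" using X(1) by (simp add: img_def)
    ultimately show ?thesis using 1 by (auto simp: KCon_def)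
  qed
  obtain \<alpha>' \<beta>' where ab: "\<alpha>' \<in> KCon S N" "pre M \<phi> \<alpha>' = \<alpha>" "\<beta>' \<in> KCon S N" "pre M \<phi> \<beta>' = \<beta>"
    using *[OF assms(2)] *[OF assms(3)] by blast
  then have con: "\<alpha>' \<in> Con S N" "\<beta>' \<in> Con S N" using Cg_Con[OF algN] by (auto simp: KCon_def)
  have "ker \<subseteq> \<theta>" if "\<theta> \<in> Con S M" for \<theta> using k Delta_least[OF that] by simp
  then have "{\<delta> \<in> Con S M. ker \<subseteq> \<delta> \<and> centralizes S M \<alpha> \<beta> \<delta>} = {\<delta> \<in> Con S M. centralizes S M \<alpha> \<beta> \<delta>}"
    by auto
  with pre_commutator[OF con] have eq: "pre M \<phi> (commutator S N \<alpha>' \<beta>') = commutator S M \<alpha> \<beta>"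
    unfolding ab(2,4) commutator_def[of S M] by (simp only:)
  have "commutator S N \<alpha>' \<beta>' \<in> KCon S N" using commutator_closed N ab(1,3) by simp
  then obtain Y where Y: "finite Y" "Y \<subseteq> Nabla N" "commutator S N \<alpha>' \<beta>' = Cg S N Y"
    unfolding KCon_def by blast
  have "finite (pre M \<phi> Y)"
  proof (rule finite_imageD)
    show "finite (map_prod \<phi> \<phi> ` pre M \<phi> Y)"
      by (rule finite_subset[OF _ Y(1)]) (auto simp: pre_def)
    show "inj_on (map_prod \<phi> \<phi>) (pre M \<phi> Y)"
      using inj by (auto simp: inj_on_def pre_def)
  qed
  moreover have sub: "pre M \<phi> Y \<subseteq> Nabla M" by (auto simp: pre_def Nabla_def)
  moreover have "commutator S M \<alpha> \<beta> = Cg S M (pre M \<phi> Y)"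
    unfolding eq[symmetric] Y(3) pre_Cg[OF Y(2)] k by (rule Cg_Delta[OF sub])
  ultimately show ?thesis by (auto simp: KCon_def)
qed

text \<open>By semi-degeneracy, applied to the quotient by \<open>\<Theta>\<close>, in which the class of \<open>c\<close> is a
  one-element subalgebra.\<close>

lemma Con_eq_Nabla:
  assumes M: "member S E TYPE('u) M" and \<Theta>: "\<Theta> \<in> Con S M" and c: "c \<in> carrier M"
    and idem: "\<And>f. f \<in> ops S \<Longrightarrow> (opn M f (replicate (arity S f) c), c) \<in> \<Theta>"
  shows "\<Theta> = Nabla M"
proof -
  obtain \<phi> :: "_ \<Rightarrow> 'u" where \<phi>: "inj_on \<phi> (carrier M)" using M by (auto simp: embeds_def)
  \<comment> \<open>The choice depends only on the class of \<open>x\<close>, so coding it by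
    \<open>\<phi>\<close> realises the quotient by \<open>\<Theta>\<close> within the universe, with
    kernel exactly \<open>\<Theta>\<close>.\<close>
  define r where "r x = (SOME y. (x, y) \<in> \<Theta>)" for x
  have r: "(x, r x) \<in> \<Theta>" if "x \<in> carrier M" for x
    unfolding r_def by (rule someI, rule Con_refl[OF \<Theta> that])
  have r_eq: "r x = r y" if "(x, y) \<in> \<Theta>" for x y
  proof -
    have "(x, z) \<in> \<Theta> \<longleftrightarrow> (y, z) \<in> \<Theta>" for z using that Con_sym[OF \<Theta>] Con_trans[OF \<Theta>] by blast
    then show ?thesis by (simp add: r_def)
  qed
  define \<psi> where "\<psi> x = \<phi> (r x)" for x
  have ker_\<psi>: "\<psi> x = \<psi> y \<longleftrightarrow> (x, y) \<in> \<Theta>" if xy: "x \<in> carrier M" "y \<in> carrier M" for x y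
  proof
    assume "\<psi> x = \<psi> y"
    moreover have "r x \<in> carrier M" "r y \<in> carrier M" using r xy Con_sub[OF \<Theta>] by blast+
    ultimately have "r x = r y" using \<phi> by (auto simp: \<psi>_def inj_on_def)
    then show "(x, y) \<in> \<Theta>" using r[OF xy(1)] r[OF xy(2)] Con_sym[OF \<Theta>] Con_trans[OF \<Theta>] by metis
  qed (simp add: \<psi>_def r_eq)
  interpret onto_hom S M "image_alg \<psi> M" \<psi>
    by (rule onto_hom_image_alg[OF mem_algebra[OF M] \<Theta> ker_\<psi>])
  let ?N = "image_alg \<psi> M"
  have N: "?N \<in> \<C>" using variety_image[OF identities] M variety by blast
  have "subuniverse S ?N {\<psi> c}"
    unfolding subuniverse_def
  proof (intro conjI ballI allI impI)
    show "{\<psi> c} \<subseteq> carrier ?N" using c by (auto simp: image_alg_def)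
    fix f xs assume f: "f \<in> ops S" and xs: "length xs = arity S f \<and> set xs \<subseteq> {\<psi> c}"
    then have eq: "xs = map \<psi> (replicate (arity S f) c)"
      by (auto simp: subset_iff intro!: nth_equalityI)
    have "opn ?N f xs = \<psi> (opn M f (replicate (arity S f) c))"
      unfolding eq by (rule alg_hom_op[OF hom, symmetric]) (use f c in auto)
    also have "\<dots> = \<psi> c" using ker_\<psi> idem[OF f] Con_sub[OF \<Theta>] by blast
    finally show "opn ?N f xs \<in> {\<psi> c}" by simp
  qed
  with N semi_degenerate obtain d where "carrier ?N = {d}" unfolding semi_degenerate_def by blast
  then have "\<psi> x = \<psi> y" if "x \<in> carrier M" "y \<in> carrier M" for x y
    using that imageI[of x "carrier M" \<psi>] imageI[of y "carrier M" \<psi>] by (simp add: image_alg_def)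
  then have "Nabla M \<subseteq> \<Theta>" using ker_\<psi> by (intro subrelI) (simp add: Nabla_def)
  with Con_Nabla[OF \<Theta>] show ?thesis by blast
qed

subsection \<open>Room in the universe\<close>

lemma pairing: "\<exists>P :: 'u \<times> 'u \<Rightarrow> 'u. inj P"
proof -
  have "infinite (UNIV :: 'u set)" using universe by (simp add: large_universe_def)
  from ordIso_imp_ordLeq[OF card_of_Times_same_infinite[OF this]]
  show ?thesis unfolding card_of_ordLeq[symmetric] by auto
qed

lemma two_points: "\<exists>k0 k1 :: 'u. k0 \<noteq> k1"
proof (rule ccontr)
  assume *: "\<nexists>k0 k1 :: 'u. k0 \<noteq> k1"
  have "(UNIV :: 'u set) \<subseteq> {undefined}" using * by auto
  then show False using universe finite_subset by (auto simp: large_universe_def)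
qed

lemma list_coding: "\<exists>L :: 'u list \<Rightarrow> 'u. inj L"
proof -
  obtain P :: "'u \<times> 'u \<Rightarrow> 'u" where P: "inj P" using pairing by blast
  obtain k0 k1 :: 'u where k: "k0 \<noteq> k1" using two_points by blast
  define L where "L = rec_list (P (k0, k0)) (\<lambda>x _ l. P (k1, P (x, l)))"
  have L: "L [] = P (k0, k0)" "L (x # xs) = P (k1, P (x, L xs))" for x xs
    by (simp_all add: L_def)
  have "L xs = L ys \<longrightarrow> xs = ys" for xs ys
  proof (induction xs arbitrary: ys)
    case Nil
    then show ?case using k by (cases ys) (auto simp: L inj_eq[OF P])
  next
    case (Cons x xs)
    then show ?case using k by (cases ys) (auto simp: L inj_eq[OF P])
  qed
  then show ?thesis by (auto simp: inj_def)
qed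

lemma embeds_finite_power:
  fixes B :: "('i::finite \<Rightarrow> 'b) set"
  assumes "embeds TYPE('u) A" "\<And>x i. x \<in> B \<Longrightarrow> x i \<in> A"
  shows "embeds TYPE('u) B"
proof -
  obtain g :: "'b \<Rightarrow> 'u" where g: "inj_on g A" using assms(1) by (auto simp: embeds_def)
  obtain L :: "'u list \<Rightarrow> 'u" where L: "inj L" using list_coding by blast
  obtain ix :: "'i list" where ix: "set ix = UNIV" using finite_list[OF finite_UNIV] by auto
  have "inj_on (\<lambda>x. L (map (\<lambda>i. g (x i)) ix)) B"
  proof (rule inj_onI)
    fix x y assume xy: "x \<in> B" "y \<in> B" "L (map (\<lambda>i. g (x i)) ix) = L (map (\<lambda>i. g (y i)) ix)"
    then have "g (x i) = g (y i)" for i using ix by (auto simp: inj_eq[OF L])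
    then show "x = y" using g assms(2) xy by (intro ext) (auto simp: inj_on_def)
  qed
  then show ?thesis unfolding embeds_def by blast
qed

lemma mem_sub_pow:
  fixes B :: "('i::finite \<Rightarrow> 'b) set"
  assumes "member S E TYPE('u) M" "is_sub_pow S M B"
  shows "member S E TYPE('u) (sub_pow M B)"
  using assms variety_sub_pow[of M S E B] embeds_finite_power[of "carrier M" B]
  by (simp add: is_sub_pow_def)

lemma mem_pairs: "member S E TYPE('u) M \<Longrightarrow> \<beta> \<in> Con S M \<Longrightarrow> member S E TYPE('u) (sub_pow M (pairs \<beta>))"
  by (intro mem_sub_pow is_sub_pow_pairs mem_algebra)

subsection \<open>The commutator\<close>

text \<open>A proof without Day's terms: the chain of congruent elements which these terms produce is
  found in the algebra of all squares of values in the term condition, by the modular law.\<close>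

lemma centralizes_column:
  assumes M: "member S E TYPE('u) M" and con: "\<alpha> \<in> Con S M" "\<beta> \<in> Con S M" "\<delta>' \<in> Con S M" and \<delta>: "\<delta> \<in> Con S M"
    and C: "centralizes S M \<alpha> \<beta> \<delta>" and le: "\<delta> \<subseteq> \<delta>'"
    and T: "wf_trm S (Inl ` \<alpha> \<union> Inr ` \<beta>) T"
    and col: "(entry M False True T, entry M True True T) \<in> \<delta>'"
  shows "(entry M False False T, entry M True False T) \<in> \<delta>'"
proof -
  let ?V = "Inl ` \<alpha> \<union> Inr ` \<beta>"
  have alg: "is_algebra S M" by (rule mem_algebra[OF M])
  have sub: "\<alpha> \<subseteq> Nabla M" "\<beta> \<subseteq> Nabla M" using con Con_Nabla by blast+
  define sq where "sq T = (\<lambda>p. eval M (case_sum (sel (fst p)) (sel (snd p))) T)" for T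
  have sq_at: "sq T (i, j) = entry M i j T" for T i j by (simp add: sq_def entry_def)
  define B where "B = sq ` {T. wf_trm S ?V T}"
  let ?Q = "sub_pow M B"
  have BI: "sq T \<in> B" if "wf_trm S ?V T" for T using that by (auto simp: B_def)
  have B: "is_sub_pow S M B"
    unfolding B_def sq_def
    by (rule is_sub_pow_terms[OF alg T]) (use sub in \<open>auto simp: sel_def Nabla_def\<close>)
  have Q: "member S E TYPE('u) ?Q" by (rule mem_sub_pow[OF M B])
  have algQ: "is_algebra S ?Q" by (rule mem_algebra[OF Q])
  define at where "at i j \<theta> = pre ?Q (\<lambda>x. x (i, j)) \<theta>" for i j \<theta>
  have at_Con: "at i j \<theta> \<in> Con S ?Q" if "\<theta> \<in> Con S M" for i j \<theta>
    unfolding at_def by (rule pre_Con[OF algQ proj_hom[OF B] that])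
  have at_iff: "(x, y) \<in> at i j \<theta> \<longleftrightarrow> x \<in> B \<and> y \<in> B \<and> (x (i, j), y (i, j)) \<in> \<theta>" for x y i j \<theta>
    by (auto simp: at_def pre_def)
  have carr: "x i \<in> carrier M" if "x \<in> B" for x i using B that unfolding is_sub_pow_def by blast
  note \<Delta> = Delta_Con[OF alg]
  \<comment> \<open>\<open>\<gamma>'\<close> compares first rows, \<open>\<beta>'\<close> left
    columns; \<open>\<alpha>'\<close> lies below \<open>\<gamma>'\<close>, as the modular law
    requires, and also compares the last corner modulo \<open>\<delta>'\<close>.\<close>
  define \<gamma>' where "\<gamma>' = at False False (Delta M) \<inter> at False True (Delta M)"
  define \<beta>' where "\<beta>' = at False False (Delta M) \<inter> at True False (Delta M)"
  define \<alpha>' where "\<alpha>' = \<gamma>' \<inter> at True True \<delta>'"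
  have cons: "\<alpha>' \<in> Con S ?Q" "\<beta>' \<in> Con S ?Q" "\<gamma>' \<in> Con S ?Q" "\<beta>' \<inter> \<gamma>' \<in> Con S ?Q"
    unfolding \<alpha>'_def \<beta>'_def \<gamma>'_def by (intro Int_Con at_Con \<Delta> con)+
  define a where "a = entry M False False T"
  define reslct where "reslct r r' c c' =
    map_trm id (map_sum (\<lambda>p. (sel r p, sel r' p)) (\<lambda>q. (sel c q, sel c' q))) T" for r r' c c'
  have reslct: "entry M i j (reslct r r' c c') = entry M (if i then r' else r) (if j then c' else c) T"
    for i j r r' c c'
  proof -
    have "case_sum (sel i) (sel j) \<circ> map_sum (\<lambda>p. (sel r p, sel r' p)) (\<lambda>q. (sel c q, sel c' q)) =
      case_sum (sel (if i then r' else r)) (sel (if j then c' else c))"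
      by (rule ext) (auto simp: sel_def split: sum.split)
    from arg_cong[where f = "\<lambda>v. eval M v T", OF this]
    show ?thesis unfolding entry_def reslct_def eval_map_trm .
  qed
  \<comment> \<open>If \<open>T\<close> has the rows \<open>a b\<close> and \<open>c d\<close>, then
    \<open>X\<close>, \<open>Y\<close>, \<open>Z\<close>, \<open>U\<close> have the rows
    \<open>a a\<close> and \<open>a a\<close>, \<open>a b\<close> and \<open>a b\<close>,
    \<open>a b\<close> and \<open>c d\<close>, \<open>a a\<close> and \<open>c c\<close>.
    Consecutive squares are related by \<open>\<beta>'\<close>, \<open>\<alpha>'\<close>,
    \<open>\<beta>'\<close>, the middle step being the hypothesis \<open>col\<close>, while
    \<open>X\<close> and \<open>U\<close> have the same first row.\<close>
  define X where "X = sq (reslct False False False False)"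
  define Y where "Y = sq (reslct False False False True)"
  define Z where "Z = sq T"
  define U where "U = sq (reslct False True False False)"
  have sel_in: "(sel i p, sel j p) \<in> \<theta>" if "p \<in> \<theta>" "\<theta> \<in> Con S M" "\<not> i \<or> j" for i j p \<theta>
    using that Con_sub[OF that(2)] Con_refl[OF that(2)] by (cases p) (auto simp: sel_def)
  have wf: "wf_trm S ?V (reslct r r' c c')" if "\<not> r \<or> r'" "\<not> c \<or> c'" for r r' c c'
    unfolding reslct_def
  proof (rule wf_map_trm[OF T], rule image_subsetI)
    fix x assume "x \<in> ?V"
    then consider p where "x = Inl p" "p \<in> \<alpha>" | q where "x = Inr q" "q \<in> \<beta>" by blast
    then show "map_sum (\<lambda>p. (sel r p, sel r' p)) (\<lambda>q. (sel c q, sel c' q)) x \<in> ?V"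
      using sel_in[OF _ con(1) that(1)] sel_in[OF _ con(2) that(2)] by cases simp_all
  qed
  have mem_B: "X \<in> B" "Y \<in> B" "Z \<in> B" "U \<in> B"
    unfolding X_def Y_def Z_def U_def by (auto intro!: BI wf T)
  note defs = X_def Y_def Z_def U_def sq_at reslct
  have xu: "(X, U) \<in> \<gamma>'"
    using mem_B entry_closed[OF alg sub T] unfolding \<gamma>'_def
    by (simp_all add: at_iff Delta_iff) (simp_all add: defs)
  have xy: "(X, Y) \<in> \<beta>'" "(Z, U) \<in> \<beta>'"
    using mem_B entry_closed[OF alg sub T] unfolding \<beta>'_def
    by (simp_all add: at_iff Delta_iff) (simp_all add: defs)
  have yz: "(Y, Z) \<in> \<alpha>'"
    using mem_B entry_closed[OF alg sub T] col unfolding \<alpha>'_def \<gamma>'_def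
    by (simp_all add: at_iff Delta_iff) (simp_all add: defs)
  let ?J = "Cg S ?Q (\<alpha>' \<union> \<beta>')"
  have J: "?J \<in> Con S ?Q" and J': "\<alpha>' \<union> \<beta>' \<subseteq> ?J"
    using Cg_ge[of "\<alpha>' \<union> \<beta>'" S ?Q] Con_Nabla[OF cons(1)] Con_Nabla[OF cons(2)]
    by (auto intro!: Cg_Con[OF algQ])
  have "(X, Y) \<in> ?J" "(Y, Z) \<in> ?J" "(Z, U) \<in> ?J" using xy yz J' by auto
  then have "(X, U) \<in> ?J" using Con_trans[OF J] by blast
  with xu modular[OF Q cons(1-3)] have XU: "(X, U) \<in> Cg S ?Q (\<alpha>' \<union> (\<beta>' \<inter> \<gamma>'))"
    by (auto simp: \<alpha>'_def)
  have row: "(x (True, False), x (True, True)) \<in> \<delta>'"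
    if x: "x \<in> B" "x (False, False) = a" "x (False, True) = a" for x
  proof -
    obtain T' where T': "wf_trm S ?V T'" "x = sq T'" using x by (auto simp: B_def)
    then have "entry M False False T' = a" "entry M False True T' = a"
      using x by (auto simp: sq_at)
    moreover have "(a, a) \<in> \<delta>"
      using entry_closed[OF alg sub T] by (auto simp: a_def intro: Con_refl[OF \<delta>])
    ultimately have "(entry M True False T', entry M True True T') \<in> \<delta>"
      using C[unfolded centralizes_iff, rule_format, OF T'(1)] by simp
    then show ?thesis using le T'(2) by (auto simp: sq_at)
  qed
  \<comment> \<open>\<open>X\<close> lies in \<open>D\<close>, and membership of \<open>U\<close>
    gives the claim. Under \<open>\<beta>' \<inter> \<gamma>'\<close> only the last corner changes;
    the term condition (\<open>row\<close>) ties it to the unchanged corner beside it.\<close>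
  define D where "D = {x \<in> B. x (False, False) = a \<and> x (False, True) = a \<and> (x (True, True), a) \<in> \<delta>'}"
  have "Cg S ?Q (\<alpha>' \<union> (\<beta>' \<inter> \<gamma>')) \<subseteq> Syn S ?Q D"
  proof (intro Cg_least Syn_Con algQ Un_least)
    show "\<alpha>' \<subseteq> Syn S ?Q D"
    proof (rule Con_le_Syn[OF cons(1)])
      fix x y assume xy: "(x, y) \<in> \<alpha>'" and x: "x \<in> D"
      then have y: "y \<in> B" "y (False, False) = a" "y (False, True) = a"
        "(x (True, True), y (True, True)) \<in> \<delta>'" "(x (True, True), a) \<in> \<delta>'"
        by (auto simp: \<alpha>'_def \<gamma>'_def at_iff D_def Delta_iff)
      then have "(y (True, True), a) \<in> \<delta>'" using Con_sym[OF con(3)] Con_trans[OF con(3)] by blast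
      with y show "y \<in> D" by (simp add: D_def)
    qed
    show "\<beta>' \<inter> \<gamma>' \<subseteq> Syn S ?Q D"
    proof (rule Con_le_Syn[OF cons(4)])
      fix x y assume xy: "(x, y) \<in> \<beta>' \<inter> \<gamma>'" and x: "x \<in> D"
      then have *: "x \<in> B" "x (False, False) = a" "x (False, True) = a" "(x (True, True), a) \<in> \<delta>'"
        and y: "y \<in> B" "y (False, False) = a" "y (False, True) = a" "y (True, False) = x (True, False)"
        by (auto simp: \<beta>'_def \<gamma>'_def at_iff D_def Delta_iff)
      have "(y (True, True), a) \<in> \<delta>'"
        using row[OF *(1-3)] row[OF y(1-3)] y(4) *(4) Con_sym[OF con(3)] Con_trans[OF con(3)] by metis
      with y show "y \<in> D" by (simp add: D_def)
    qed
  qed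
  with XU have "(X, U) \<in> Syn S ?Q D" by blast
  moreover have "X \<in> D" using mem_B(1) Con_refl[OF con(3)] entry_closed[OF alg sub T]
    by (auto simp: D_def defs a_def)
  ultimately have "U \<in> D" using Syn_saturated by metis
  then have "(entry M True False T, a) \<in> \<delta>'" by (auto simp: D_def defs)
  then show ?thesis using Con_sym[OF con(3)] by (simp add: a_def)
qed

end

section \<open>Codes for terms, and algebras of eventually constant sequences\<close>

primrec term_code ::
  "('u \<times> 'u \<Rightarrow> 'u) \<Rightarrow> ('u list \<Rightarrow> 'u) \<Rightarrow> ('f \<Rightarrow> 'u) \<Rightarrow> (bool \<Rightarrow> 'u) \<Rightarrow> ('f, bool) trm \<Rightarrow> 'u" where
  "term_code P L g h (Var b) = P (h False, h b)"
| "term_code P L g h (Fn f ts) = P (h True, P (g f, L (map (term_code P L g h) ts)))"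

text \<open>Allows the values of terms in two variables to be copied into the universe, however
  large the power they live in.\<close>

lemma inj_on_term_code:
  assumes P: "inj P" and L: "inj L" and g: "inj_on g (ops S)" and h: "inj h"
  shows "inj_on (term_code P L g h) {t. wf_trm S UNIV t}"
proof -
  have "wf_trm S UNIV t' \<longrightarrow> term_code P L g h t = term_code P L g h t' \<longrightarrow> t = t'"
    if "wf_trm S UNIV t" for t t'
    using that
  proof (induction t arbitrary: t')
    case (Var b)
    then show ?case by (cases t') (auto simp: inj_eq[OF P] inj_eq[OF h])
  next
    case (Fn f ts)
    show ?case
    proof (cases t')
      case (Var b)
      then show ?thesis by (auto simp: inj_eq[OF P] inj_eq[OF h])
    next
      case t': (Fn f' ts')
      show ?thesis
      proof (intro impI)
        assume wf: "wf_trm S UNIV t'" and eq: "term_code P L g h (Fn f ts) = term_code P L g h t'"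
        then have "g f = g f'" and ts: "map (term_code P L g h) ts = map (term_code P L g h) ts'"
          using t' by (auto simp: inj_eq[OF P] inj_eq[OF L])
        then have "f = f'" using g wf t' Fn.prems by (auto simp: inj_on_def)
        have len: "length ts = length ts'" using ts map_eq_imp_length_eq by blast
        have "ts ! i = ts' ! i" if "i < length ts" for i
        proof -
          have "ts ! i \<in> set ts" "ts' ! i \<in> set ts'" using that len by auto
          moreover have "term_code P L g h (ts ! i) = term_code P L g h (ts' ! i)"
            using arg_cong[where f = "\<lambda>l. l ! i", OF ts] that len by simp
          ultimately show ?thesis using Fn.IH Fn.prems wf t' by simp
        qed
        with len have "ts = ts'" by (intro nth_equalityI)
        with \<open>f = f'\<close> t' show "Fn f ts = t'" by simp
      qed
    qed
  qed
  then show ?thesis by (intro inj_onI) blast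
qed

text \<open>There are infinitely many coordinates, so that finitely many generators cannot tell late
  ones apart, yet each element is coded by a finite list. Relating all entries by
  \<open>\<sigma>\<close> makes any two coordinates give an element of
  \<open>pairs \<sigma>\<close>.\<close>

definition ev_const :: "'a rel \<Rightarrow> (nat \<Rightarrow> 'a) set" where
  "ev_const \<sigma> = {x. (\<forall>i j. (x i, x j) \<in> \<sigma>) \<and> (\<exists>n. \<forall>i\<ge>n. x i = x n)}"

lemma ev_const_closed: "\<sigma> \<in> Con S M \<Longrightarrow> x \<in> ev_const \<sigma> \<Longrightarrow> x i \<in> carrier M"
  unfolding ev_const_def using Con_sub[of \<sigma> S M "x i" "x i"] by blast

lemma ev_const_all:
  assumes "finite X" "X \<subseteq> ev_const \<sigma>"
  shows "\<exists>n. \<forall>x\<in>X. \<forall>i\<ge>n. x i = x n"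
  using assms
proof induction
  case (insert x X)
  then obtain n m where nm: "\<forall>x\<in>X. \<forall>i\<ge>n. x i = x n" "\<forall>i\<ge>m. x i = x m"
    by (auto simp: ev_const_def)
  have "y i = y (max n m)" if "y \<in> insert x X" "i \<ge> max n m" for y i
  proof (cases "y \<in> X")
    case True
    then have "y i = y n" "y (max n m) = y n" using nm(1) that by auto
    then show ?thesis by simp
  next
    case False
    then have y: "y = x" using that by simp
    show ?thesis using nm(2)[rule_format, of i] nm(2)[rule_format, of "max n m"] that(2) by (simp add: y)
  qed
  then show ?case by blast
qed simp

lemma is_sub_pow_ev_const:
  assumes alg: "is_algebra S M" and \<sigma>: "\<sigma> \<in> Con S M"
  shows "is_sub_pow S M (ev_const \<sigma>)"
  unfolding is_sub_pow_def
proof (intro conjI ballI allI impI)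
  obtain c where "c \<in> carrier M" using alg by (auto simp: is_algebra_def)
  then have "(\<lambda>_. c) \<in> ev_const \<sigma>" using Con_refl[OF \<sigma>] by (auto simp: ev_const_def)
  then show "ev_const \<sigma> \<noteq> {}" by blast
  show "x i \<in> carrier M" if "x \<in> ev_const \<sigma>" for x i
    by (rule ev_const_closed[OF \<sigma> that])
  fix f xs assume f: "f \<in> ops S" and xs: "length xs = arity S f \<and> set xs \<subseteq> ev_const \<sigma>"
  obtain n where n: "\<forall>x\<in>set xs. \<forall>i\<ge>n. x i = x n" using ev_const_all[of "set xs" \<sigma>] xs by auto
  have "(opn M f (map (\<lambda>x. x i) xs), opn M f (map (\<lambda>x. x j) xs)) \<in> \<sigma>" for i j
    using f xs by (intro Con_op[OF \<sigma>]) (auto simp: list_all2_conv_all_nth ev_const_def subset_iff)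
  moreover have "map (\<lambda>x. x i) xs = map (\<lambda>x. x n) xs" if "i \<ge> n" for i
    using n that by auto
  then have "\<forall>i\<ge>n. opn M f (map (\<lambda>x. x i) xs) = opn M f (map (\<lambda>x. x n) xs)"
    by (metis (no_types))
  ultimately show "(\<lambda>i. opn M f (map (\<lambda>x. x i) xs)) \<in> ev_const \<sigma>" unfolding ev_const_def by blast
qed

lemma const_ev_const: "\<sigma> \<in> Con S M \<Longrightarrow> x \<in> carrier M \<Longrightarrow> (\<lambda>_. x) \<in> ev_const \<sigma>"
  by (auto simp: ev_const_def intro: Con_refl)

definition spike :: "nat \<Rightarrow> 'a \<Rightarrow> 'a \<Rightarrow> nat \<Rightarrow> 'a" where
  "spike j x y = (\<lambda>i. if i = j then y else x)"

lemma spike_simps [simp]: "spike j x y j = y" "i \<noteq> j \<Longrightarrow> spike j x y i = x" "spike j x x = (\<lambda>_. x)"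
  by (auto simp: spike_def)

lemma spike_ev_const:
  assumes \<sigma>: "\<sigma> \<in> Con S M" and xy: "(x, y) \<in> \<sigma>"
  shows "spike j x y \<in> ev_const \<sigma>"
proof -
  have "x \<in> carrier M" "y \<in> carrier M" using Con_sub[OF \<sigma> xy] by auto
  then have "\<forall>i i'. ((spike j x y) i, (spike j x y) i') \<in> \<sigma>"
    using xy Con_refl[OF \<sigma>] Con_sym[OF \<sigma>] by (simp add: spike_def)
  moreover have "\<forall>i\<ge>Suc j. (spike j x y) i = (spike j x y) (Suc j)" by simp
  ultimately show ?thesis unfolding ev_const_def by blast
qed

section \<open>Symmetry, residuation and unit law of the commutator; compactness of
  \<open>\<nabla>\<close>\<close>

context cm_variety
begin

text \<open>\<open>T1\<close> transposes the square, so \<open>centralizes_column\<close> becomes a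
  statement about rows; \<open>T2\<close> also exchanges the columns of \<open>T1\<close>, using
  symmetry of \<open>\<beta>\<close>, and yields the converse implication. Admitting a larger
  \<open>\<delta>'\<close> is what later makes the term condition upward closed in
  \<open>\<delta>\<close>.\<close>

lemma centralizes_swap:
  assumes M: "member S E TYPE('u) M"
    and con: "\<alpha> \<in> Con S M" "\<beta> \<in> Con S M" "\<delta> \<in> Con S M" "\<delta>' \<in> Con S M"
    and C: "centralizes S M \<alpha> \<beta> \<delta>" and le: "\<delta> \<subseteq> \<delta>'"
  shows "centralizes S M \<beta> \<alpha> \<delta>'"
  unfolding centralizes_iff
proof (intro allI impI)
  fix T assume T: "wf_trm S (Inl ` \<beta> \<union> Inr ` \<alpha>) T"
  let ?V = "Inl ` \<alpha> \<union> Inr ` \<beta>"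
  define T1 where "T1 = map_trm id (case_sum Inr Inl) T"
  define T2 where "T2 = map_trm id (map_sum id prod.swap) T1"
  have e1: "entry M i j T1 = entry M j i T" for i j
  proof -
    have "case_sum (sel i) (sel j) \<circ> case_sum Inr Inl = case_sum (sel j) (sel i)"
      by (rule ext) (auto split: sum.split)
    from arg_cong[where f = "\<lambda>v. eval M v T", OF this]
    show ?thesis unfolding entry_def T1_def eval_map_trm .
  qed
  have e2: "entry M i j T2 = entry M i (\<not> j) T1" for i j
  proof -
    have "case_sum (sel i) (sel j) \<circ> map_sum id prod.swap = case_sum (sel i) (sel (\<not> j))"
      by (rule ext) (auto simp: sel_def split: sum.split)
    from arg_cong[where f = "\<lambda>v. eval M v T1", OF this]
    show ?thesis unfolding entry_def T2_def eval_map_trm .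
  qed
  have wf1: "wf_trm S ?V T1" unfolding T1_def by (rule wf_map_trm[OF T]) auto
  have wf2: "wf_trm S ?V T2"
    unfolding T2_def
    by (rule wf_map_trm[OF wf1]) (use Con_sym[OF con(2)] in auto)
  note * = centralizes_column[OF M con(1,2,4,3) C le]
  show "((entry M False False T, entry M False True T) \<in> \<delta>') =
      ((entry M True False T, entry M True True T) \<in> \<delta>')"
    using *[OF wf1] *[OF wf2] by (auto simp: e1 e2)
qed

text \<open>Two swaps: one passes from the commutator to the larger \<open>\<delta>\<close>, the
  other restores the order of the arguments.\<close>

lemma commutator_le_iff:
  assumes M: "member S E TYPE('u) M" and con: "\<alpha> \<in> Con S M" "\<beta> \<in> Con S M" "\<delta> \<in> Con S M"
  shows "commutator S M \<alpha> \<beta> \<subseteq> \<delta> \<longleftrightarrow> centralizes S M \<alpha> \<beta> \<delta>"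
proof
  assume le: "commutator S M \<alpha> \<beta> \<subseteq> \<delta>"
  have "commutator S M \<alpha> \<beta> \<in> Con S M" using commutator_Con con Con_Nabla by blast
  from centralizes_swap[OF M con(1,2) this con(3) centralizes_commutator le]
  show "centralizes S M \<alpha> \<beta> \<delta>" using centralizes_swap[OF M con(2,1,3,3)] by blast
qed (rule commutator_least[OF con(3)])

lemma commutator_commute:
  assumes M: "member S E TYPE('u) M" and con: "\<alpha> \<in> Con S M" "\<beta> \<in> Con S M"
  shows "commutator S M \<alpha> \<beta> = commutator S M \<beta> \<alpha>"
proof -
  have "centralizes S M \<alpha> \<beta> \<mu> \<longleftrightarrow> centralizes S M \<beta> \<alpha> \<mu>" if "\<mu> \<in> Con S M" for \<mu>
    using centralizes_swap[OF M con that that] centralizes_swap[OF M con(2,1) that that] by blast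
  then show ?thesis unfolding commutator_def by (metis (no_types, lifting) Collect_cong)
qed

text \<open>Residuation: for fixed \<open>\<beta>\<close> and \<open>\<delta>\<close> there is a
  largest admissible \<open>\<alpha>\<close>, from which distributivity over joins is
  immediate.\<close>

lemma commutator_le_iff_ann:
  assumes M: "member S E TYPE('u) M" and con: "\<alpha> \<in> Con S M" "\<beta> \<in> Con S M" "\<delta> \<in> Con S M"
  shows "commutator S M \<alpha> \<beta> \<subseteq> \<delta> \<longleftrightarrow> \<alpha> \<subseteq> ann S M \<beta> \<delta>"
  using commutator_le_iff[OF M con] centralizes_iff_ann[OF mem_algebra[OF M] _ con(2)] Con_Nabla[OF con(1)]
  by blast

lemma commutator_join_le:
  assumes M: "member S E TYPE('u) M" and con: "\<alpha> \<in> Con S M" "\<alpha>' \<in> Con S M" "\<beta> \<in> Con S M" "\<delta> \<in> Con S M"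
    and le: "commutator S M \<alpha> \<beta> \<subseteq> \<delta>" "commutator S M \<alpha>' \<beta> \<subseteq> \<delta>"
  shows "commutator S M (Cg S M (\<alpha> \<union> \<alpha>')) \<beta> \<subseteq> \<delta>"
proof -
  have alg: "is_algebra S M" by (rule mem_algebra[OF M])
  have "Cg S M (\<alpha> \<union> \<alpha>') \<subseteq> ann S M \<beta> \<delta>"
    using le commutator_le_iff_ann[OF M] con by (intro Cg_least ann_Con alg) auto
  moreover have "Cg S M (\<alpha> \<union> \<alpha>') \<in> Con S M" using con Con_Nabla by (intro Cg_Con alg) blast
  ultimately show ?thesis using commutator_le_iff_ann[OF M] con by blast
qed

text \<open>Put \<open>\<delta> = [\<nabla>, \<theta>]\<close>. Then \<open>Syn\<close> identifies
  all constant pairs in the algebra of \<open>\<theta>\<close>-pairs, so the operations fix a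
  constant pair modulo \<open>Syn\<close>, and semi-degeneracy makes \<open>Syn\<close> the total
  relation. As \<open>(x, x)\<close> lies in \<open>\<delta>\<close>, so does every pair of
  \<open>\<theta>\<close>.\<close>

lemma commutator_Nabla:
  assumes M: "member S E TYPE('u) M" and \<theta>: "\<theta> \<in> Con S M"
  shows "commutator S M \<theta> (Nabla M) = \<theta>"
proof -
  have alg: "is_algebra S M" by (rule mem_algebra[OF M])
  have N: "Nabla M \<in> Con S M" by (rule Nabla_Con[OF alg])
  let ?\<delta> = "commutator S M (Nabla M) \<theta>" and ?P = "sub_pow M (pairs \<theta>)"
  let ?Syn = "Syn S ?P {z. (z False, z True) \<in> ?\<delta>}"
  have P: "member S E TYPE('u) ?P" by (rule mem_pairs[OF M \<theta>])
  have Syn: "?Syn \<in> Con S ?P" by (rule Syn_Con[OF mem_algebra[OF P]])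
  have \<delta>: "?\<delta> \<in> Con S M" by (rule commutator_Con[OF N Con_Nabla[OF \<theta>]])
  have "Nabla M \<subseteq> ann S M \<theta> ?\<delta>" using commutator_le_iff_ann[OF M N \<theta> \<delta>] by blast
  then have diag: "((\<lambda>_. x), (\<lambda>_. y)) \<in> ?Syn" if "x \<in> carrier M" "y \<in> carrier M" for x y
    using that by (auto simp: ann_def pre_def Nabla_def)
  obtain c where c: "c \<in> carrier M" using alg by (auto simp: is_algebra_def)
  have "?Syn = Nabla ?P"
  proof (rule Con_eq_Nabla[OF P Syn])
    show "(\<lambda>_. c) \<in> carrier ?P" using c by (auto simp: pairs_def intro: Con_refl[OF \<theta>])
    fix f assume "f \<in> ops S"
    then have "opn M f (replicate (arity S f) c) \<in> carrier M" using c by (auto intro!: algebra_op[OF alg])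
    then show "(opn ?P f (replicate (arity S f) (\<lambda>_. c)), (\<lambda>_. c)) \<in> ?Syn" using diag c by simp
  qed
  moreover have "(x, y) \<in> ?\<delta>" if xy: "(x, y) \<in> \<theta>" and eq: "?Syn = Nabla ?P" for x y
  proof -
    have x: "x \<in> carrier M" using Con_sub[OF \<theta> xy] by simp
    have "(pair x x, pair x y) \<in> ?Syn"
      unfolding eq using xy Con_refl[OF \<theta> x] by (simp add: Nabla_def)
    from Syn_saturated[OF this] show ?thesis using Con_refl[OF \<delta> x] by simp
  qed
  ultimately have "\<theta> \<subseteq> ?\<delta>" by (intro subrelI) blast
  moreover have "?\<delta> \<subseteq> \<theta>" using commutator_le_Int[OF N \<theta>] by blast
  ultimately show ?thesis using commutator_commute[OF M N \<theta>] by blast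
qed

text \<open>The constant sequence \<open>c\<close> and the sequence \<open>d\<close> of witnesses against compactness
  generate a subalgebra of a power of \<open>M\<close> which contradicts semi-degeneracy.\<close>

lemma Nabla_KCon:
  assumes M: "member S E TYPE('u) M"
  shows "Nabla M \<in> KCon S M"
proof (rule ccontr)
  assume neg: "Nabla M \<notin> KCon S M"
  have alg: "is_algebra S M" by (rule mem_algebra[OF M])
  obtain c where c: "c \<in> carrier M" using alg by (auto simp: is_algebra_def)
  \<comment> \<open>The pair that a congruence must contain for the class of \<open>c\<close> to be
    closed under \<open>f\<close>.\<close>
  define e where "e f = (opn M f (replicate (arity S f) c), c)" for f
  have e: "e ` F \<subseteq> Nabla M" if "F \<subseteq> ops S" for F
    using that c by (auto simp: e_def Nabla_def intro!: algebra_op[OF alg])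
  \<comment> \<open>A finite \<open>F\<close> yields a finitely generated congruence, proper by
    assumption, which cannot relate \<open>c\<close> to everything. For other \<open>F\<close> any
    value will do.\<close>
  have ex: "\<exists>d\<in>carrier M. finite F \<and> F \<subseteq> ops S \<longrightarrow> (c, d) \<notin> Cg S M (e ` F)" for F
  proof (cases "finite F \<and> F \<subseteq> ops S")
    case True
    then have "Cg S M (e ` F) \<in> KCon S M" using e by (auto simp: KCon_def)
    with neg have ne: "Cg S M (e ` F) \<noteq> Nabla M" by auto
    have con: "Cg S M (e ` F) \<in> Con S M" using Cg_Con[OF alg e] True by blast
    show ?thesis
    proof (rule ccontr)
      assume "\<not> ?thesis"
      then have *: "(c, x) \<in> Cg S M (e ` F)" if "x \<in> carrier M" for x using that by blast
      have "Nabla M \<subseteq> Cg S M (e ` F)"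
      proof (rule subrelI)
        fix x y assume "(x, y) \<in> Nabla M"
        then show "(x, y) \<in> Cg S M (e ` F)"
          using Con_trans[OF con Con_sym[OF con *] *] by (simp add: Nabla_def)
      qed
      with ne Con_Nabla[OF con] show False by blast
    qed
  qed (use c in blast)
  then obtain d where d: "\<And>F. d F \<in> carrier M"
    "\<And>F. finite F \<Longrightarrow> F \<subseteq> ops S \<Longrightarrow> (c, d F) \<notin> Cg S M (e ` F)"
    by metis
  \<comment> \<open>Coordinates are indexed by the sets \<open>F\<close> of operation symbols; the
    two variables stand for the constant \<open>c\<close> and for \<open>d\<close>.\<close>
  define val where "val = (\<lambda>t F. eval M (\<lambda>b. if b then d F else c) t)"
  define B where "B = val ` {t. wf_trm S UNIV t}"
  let ?N = "sub_pow M B"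
  have B: "is_sub_pow S M B"
    unfolding B_def val_def
    by (rule is_sub_pow_terms[OF alg, of _ "Var True"]) (use d(1) c in auto)
  have "embeds TYPE('u) B"
  proof -
    obtain P :: "'u \<times> 'u \<Rightarrow> 'u" where P: "inj P" using pairing by blast
    obtain L :: "'u list \<Rightarrow> 'u" where L: "inj L" using list_coding by blast
    obtain k0 k1 :: 'u where k: "k0 \<noteq> k1" using two_points by blast
    obtain g :: "'f \<Rightarrow> 'u" where g: "inj_on g (ops S)" using universe by (auto simp: large_universe_def)
    define h where "h b = (if b then k1 else k0)" for b
    have h: "inj h" using k by (auto simp: h_def inj_def)
    define \<phi> where "\<phi> = term_code P L g h \<circ> inv_into {t. wf_trm S UNIV t} val"
    have "inj_on \<phi> B"
      unfolding \<phi>_def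
    proof (rule comp_inj_on)
      show "inj_on (inv_into {t. wf_trm S UNIV t} val) B"
        unfolding B_def by (rule inj_on_inv_into) simp
      show "inj_on (term_code P L g h) (inv_into {t. wf_trm S UNIV t} val ` B)"
        by (rule inj_on_subset[OF inj_on_term_code[OF P L g h]]) (use inv_into_into[of _ val "{t. wf_trm S UNIV t}"] in \<open>auto simp: B_def\<close>)
    qed
    then show ?thesis by (auto simp: embeds_def)
  qed
  then have N: "member S E TYPE('u) ?N" using variety_sub_pow[OF _ B] M by simp
  define c' where "c' = (\<lambda>_ :: 'f set. c)"
  define e' where "e' f = (opn ?N f (replicate (arity S f) c'), c')" for f
  have "val (Var False) \<in> B" "val (Var True) \<in> B" by (auto simp: B_def)
  moreover have "val (Var False) = c'" "val (Var True) = d" by (auto simp: val_def c'_def)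
  ultimately have in_B: "c' \<in> B" "d \<in> B" by auto
  have e'_sub: "e' ` ops S \<subseteq> Nabla ?N"
    using in_B by (auto simp: e'_def Nabla_def simp del: opn_sub_pow
        intro!: algebra_op[OF mem_algebra[OF N], unfolded carrier_sub_pow])
  have "Cg S ?N (e' ` ops S) = Nabla ?N"
  proof (rule Con_eq_Nabla[OF N Cg_Con[OF mem_algebra[OF N] e'_sub], of c'])
    show "c' \<in> carrier ?N" using in_B by simp
    show "(opn ?N f (replicate (arity S f) c'), c') \<in> Cg S ?N (e' ` ops S)" if "f \<in> ops S" for f
      unfolding e'_def[symmetric] using that Cg_ge by blast
  qed
  then have "(c', d) \<in> Cg S ?N (e' ` ops S)" using in_B by (simp add: Nabla_def)
  from Cg_finitary[OF mem_algebra[OF N] e'_sub this]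
  obtain G where G: "finite G" "G \<subseteq> e' ` ops S" "(c', d) \<in> Cg S ?N G" by blast
  \<comment> \<open>The finite set of symbols occurring in the generators is itself a coordinate;
    reading \<open>(c', d)\<close> there contradicts the choice of \<open>d F\<close>.\<close>
  then obtain F where F: "finite F" "F \<subseteq> ops S" "G = e' ` F" by (meson finite_subset_image)
  have con: "Cg S M (e ` F) \<in> Con S M" by (rule Cg_Con[OF alg e[OF F(2)]])
  have "Cg S ?N G \<subseteq> pre ?N (\<lambda>x. x F) (Cg S M (e ` F))"
  proof (rule Cg_least[OF pre_Con[OF mem_algebra[OF N] proj_hom[OF B] con]])
    have "e ` F \<subseteq> Cg S M (e ` F)" by (rule Cg_ge)
    then show "G \<subseteq> pre ?N (\<lambda>x. x F) (Cg S M (e ` F))"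
      using F(2,3) e'_sub by (auto simp: e'_def e_def pre_def c'_def Nabla_def)
  qed
  then have "(c, d F) \<in> Cg S M (e ` F)" using G(3) by (auto simp: pre_def c'_def)
  with d(2) F show False by blast
qed

text \<open>A sequence is coded by the list of its values up to an index from which it is constant;
  the length of the list gives the index back.\<close>

lemma member_ev_const:
  fixes M :: "('f, 'a) algebra"
  assumes M: "member S E TYPE('u) M" and \<sigma>: "\<sigma> \<in> Con S M"
  shows "member S E TYPE('u) (sub_pow M (ev_const \<sigma>))"
proof -
  obtain g :: "_ \<Rightarrow> 'u" where g: "inj_on g (carrier M)" using M by (auto simp: embeds_def)
  obtain L :: "'u list \<Rightarrow> 'u" where L: "inj L" using list_coding by blast
  define k where "k x = (SOME n. \<forall>i\<ge>n. x i = x n)" for x :: "nat \<Rightarrow> 'a"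
  have k: "x i = x (k x)" if "x \<in> ev_const \<sigma>" "i \<ge> k x" for x i
  proof -
    have "\<exists>n. \<forall>i\<ge>n. x i = x n" using that(1) by (auto simp: ev_const_def)
    from someI_ex[OF this] have "\<forall>i\<ge>k x. x i = x (k x)" unfolding k_def .
    then show ?thesis using that(2) by blast
  qed
  have "inj_on (\<lambda>x. L (map (g \<circ> x) [0..<Suc (k x)])) (ev_const \<sigma>)"
  proof (rule inj_onI)
    fix x y
    assume xy: "x \<in> ev_const \<sigma>" "y \<in> ev_const \<sigma>"
      "L (map (g \<circ> x) [0..<Suc (k x)]) = L (map (g \<circ> y) [0..<Suc (k y)])"
    then have eq: "map (g \<circ> x) [0..<Suc (k x)] = map (g \<circ> y) [0..<Suc (k y)]" by (simp only: inj_eq[OF L])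
    from arg_cong[where f = length, OF this] have ky: "k y = k x" by simp
    have le: "x i = y i" if "i \<le> k x" for i
    proof -
      have "g (x i) = g (y i)" using arg_cong[where f = "\<lambda>l. l ! i", OF eq] that
        by (simp add: ky nth_append del: upt_Suc)
      then show ?thesis using g ev_const_closed[OF \<sigma> xy(1)] ev_const_closed[OF \<sigma> xy(2)]
        by (auto simp: inj_on_def)
    qed
    show "x = y"
    proof
      fix i
      show "x i = y i"
      proof (cases "i \<le> k x")
        case False
        then have "x i = x (k x)" "y i = y (k x)"
          using k[OF xy(1), of i] k[OF xy(2), of i] unfolding ky by simp_all
        then show ?thesis using le[of "k x"] by simp
      qed (rule le)
    qed
  qed
  then have "embeds TYPE('u) (ev_const \<sigma>)" unfolding embeds_def by blast
  then show ?thesis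
    using variety_sub_pow[OF _ is_sub_pow_ev_const[OF mem_algebra[OF M] \<sigma>]] M by simp
qed

section \<open>Changing one coordinate of an eventually constant sequence\<close>

context
  fixes M :: "('f, 'a) algebra" and \<sigma> :: "'a rel" and \<Theta> :: "(nat \<Rightarrow> 'a) rel" and j :: nat
  assumes M: "member S E TYPE('u) M" and \<sigma>: "\<sigma> \<in> Con S M"
    and \<Theta>: "\<Theta> \<in> Con S (sub_pow M (ev_const \<sigma>))"
begin

text \<open>Agreement off \<open>j\<close> (\<open>\<eta>\<close>) and agreement at \<open>j\<close>
  (\<open>\<zeta>\<close>) intersect in equality, and the four spikes form a rectangle for them. The
  shifting lemma moves a pair of \<open>\<Theta>\<close> to the opposite side, for either pair of
  sides.\<close>

lemma ev_const_shift:
  assumes "(p, x) \<in> \<sigma>" "(p, y) \<in> \<sigma>" "(p', x) \<in> \<sigma>"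
  shows "(spike j p x, spike j p y) \<in> \<Theta> \<Longrightarrow> (spike j p' x, spike j p' y) \<in> \<Theta>"
    and "(spike j p x, spike j p' x) \<in> \<Theta> \<Longrightarrow> (spike j p y, spike j p' y) \<in> \<Theta>"
proof -
  let ?Q = "sub_pow M (ev_const \<sigma>)"
  note algQ = mem_algebra[OF member_ev_const[OF M \<sigma>]]
  note B = is_sub_pow_ev_const[OF mem_algebra[OF M] \<sigma>]
  note \<Delta> = Delta_Con[OF mem_algebra[OF M]]
  define \<eta> where "\<eta> = (\<Inter>i\<in>- {j}. pre ?Q (\<lambda>z. z i) (Delta M))"
  define \<zeta> where "\<zeta> = pre ?Q (\<lambda>z. z j) (Delta M)"
  have "Suc j \<in> - {j}" by simp
  then have ne: "- {j} \<noteq> {}" by blast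
  have \<eta>: "\<eta> \<in> Con S ?Q" unfolding \<eta>_def
    using ne by (intro Inter_Con) (auto intro!: pre_Con[OF algQ proj_hom[OF B] \<Delta>])
  have \<zeta>: "\<zeta> \<in> Con S ?Q" unfolding \<zeta>_def by (rule pre_Con[OF algQ proj_hom[OF B] \<Delta>])
  have \<eta>_iff: "(z, w) \<in> \<eta> \<longleftrightarrow> z \<in> ev_const \<sigma> \<and> w \<in> ev_const \<sigma> \<and> (\<forall>i. i \<noteq> j \<longrightarrow> z i = w i)" for z w
    using ne ev_const_closed[OF \<sigma>] by (auto simp: \<eta>_def pre_def Delta_iff)
  have \<zeta>_iff: "(z, w) \<in> \<zeta> \<longleftrightarrow> z \<in> ev_const \<sigma> \<and> w \<in> ev_const \<sigma> \<and> z j = w j" for z w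
    using ev_const_closed[OF \<sigma>] by (auto simp: \<zeta>_def pre_def Delta_iff)
  have "z = w" if "(z, w) \<in> \<eta> \<inter> \<zeta>" for z w
  proof
    fix i show "z i = w i" using that by (cases "i = j") (auto simp: \<eta>_iff \<zeta>_iff)
  qed
  moreover have "z \<in> ev_const \<sigma>" if "(z, w) \<in> \<eta> \<inter> \<zeta>" for z w
    using that by (simp add: \<eta>_iff)
  ultimately have le: "\<eta> \<inter> \<zeta> \<subseteq> \<Theta>"
    using Con_refl[OF \<Theta>] by (intro subrelI) (metis carrier_sub_pow)
  have p'y: "(p', y) \<in> \<sigma>" using assms Con_sym[OF \<sigma>] Con_trans[OF \<sigma>] by blast
  have in_Q: "spike j p x \<in> ev_const \<sigma>" "spike j p y \<in> ev_const \<sigma>" "spike j p' x \<in> ev_const \<sigma>" "spike j p' y \<in> ev_const \<sigma>"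
    using spike_ev_const[OF \<sigma>] assms p'y by blast+
  then have rect: "(spike j p x, spike j p y) \<in> \<eta>" "(spike j p' x, spike j p' y) \<in> \<eta>"
    "(spike j p x, spike j p' x) \<in> \<zeta>" "(spike j p y, spike j p' y) \<in> \<zeta>"
    by (auto simp: \<eta>_iff \<zeta>_iff)
  note Q = member_ev_const[OF M \<sigma>]
  show "(spike j p' x, spike j p' y) \<in> \<Theta>" if "(spike j p x, spike j p y) \<in> \<Theta>"
    by (rule shifting[OF Q \<eta> \<zeta> \<Theta> le rect that])
  show "(spike j p y, spike j p' y) \<in> \<Theta>" if "(spike j p x, spike j p' x) \<in> \<Theta>"
    by (rule shifting[OF Q \<zeta> \<eta> \<Theta> _ rect(3,4,1,2) that]) (use le in blast)
qed

text \<open>The pairs \<open>(x, y)\<close> of \<open>\<sigma>\<close> for which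
  \<open>\<Theta>\<close> relates the constant \<open>x\<close> to its modification \<open>y\<close>
  at \<open>j\<close> form a congruence \<open>\<mu>\<close> of \<open>M\<close>. It satisfies the
  term condition for \<open>\<sigma>\<close> and \<open>\<alpha>\<close>, so it contains
  \<open>[\<sigma>, \<alpha>]\<close>.\<close>

lemma ev_const_commutator:
  assumes \<alpha>: "\<alpha> \<in> Con S M" and const: "\<And>x y. (x, y) \<in> \<alpha> \<Longrightarrow> ((\<lambda>_. x), (\<lambda>_. y)) \<in> \<Theta>"
    and xy: "(x, y) \<in> commutator S M \<sigma> \<alpha>"
  shows "((\<lambda>_. x), spike j x y) \<in> \<Theta>"
proof -
  let ?Q = "sub_pow M (ev_const \<sigma>)"
  define \<mu> where "\<mu> = {(x, y) \<in> \<sigma>. (spike j x x, spike j x y) \<in> \<Theta>}"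
  have \<mu>_iff: "(x, y) \<in> \<mu> \<longleftrightarrow> (x, y) \<in> \<sigma> \<and> (spike j x x, spike j x y) \<in> \<Theta>" for x y
    by (auto simp: \<mu>_def)
  note alg = mem_algebra[OF M]
  note refl\<sigma> = Con_refl[OF \<sigma>] and sym\<sigma> = Con_sym[OF \<sigma>] and trans\<sigma> = Con_trans[OF \<sigma>]
  have \<mu>_Con: "\<mu> \<in> Con S M"
  proof (rule ConI)
    show "\<mu> \<subseteq> Nabla M" using Con_Nabla[OF \<sigma>] by (auto simp: \<mu>_def)
    show "(x, x) \<in> \<mu>" if "x \<in> carrier M" for x
      using that spike_ev_const[OF \<sigma> refl\<sigma>[OF that]] refl\<sigma> Con_refl[OF \<Theta>] unfolding \<mu>_iff by simp
    show "(y, x) \<in> \<mu>" if "(x, y) \<in> \<mu>" for x y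
    proof -
      have *: "(x, x) \<in> \<sigma>" "(x, y) \<in> \<sigma>" "(y, x) \<in> \<sigma>"
        using that sym\<sigma> trans\<sigma> unfolding \<mu>_iff by blast+
      have "(spike j y x, spike j y y) \<in> \<Theta>" using ev_const_shift(1)[OF *] that unfolding \<mu>_iff by blast
      then show ?thesis using Con_sym[OF \<Theta>] * unfolding \<mu>_iff by blast
    qed
    show "(x, z) \<in> \<mu>" if "(x, y) \<in> \<mu>" "(y, z) \<in> \<mu>" for x y z
    proof -
      have *: "(y, y) \<in> \<sigma>" "(y, z) \<in> \<sigma>" "(x, y) \<in> \<sigma>" "(x, z) \<in> \<sigma>"
        using that sym\<sigma> trans\<sigma> unfolding \<mu>_iff by blast+
      have "(spike j x y, spike j x z) \<in> \<Theta>" using ev_const_shift(1)[OF *(1-3)] that unfolding \<mu>_iff by blast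
      then show ?thesis using Con_trans[OF \<Theta>] that * unfolding \<mu>_iff by blast
    qed
    fix f xs ys assume f: "f \<in> ops S" "length xs = arity S f" and l: "list_all2 (\<lambda>x y. (x, y) \<in> \<mu>) xs ys"
    have len: "length ys = length xs" using l by (simp add: list_all2_lengthD)
    have "(opn M f xs, opn M f ys) \<in> \<sigma>"
      using f l by (intro Con_op[OF \<sigma>]) (auto simp: list_all2_conv_all_nth \<mu>_iff)
    moreover have "(opn ?Q f (map (\<lambda>x. spike j x x) xs), opn ?Q f (map (\<lambda>(x, y). spike j x y) (zip xs ys))) \<in> \<Theta>"
      using f l len by (intro Con_op[OF \<Theta>]) (auto simp: list_all2_conv_all_nth \<mu>_iff)
    moreover have "opn ?Q f (map (\<lambda>x. spike j x x) xs) = spike j (opn M f xs) (opn M f xs)"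
      by (auto simp: fun_eq_iff comp_def)
    moreover have "opn ?Q f (map (\<lambda>(x, y). spike j x y) (zip xs ys)) = spike j (opn M f xs) (opn M f ys)"
    proof
      fix i
      have "map (\<lambda>p. (case p of (x, y) \<Rightarrow> spike j x y) i) (zip xs ys) = (if i = j then ys else xs)"
        using len by (auto intro!: nth_equalityI)
      then show "opn ?Q f (map (\<lambda>(x, y). spike j x y) (zip xs ys)) i = spike j (opn M f xs) (opn M f ys) i"
        by (simp add: comp_def)
    qed
    ultimately show "(opn M f xs, opn M f ys) \<in> \<mu>" by (simp add: \<mu>_iff)
  qed
  have "centralizes S M \<sigma> \<alpha> \<mu>"
  proof -
    have step: "(entry M (\<not> r) False T, entry M (\<not> r) True T) \<in> \<mu>"
      if T: "wf_trm S (Inl ` \<sigma> \<union> Inr ` \<alpha>) T" and row: "(entry M r False T, entry M r True T) \<in> \<mu>" for T r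
    proof -
      let ?p = "entry M r False T" and ?q = "entry M r True T"
        and ?u = "entry M (\<not> r) False T" and ?v = "entry M (\<not> r) True T"
      have rel: "(?p, ?q) \<in> \<sigma>" using row by (simp add: \<mu>_iff)
      have col: "(?p, ?u) \<in> \<sigma>" "(?q, ?v) \<in> \<sigma>"
        using entry_left[OF \<sigma> Con_Nabla[OF \<alpha>] T, of False] entry_left[OF \<sigma> Con_Nabla[OF \<alpha>] T, of True] sym\<sigma>
        by (cases r; simp)+
      have all: "(s, t) \<in> \<sigma>" if "s \<in> {?p, ?q, ?u, ?v}" "t \<in> {?p, ?q, ?u, ?v}" for s t
      proof -
        have "(?p, s) \<in> \<sigma>" if "s \<in> {?p, ?q, ?u, ?v}" for s
          using that rel col trans\<sigma>[OF rel col(2)] refl\<sigma> Con_sub[OF \<sigma> rel] by auto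
        from this[OF that(1)] this[OF that(2)] show ?thesis using sym\<sigma> trans\<sigma> by blast
      qed
      \<comment> \<open>Off \<open>j\<close> the valuation always reads row \<open>r\<close>; at
        \<open>j\<close> it reads the opposite row if \<open>k\<close> holds. Only variables from
        \<open>\<sigma>\<close> become spikes; those from \<open>\<alpha>\<close> stay constant, so
        that \<open>const\<close> can change the column \<open>c\<close>.\<close>
      define w :: "bool \<Rightarrow> bool \<Rightarrow> 'a \<times> 'a + 'a \<times> 'a \<Rightarrow> nat \<Rightarrow> 'a" where "w k c = (case_sum (\<lambda>p. spike j (sel r p) (if k then sel (\<not> r) p else sel r p)) (\<lambda>q _. sel c q))"
        for k c
      have ev: "eval ?Q (w k c) T = spike j (entry M r c T) (if k then entry M (\<not> r) c T else entry M r c T)" for k c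
      proof
        fix i
        have "(\<lambda>x. w k c x i) = case_sum (sel (if i = j \<and> k then \<not> r else r)) (sel c)"
          by (rule ext) (auto simp: w_def split: sum.split)
        then have "eval ?Q (w k c) T i = entry M (if i = j \<and> k then \<not> r else r) c T"
          by (simp only: eval_sub_pow entry_def)
        then show "eval ?Q (w k c) T i = spike j (entry M r c T) (if k then entry M (\<not> r) c T else entry M r c T) i"
          by simp
      qed
      have rows: "(spike j ?p (if k then ?u else ?p), spike j ?q (if k then ?v else ?q)) \<in> \<Theta>" for k
      proof -
        have "(eval ?Q (w k False) T, eval ?Q (w k True) T) \<in> \<Theta>"
        proof (rule Con_eval[OF \<Theta> T])
          fix z assume "z \<in> Inl ` \<sigma> \<union> Inr ` \<alpha>"
          then consider s where "z = Inl s" "s \<in> \<sigma>" | c where "z = Inr c" "c \<in> \<alpha>" by blast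
          then show "(w k False z, w k True z) \<in> \<Theta>"
          proof cases
            case (1 s)
            have "(sel r s, if k then sel (\<not> r) s else sel r s) \<in> \<sigma>"
              using 1(2) sym\<sigma> refl\<sigma> Con_sub[OF \<sigma>, of "fst s" "snd s"] by (auto simp: sel_def)
            then show ?thesis using 1 spike_ev_const[OF \<sigma>] Con_refl[OF \<Theta>] by (simp add: w_def)
          next
            case (2 c)
            then show ?thesis using const[of "fst c" "snd c"] by (simp add: w_def)
          qed
        qed
        then show ?thesis by (simp only: ev)
      qed
      \<comment> \<open>The base changes from \<open>?p\<close> to \<open>?q\<close> under a spike
        \<open>?q\<close>; shifting carries this over to a spike \<open>?v\<close>. Combined with
        \<open>rows[of True]\<close> it exchanges \<open>?u\<close> for \<open>?v\<close> over the
        base \<open>?p\<close>, and the last shift moves the base to \<open>?u\<close>.\<close>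
      have "(spike j ?p ?q, spike j ?q ?q) \<in> \<Theta>"
      proof -
        have "(spike j ?p ?p, spike j ?q ?q) \<in> \<Theta>" using rows[of False] by simp
        moreover have "(spike j ?p ?q, spike j ?p ?p) \<in> \<Theta>" using row Con_sym[OF \<Theta>] unfolding \<mu>_iff by blast
        ultimately show ?thesis using Con_trans[OF \<Theta>] by blast
      qed
      from ev_const_shift(2)[OF _ _ _ this, of ?v] have "(spike j ?p ?v, spike j ?q ?v) \<in> \<Theta>" using all by simp
      moreover have "(spike j ?p ?u, spike j ?q ?v) \<in> \<Theta>" using rows[of True] by simp
      ultimately have "(spike j ?p ?u, spike j ?p ?v) \<in> \<Theta>" using Con_sym[OF \<Theta>] Con_trans[OF \<Theta>] by blast
      from ev_const_shift(1)[OF _ _ _ this, of ?u] have "(spike j ?u ?u, spike j ?u ?v) \<in> \<Theta>" using all by simp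
      then show ?thesis using all by (simp add: \<mu>_iff)
    qed
    show ?thesis
      unfolding centralizes_iff using step[of _ False] step[of _ True] by auto
  qed
  then have "(x, y) \<in> \<mu>" using commutator_least[OF \<mu>_Con] xy by blast
  moreover have "spike j x x = (\<lambda>_. x)" by auto
  ultimately show ?thesis by (simp add: \<mu>_iff)
qed

end

text \<open>The hypothesis on \<open>\<K>\<close> is applied to the algebra of eventually constant sequences.  There
  the commutator of the congruences generated by constant pairs from \<open>\<alpha>\<close> and from \<open>\<beta>\<close> is
  finitely generated, hence generated by pairs which do not distinguish two late coordinates
  \<open>n\<close> and \<open>Suc n\<close>; but it also contains the pairs of \<open>[\<sigma>, \<alpha>] \<inter> [\<sigma>, \<beta>]\<close> put at \<open>n\<close> alone.\<close>

lemma commutator_Int_le: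
  fixes M :: "('f, 'a) algebra"
  assumes M: "member S E TYPE('u) M" and K: "\<alpha> \<in> KCon S M" "\<beta> \<in> KCon S M"
    and top: "Cg S M (\<alpha> \<union> \<beta>) = Nabla M" and \<sigma>: "\<sigma> \<in> Con S M"
  shows "commutator S M \<sigma> \<alpha> \<inter> commutator S M \<sigma> \<beta> \<subseteq> commutator S M (\<alpha> \<inter> \<beta>) \<sigma>"
proof -
  note alg = mem_algebra[OF M]
  let ?Q = "sub_pow M (ev_const \<sigma>)"
  note Q = member_ev_const[OF M \<sigma>]
  note algQ = mem_algebra[OF Q]
  note B = is_sub_pow_ev_const[OF alg \<sigma>]
  let ?c = "\<lambda>x (_ :: nat). x"
  have c_hom: "alg_hom S M ?Q ?c" by (rule const_hom[OF const_ev_const[OF \<sigma>]])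
  define lift where "lift X = (\<lambda>(x, y). (?c x, ?c y)) ` X" for X :: "('a \<times> 'a) set"
  have lift: "Cg S ?Q (lift X) \<in> KCon S ?Q" "\<And>x y. (x, y) \<in> Cg S M X \<Longrightarrow> (?c x, ?c y) \<in> Cg S ?Q (lift X)"
    "\<And>z w i. (z, w) \<in> Cg S ?Q (lift X) \<Longrightarrow> (z i, w i) \<in> Cg S M X"
    if X: "finite X" "X \<subseteq> Nabla M" for X
  proof -
    have sub: "lift X \<subseteq> Nabla ?Q"
      using X(2) const_ev_const[OF \<sigma>] by (auto simp: lift_def Nabla_def)
    then show "Cg S ?Q (lift X) \<in> KCon S ?Q" using X(1) by (auto simp: KCon_def lift_def)
    note con = Cg_Con[OF algQ sub]
    have "Cg S M X \<subseteq> pre M ?c (Cg S ?Q (lift X))"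
    proof (rule Cg_least[OF pre_Con[OF alg c_hom con]])
      show "X \<subseteq> pre M ?c (Cg S ?Q (lift X))"
        using X(2) Cg_ge[of "lift X" S ?Q] by (auto simp: pre_def lift_def Nabla_def)
    qed
    then show "(?c x, ?c y) \<in> Cg S ?Q (lift X)" if "(x, y) \<in> Cg S M X" for x y
      using that by (auto simp: pre_def)
    have "Cg S ?Q (lift X) \<subseteq> pre ?Q (\<lambda>z. z i) (Cg S M X)" for i
    proof (rule Cg_least[OF pre_Con[OF algQ proj_hom[OF B] Cg_Con[OF alg X(2)]]])
      show "lift X \<subseteq> pre ?Q (\<lambda>z. z i) (Cg S M X)"
        using X(2) Cg_ge[of X S M] const_ev_const[OF \<sigma>] by (auto simp: pre_def lift_def Nabla_def)
    qed
    then show "(z i, w i) \<in> Cg S M X" if "(z, w) \<in> Cg S ?Q (lift X)" for z w i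
      using that by (auto simp: pre_def)
  qed
  obtain X where X: "finite X" "X \<subseteq> Nabla M" "\<alpha> = Cg S M X" using K(1) by (auto simp: KCon_def)
  obtain Y where Y: "finite Y" "Y \<subseteq> Nabla M" "\<beta> = Cg S M Y" using K(2) by (auto simp: KCon_def)
  have con: "\<alpha> \<in> Con S M" "\<beta> \<in> Con S M" using X Y by (simp_all add: Cg_Con[OF alg])
  define \<alpha>' where "\<alpha>' = Cg S ?Q (lift X)"
  define \<beta>' where "\<beta>' = Cg S ?Q (lift Y)"
  have \<alpha>': "\<alpha>' \<in> KCon S ?Q" "\<And>x y. (x, y) \<in> \<alpha> \<Longrightarrow> (?c x, ?c y) \<in> \<alpha>'" "\<And>z w i. (z, w) \<in> \<alpha>' \<Longrightarrow> (z i, w i) \<in> \<alpha>"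
    using lift[OF X(1,2)] X(3) by (simp_all add: \<alpha>'_def)
  have \<beta>': "\<beta>' \<in> KCon S ?Q" "\<And>x y. (x, y) \<in> \<beta> \<Longrightarrow> (?c x, ?c y) \<in> \<beta>'" "\<And>z w i. (z, w) \<in> \<beta>' \<Longrightarrow> (z i, w i) \<in> \<beta>"
    using lift[OF Y(1,2)] Y(3) by (simp_all add: \<beta>'_def)
  have K_Con: "\<theta> \<in> Con S ?Q" if "\<theta> \<in> KCon S ?Q" for \<theta> using that Cg_Con[OF algQ] by (auto simp: KCon_def)
  note con' = K_Con[OF \<alpha>'(1)] K_Con[OF \<beta>'(1)]
  let ?J = "Cg S ?Q (\<alpha>' \<union> \<beta>')"
  have J: "?J \<in> Con S ?Q" using con' Con_Nabla by (intro Cg_Con[OF algQ]) blast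
  have "Cg S M (\<alpha> \<union> \<beta>) \<subseteq> pre M ?c ?J"
    using \<alpha>'(2) \<beta>'(2) Cg_ge[of "\<alpha>' \<union> \<beta>'" S ?Q] Con_sub[OF con(1)] Con_sub[OF con(2)]
    by (intro Cg_least pre_Con[OF alg c_hom J]) (auto simp: pre_def)
  then have diag: "(?c x, ?c y) \<in> ?J" if "x \<in> carrier M" "y \<in> carrier M" for x y
    using that by (auto simp: top Nabla_def pre_def)
  obtain b where b: "b \<in> carrier M" using alg by (auto simp: is_algebra_def)
  \<comment> \<open>The hypothesis \<open>top\<close> relates only constant sequences to each other;
    semi-degeneracy extends this to all sequences.\<close>
  have top': "?J = Nabla ?Q"
  proof (rule Con_eq_Nabla[OF Q J])
    show "?c b \<in> carrier ?Q" using const_ev_const[OF \<sigma> b] by simp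
    fix f assume "f \<in> ops S"
    then have "opn M f (replicate (arity S f) b) \<in> carrier M" using b by (auto intro!: algebra_op[OF alg])
    then show "(opn ?Q f (replicate (arity S f) (?c b)), ?c b) \<in> ?J" using diag b by simp
  qed
  let ?\<kappa> = "\<alpha>' \<inter> \<beta>'" and ?\<epsilon> = "commutator S ?Q \<alpha>' \<beta>'"
  have \<kappa>: "?\<kappa> \<in> Con S ?Q" by (rule Int_Con[OF con'])
  have \<epsilon>: "?\<epsilon> \<in> Con S ?Q" by (rule commutator_Con[OF con'(1) Con_Nabla[OF con'(2)]])
  \<comment> \<open>Comaximality gives \<open>?\<kappa> = [\<nabla>, ?\<kappa>] \<subseteq>
    [\<alpha>', \<beta>']\<close>, so the intersection is a commutator of compact congruences and
    therefore compact.\<close>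
  have "commutator S ?Q \<alpha>' ?\<kappa> \<subseteq> ?\<epsilon>" by (rule commutator_mono) auto
  moreover have "commutator S ?Q \<beta>' ?\<kappa> \<subseteq> ?\<epsilon>"
    unfolding commutator_commute[OF Q con'] by (rule commutator_mono) auto
  ultimately have "commutator S ?Q ?J ?\<kappa> \<subseteq> ?\<epsilon>" by (rule commutator_join_le[OF Q con' \<kappa> \<epsilon>])
  then have "?\<kappa> \<subseteq> ?\<epsilon>"
    unfolding top' commutator_commute[OF Q Nabla_Con[OF algQ] \<kappa>] commutator_Nabla[OF Q \<kappa>] .
  then have eq: "?\<kappa> = ?\<epsilon>" using commutator_le_Int[OF con'] by blast
  have "?\<kappa> \<in> KCon S ?Q" unfolding eq by (rule commutator_KCon[OF Q \<alpha>'(1) \<beta>'(1)])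
  then obtain Z where Z: "finite Z" "Z \<subseteq> Nabla ?Q" "?\<kappa> = Cg S ?Q Z" by (auto simp: KCon_def)
  have "\<exists>n. \<forall>x\<in>fst ` Z \<union> snd ` Z. \<forall>i\<ge>n. x i = x n"
    using Z(1,2) by (intro ev_const_all) (auto simp: Nabla_def)
  then obtain n where n: "\<forall>x\<in>fst ` Z \<union> snd ` Z. \<forall>i\<ge>n. x i = x n" by blast
  let ?\<gamma> = "\<alpha> \<inter> \<beta>"
  let ?\<delta> = "commutator S M ?\<gamma> \<sigma>" and ?P = "sub_pow M (pairs \<sigma>)"
  have \<gamma>: "?\<gamma> \<in> Con S M" by (rule Int_Con[OF con])
  have \<delta>: "?\<delta> \<in> Con S M" by (rule commutator_Con[OF \<gamma> Con_Nabla[OF \<sigma>]])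
  let ?\<Omega> = "Syn S ?P {z. (z False, z True) \<in> ?\<delta>}"
  have \<Omega>: "?\<Omega> \<in> Con S ?P" by (rule Syn_Con[OF mem_algebra[OF mem_pairs[OF M \<sigma>]]])
  have \<gamma>\<Omega>: "((\<lambda>_. x), (\<lambda>_. y)) \<in> ?\<Omega>" if "(x, y) \<in> ?\<gamma>" for x y
    using commutator_le_iff_ann[OF M \<gamma> \<sigma> \<delta>] that by (auto simp: ann_def pre_def)
  \<comment> \<open>A window on the coordinates \<open>n\<close> and \<open>Suc n\<close>: the
    generators of \<open>?\<kappa>\<close> become constant pairs, whereas a spike at
    \<open>n\<close> remains visible.\<close>
  define \<pi> where "\<pi> z = (\<lambda>i. z (if i then Suc n else n))" for z :: "nat \<Rightarrow> 'a"
  have \<pi>_hom: "alg_hom S ?Q ?P \<pi>"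
    unfolding \<pi>_def by (rule reindex_hom) (auto simp: ev_const_def pairs_def)
  have "?\<kappa> \<subseteq> pre ?Q \<pi> ?\<Omega>"
    unfolding Z(3)
  proof (rule Cg_least[OF pre_Con[OF algQ \<pi>_hom \<Omega>]], rule subrelI)
    fix z w assume zw: "(z, w) \<in> Z"
    then have in_Z: "z \<in> fst ` Z \<union> snd ` Z" "w \<in> fst ` Z \<union> snd ` Z" by force+
    have \<pi>_const: "\<pi> x = (\<lambda>_. x n)" if "x \<in> fst ` Z \<union> snd ` Z" for x
    proof -
      have "x (Suc n) = x n" by (rule bspec[OF n that, rule_format]) simp
      then show ?thesis by (auto simp: \<pi>_def)
    qed
    note \<pi>_const[OF in_Z(1)] \<pi>_const[OF in_Z(2)]
    moreover have "(z, w) \<in> ?\<kappa>" using zw Cg_ge[of Z S ?Q] Z(3) by blast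
    then have "(z n, w n) \<in> ?\<gamma>" using \<alpha>'(3)[of z w n] \<beta>'(3)[of z w n] by simp
    ultimately show "(z, w) \<in> pre ?Q \<pi> ?\<Omega>"
      using \<gamma>\<Omega>[of "z n" "w n"] zw Z(2) unfolding pre_def Nabla_def by auto
  qed
  moreover have "(?c x, spike n x y) \<in> ?\<kappa>"
    if "(x, y) \<in> commutator S M \<sigma> \<alpha> \<inter> commutator S M \<sigma> \<beta>" for x y
    using ev_const_commutator[OF M \<sigma> con'(1) con(1) \<alpha>'(2)] ev_const_commutator[OF M \<sigma> con'(2) con(2) \<beta>'(2)] that
    by blast
  ultimately have *: "(\<pi> (?c x), \<pi> (spike n x y)) \<in> ?\<Omega>"
    if "(x, y) \<in> commutator S M \<sigma> \<alpha> \<inter> commutator S M \<sigma> \<beta>" for x y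
    using that by (auto simp: pre_def)
  show ?thesis
  proof (rule subrelI)
    fix x y assume xy: "(x, y) \<in> commutator S M \<sigma> \<alpha> \<inter> commutator S M \<sigma> \<beta>"
    have "x \<in> carrier M" using xy commutator_le_Int[OF \<sigma> con(1)] Con_sub[OF \<sigma>] by blast
    then have "(x, x) \<in> ?\<delta>" by (rule Con_refl[OF \<delta>])
    \<comment> \<open>The window shows the spike entry \<open>y\<close> first, hence the reversed
      pair.\<close>
    with Syn_saturated[OF *[OF xy]] have "(y, x) \<in> ?\<delta>" by (simp add: \<pi>_def)
    then show "(x, y) \<in> ?\<delta>" by (rule Con_sym[OF \<delta>])
  qed
qed

lemma commutator_squares_le:
  assumes M: "member S E TYPE('u) M" and K: "\<alpha> \<in> KCon S M" "\<beta> \<in> KCon S M"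
    and top: "Cg S M (\<alpha> \<union> \<beta>) = Nabla M"
  shows "commutator S M \<alpha> \<alpha> \<inter> commutator S M \<beta> \<beta> \<subseteq> commutator S M (\<alpha> \<inter> \<beta>) (\<alpha> \<inter> \<beta>)"
proof -
  note alg = mem_algebra[OF M]
  have con: "\<alpha> \<in> Con S M" "\<beta> \<in> Con S M" using K Cg_Con[OF alg] by (auto simp: KCon_def)
  have \<gamma>: "\<alpha> \<inter> \<beta> \<in> Con S M" by (rule Int_Con[OF con])
  note le = commutator_Int_le[OF M K top]
  let ?\<gamma> = "\<alpha> \<inter> \<beta>"
  have xx: "\<alpha> \<inter> \<beta> \<subseteq> commutator S M \<beta> \<alpha>"
  proof -
    have \<epsilon>: "commutator S M \<beta> \<alpha> \<in> Con S M" by (rule commutator_Con[OF con(2) Con_Nabla[OF con(1)]])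
    have "commutator S M \<alpha> ?\<gamma> \<subseteq> commutator S M \<beta> \<alpha>" "commutator S M \<beta> ?\<gamma> \<subseteq> commutator S M \<beta> \<alpha>"
      using commutator_mono[of \<alpha> \<alpha> ?\<gamma> \<beta> S M] commutator_mono[of \<beta> \<beta> ?\<gamma> \<alpha> S M]
      unfolding commutator_commute[OF M con] by auto
    from commutator_join_le[OF M con \<gamma> \<epsilon> this]
    show ?thesis
      unfolding top commutator_commute[OF M Nabla_Con[OF alg] \<gamma>] commutator_Nabla[OF M \<gamma>] .
  qed
  have "commutator S M \<alpha> \<alpha> \<inter> commutator S M \<beta> \<beta> \<subseteq> commutator S M ?\<gamma> \<beta>"
    using le[OF con(2)] xx commutator_le_Int[OF con(1) con(1)] commutator_le_Int[OF con(2) con(2)] by blast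
  moreover have "commutator S M \<alpha> \<alpha> \<inter> commutator S M \<beta> \<beta> \<subseteq> commutator S M ?\<gamma> \<alpha>"
    using le[OF con(1)] xx commutator_le_Int[OF con(1) con(1)] commutator_le_Int[OF con(2) con(2)]
    unfolding commutator_commute[OF M con] by blast
  ultimately show ?thesis using le[OF \<gamma>] by blast
qed

end

section \<open>Prime congruences and radicals\<close>

text \<open>All that the rest of the argument takes from the variety, stated for the single algebra
  \<open>A\<close>; from here on no other member of the variety occurs.\<close>

locale comm_algebra =
  fixes S :: "'f signature" and A :: "('f, 'a) algebra"
  assumes alg: "is_algebra S A"
    and br_comm: "\<alpha> \<in> Con S A \<Longrightarrow> \<beta> \<in> Con S A \<Longrightarrow> commutator S A \<alpha> \<beta> = commutator S A \<beta> \<alpha>"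
    and br_le_iff: "\<alpha> \<in> Con S A \<Longrightarrow> \<beta> \<in> Con S A \<Longrightarrow> \<delta> \<in> Con S A \<Longrightarrow>
      commutator S A \<alpha> \<beta> \<subseteq> \<delta> \<longleftrightarrow> centralizes S A \<alpha> \<beta> \<delta>"
    and br_join_le: "\<alpha> \<in> Con S A \<Longrightarrow> \<alpha>' \<in> Con S A \<Longrightarrow> \<beta> \<in> Con S A \<Longrightarrow> \<delta> \<in> Con S A \<Longrightarrow>
      commutator S A \<alpha> \<beta> \<subseteq> \<delta> \<Longrightarrow> commutator S A \<alpha>' \<beta> \<subseteq> \<delta> \<Longrightarrow>
      commutator S A (Cg S A (\<alpha> \<union> \<alpha>')) \<beta> \<subseteq> \<delta>"
    and br_Nabla: "\<theta> \<in> Con S A \<Longrightarrow> commutator S A \<theta> (Nabla A) = \<theta>"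
    and br_K: "\<alpha> \<in> KCon S A \<Longrightarrow> \<beta> \<in> KCon S A \<Longrightarrow> commutator S A \<alpha> \<beta> \<in> KCon S A"
    and Nabla_K: "Nabla A \<in> KCon S A"
    and br_squares: "\<alpha> \<in> KCon S A \<Longrightarrow> \<beta> \<in> KCon S A \<Longrightarrow> Cg S A (\<alpha> \<union> \<beta>) = Nabla A \<Longrightarrow>
      commutator S A \<alpha> \<alpha> \<inter> commutator S A \<beta> \<beta> \<subseteq> commutator S A (\<alpha> \<inter> \<beta>) (\<alpha> \<inter> \<beta>)"
begin

abbreviation (input) J :: "'a rel \<Rightarrow> 'a rel \<Rightarrow> 'a rel" where "J \<alpha> \<beta> \<equiv> Cg S A (\<alpha> \<union> \<beta>)"
abbreviation (input) br :: "'a rel \<Rightarrow> 'a rel \<Rightarrow> 'a rel" where "br \<equiv> commutator S A"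
abbreviation (input) rad :: "'a rel \<Rightarrow> 'a rel" where "rad \<equiv> radical S A"

lemma J_Con: "\<alpha> \<in> Con S A \<Longrightarrow> \<beta> \<in> Con S A \<Longrightarrow> J \<alpha> \<beta> \<in> Con S A"
  using Con_Nabla[of \<alpha> S A] Con_Nabla[of \<beta> S A] by (intro Cg_Con[OF alg]) auto

lemma J_ge: "\<alpha> \<subseteq> J \<alpha> \<beta>" "\<beta> \<subseteq> J \<alpha> \<beta>"
  using Cg_ge[of "\<alpha> \<union> \<beta>" S A] by auto

lemma J_le: "\<theta> \<in> Con S A \<Longrightarrow> \<alpha> \<subseteq> \<theta> \<Longrightarrow> \<beta> \<subseteq> \<theta> \<Longrightarrow> J \<alpha> \<beta> \<subseteq> \<theta>"
  by (intro Cg_least) auto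

lemma J_le_iff: "\<theta> \<in> Con S A \<Longrightarrow> J \<alpha> \<beta> \<subseteq> \<theta> \<longleftrightarrow> \<alpha> \<subseteq> \<theta> \<and> \<beta> \<subseteq> \<theta>"
  using J_le[of \<theta> \<alpha> \<beta>] J_ge(1)[of \<alpha> \<beta>] J_ge(2)[of \<beta> \<alpha>] by blast

lemma J_mono: "\<alpha> \<subseteq> \<alpha>' \<Longrightarrow> \<beta> \<subseteq> \<beta>' \<Longrightarrow> J \<alpha> \<beta> \<subseteq> J \<alpha>' \<beta>'"
  by (intro Cg_mono) auto

lemma J_Nabla: "\<alpha> \<in> Con S A \<Longrightarrow> J \<alpha> (Nabla A) = Nabla A"
  using J_ge[of "Nabla A" \<alpha>] J_le[OF Nabla_Con[OF alg], of \<alpha> "Nabla A"] Con_Nabla[of \<alpha> S A]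
  by (auto simp: Un_commute)

lemma K_Con: "\<alpha> \<in> KCon S A \<Longrightarrow> \<alpha> \<in> Con S A"
  using Cg_Con[OF alg] by (auto simp: KCon_def)

lemma J_K:
  assumes "\<alpha> \<in> KCon S A" "\<beta> \<in> KCon S A"
  shows "J \<alpha> \<beta> \<in> KCon S A"
proof -
  obtain X Y where X: "finite X" "X \<subseteq> Nabla A" "\<alpha> = Cg S A X"
    and Y: "finite Y" "Y \<subseteq> Nabla A" "\<beta> = Cg S A Y" using assms by (auto simp: KCon_def)
  have XY: "X \<union> Y \<subseteq> Nabla A" using X Y by blast
  have "J \<alpha> \<beta> = Cg S A (X \<union> Y)"
  proof
    show "J \<alpha> \<beta> \<subseteq> Cg S A (X \<union> Y)"
      unfolding X(3) Y(3) by (intro J_le Cg_Con[OF alg XY] Cg_mono) auto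
    show "Cg S A (X \<union> Y) \<subseteq> J \<alpha> \<beta>"
      using Cg_ge[of X S A] Cg_ge[of Y S A] unfolding X(3) Y(3) by (intro Cg_mono) auto
  qed
  then show ?thesis using X(1) Y(1) XY by (auto simp: KCon_def)
qed

lemma Delta_K: "Delta A \<in> KCon S A"
proof -
  have "Delta A = Cg S A {}"
    using Delta_least[OF Cg_Con[OF alg, of "{}"]] Cg_least[OF Delta_Con[OF alg], of "{}"] by auto
  then show ?thesis unfolding KCon_def by blast
qed

lemma br_Con: "\<alpha> \<in> Con S A \<Longrightarrow> \<beta> \<in> Con S A \<Longrightarrow> br \<alpha> \<beta> \<in> Con S A"
  by (rule commutator_Con[OF _ Con_Nabla])

lemma br_le: "\<alpha> \<in> Con S A \<Longrightarrow> \<beta> \<in> Con S A \<Longrightarrow> br \<alpha> \<beta> \<subseteq> \<alpha>" "\<alpha> \<in> Con S A \<Longrightarrow> \<beta> \<in> Con S A \<Longrightarrow> br \<alpha> \<beta> \<subseteq> \<beta>"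
  using commutator_le_Int[of \<alpha> S A \<beta>] by blast+

text \<open>By \<open>br_Nabla\<close>, \<open>x\<close> is the join of \<open>[x, \<alpha>]\<close>
  and \<open>[x, \<beta>]\<close>, so it can be tested on two comaximal congruences. This replaces
  distributivity of the congruence lattice.\<close>

lemma comax_le:
  assumes con: "x \<in> Con S A" "\<alpha> \<in> Con S A" "\<beta> \<in> Con S A" "\<delta> \<in> Con S A" and top: "J \<alpha> \<beta> = Nabla A"
    and le: "br x \<alpha> \<subseteq> \<delta>" "br x \<beta> \<subseteq> \<delta>"
  shows "x \<subseteq> \<delta>"
proof -
  have "br (J \<alpha> \<beta>) x \<subseteq> \<delta>"
    using le br_comm con by (intro br_join_le con) auto
  then show ?thesis using br_comm[OF Nabla_Con[OF alg] con(1)] br_Nabla[OF con(1)] top by simp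
qed

lemma comax_Int:
  assumes "\<alpha> \<in> Con S A" "\<beta> \<in> Con S A" "J \<alpha> \<beta> = Nabla A"
  shows "\<alpha> \<inter> \<beta> = br \<alpha> \<beta>"
proof
  show "\<alpha> \<inter> \<beta> \<subseteq> br \<alpha> \<beta>"
  proof (rule comax_le[OF Int_Con[OF assms(1,2)] assms(1,2) br_Con[OF assms(1,2)] assms(3)])
    show "br (\<alpha> \<inter> \<beta>) \<alpha> \<subseteq> br \<alpha> \<beta>"
      unfolding br_comm[OF assms(1,2)] by (rule commutator_mono) auto
    show "br (\<alpha> \<inter> \<beta>) \<beta> \<subseteq> br \<alpha> \<beta>" by (rule commutator_mono) auto
  qed
  show "br \<alpha> \<beta> \<subseteq> \<alpha> \<inter> \<beta>" by (rule commutator_le_Int[OF assms(1,2)])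
qed

lemma comax_mono:
  "J \<alpha> \<beta> = Nabla A \<Longrightarrow> \<alpha> \<subseteq> \<alpha>' \<Longrightarrow> \<beta> \<subseteq> \<beta>' \<Longrightarrow> \<alpha>' \<in> Con S A \<Longrightarrow> \<beta>' \<in> Con S A \<Longrightarrow> J \<alpha>' \<beta>' = Nabla A"
  using J_mono[of \<alpha> \<alpha>' \<beta> \<beta>'] Con_Nabla[OF J_Con[of \<alpha>' \<beta>']] by blast

text \<open>Exponent 0 gives the congruence itself, so that inductions start there and exponents add
  up; from exponent 1 on this is \<open>comm_pow\<close> with equal arguments.\<close>

definition sq :: "nat \<Rightarrow> 'a rel \<Rightarrow> 'a rel" where
  "sq n = (\<lambda>\<gamma>. commutator S A \<gamma> \<gamma>) ^^ n"

lemma sq_0 [simp]: "sq 0 \<alpha> = \<alpha>"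
  by (simp add: sq_def)

lemma sq_Suc: "sq (Suc n) \<alpha> = br (sq n \<alpha>) (sq n \<alpha>)"
  by (simp add: sq_def)

lemma sq_add: "sq (m + n) \<alpha> = sq m (sq n \<alpha>)"
  by (simp add: sq_def funpow_add)

lemma comm_pow_eq: "n \<ge> 1 \<Longrightarrow> comm_pow S A \<alpha> \<alpha> n = sq n \<alpha>"
  using sq_add[of "n - 1" 1 \<alpha>] by (simp add: comm_pow_def sq_def)

lemma sq_Con: "\<alpha> \<in> Con S A \<Longrightarrow> sq n \<alpha> \<in> Con S A"
  by (induction n) (auto simp: sq_Suc intro: br_Con)

lemma sq_K: "\<alpha> \<in> KCon S A \<Longrightarrow> sq n \<alpha> \<in> KCon S A"
  by (induction n) (auto simp: sq_Suc intro: br_K)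

lemma sq_antimono:
  assumes "\<alpha> \<in> Con S A"
  shows "m \<le> n \<Longrightarrow> sq n \<alpha> \<subseteq> sq m \<alpha>"
proof (induction rule: dec_induct)
  case (step n)
  then show ?case using br_le(1)[OF sq_Con sq_Con, OF assms assms, of n n] by (auto simp: sq_Suc)
qed simp

lemma comax_br:
  assumes con: "\<alpha> \<in> Con S A" "\<beta> \<in> Con S A" and top: "J \<alpha> \<beta> = Nabla A"
  shows "J (br \<alpha> \<alpha>) \<beta> = Nabla A"
proof -
  have J: "J (br \<alpha> \<alpha>) \<beta> \<in> Con S A" by (intro J_Con br_Con con)
  have "\<alpha> \<subseteq> J (br \<alpha> \<alpha>) \<beta>"
  proof (rule comax_le[OF con(1) con J top])
    show "br \<alpha> \<alpha> \<subseteq> J (br \<alpha> \<alpha>) \<beta>" by (rule J_ge)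
    show "br \<alpha> \<beta> \<subseteq> J (br \<alpha> \<alpha>) \<beta>" using br_le(2)[OF con] J_ge(2) by blast
  qed
  then have "J \<alpha> \<beta> \<subseteq> J (br \<alpha> \<alpha>) \<beta>" by (intro J_le[OF J] J_ge)
  then show ?thesis using top Con_Nabla[OF J] by simp
qed

text \<open>The two claims go through the induction together: comaximality of the
  \<open>n\<close>-th powers is the condition under which \<open>br_squares\<close> pushes their
  intersection one square further.\<close>

lemma comax_sq:
  assumes K: "\<alpha> \<in> KCon S A" "\<beta> \<in> KCon S A" and top: "J \<alpha> \<beta> = Nabla A"
  shows "J (sq n \<alpha>) (sq n \<beta>) = Nabla A \<and> sq n \<alpha> \<inter> sq n \<beta> \<subseteq> sq n (br \<alpha> \<beta>)"
proof (induction n)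
  case 0
  then show ?case using top comax_Int[OF K_Con K_Con] K by simp
next
  case (Suc n)
  have con: "sq n \<alpha> \<in> Con S A" "sq n \<beta> \<in> Con S A" using K by (auto intro: sq_Con K_Con)
  have "J (br (sq n \<alpha>) (sq n \<alpha>)) (sq n \<beta>) = Nabla A" by (rule comax_br[OF con]) (use Suc in simp)
  then have "J (sq n \<beta>) (br (sq n \<alpha>) (sq n \<alpha>)) = Nabla A" by (simp add: Un_commute)
  from comax_br[OF con(2) br_Con[OF con(1,1)] this]
  have "J (sq (Suc n) \<alpha>) (sq (Suc n) \<beta>) = Nabla A" by (simp add: sq_Suc Un_commute)
  moreover have "sq (Suc n) \<alpha> \<inter> sq (Suc n) \<beta> \<subseteq> br (sq n \<alpha> \<inter> sq n \<beta>) (sq n \<alpha> \<inter> sq n \<beta>)"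
    unfolding sq_Suc by (rule br_squares) (use K Suc in \<open>auto intro: sq_K\<close>)
  moreover have "\<dots> \<subseteq> sq (Suc n) (br \<alpha> \<beta>)"
    unfolding sq_Suc by (rule commutator_mono) (use Suc in auto)
  ultimately show ?case by blast
qed

section \<open>Prime congruences, radicals and compactness\<close>

lemma Spec_Con: "\<phi> \<in> Spec S A \<Longrightarrow> \<phi> \<in> Con S A"
  by (simp add: Spec_def)

lemma SpecD:
  "\<phi> \<in> Spec S A \<Longrightarrow> \<alpha> \<in> Con S A \<Longrightarrow> \<beta> \<in> Con S A \<Longrightarrow> br \<alpha> \<beta> \<subseteq> \<phi> \<Longrightarrow> \<alpha> \<subseteq> \<phi> \<or> \<beta> \<subseteq> \<phi>"
  by (simp add: Spec_def)

lemma Spec_sq: "\<phi> \<in> Spec S A \<Longrightarrow> \<alpha> \<in> Con S A \<Longrightarrow> sq n \<alpha> \<subseteq> \<phi> \<Longrightarrow> \<alpha> \<subseteq> \<phi>"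
proof (induction n)
  case (Suc n)
  then show ?case using SpecD[of \<phi> "sq n \<alpha>" "sq n \<alpha>"] sq_Con by (auto simp: sq_Suc)
qed simp

lemma K_le_chain:
  assumes "\<kappa> \<in> KCon S A" "\<kappa> \<subseteq> \<Union>X" "X \<noteq> {}" "subset.chain Y X" "Y \<subseteq> Con S A"
  shows "\<exists>\<theta>\<in>X. \<kappa> \<subseteq> \<theta>"
proof -
  obtain F where F: "finite F" "\<kappa> = Cg S A F" using assms(1) by (auto simp: KCon_def)
  then have "F \<subseteq> \<Union>X" using Cg_ge[of F S A] assms(2) by blast
  from finite_subset_Union_chain[OF F(1) this assms(3,4)] obtain \<theta> where "\<theta> \<in> X" "F \<subseteq> \<theta>" by blast
  moreover have "\<theta> \<in> Con S A" using \<open>\<theta> \<in> X\<close> assms(4,5) by (auto simp: subset.chain_def)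
  ultimately show ?thesis using F(2) Cg_least[of \<theta> S A F] by auto
qed

text \<open>By Zorn, take \<open>\<phi>\<close> maximal among the congruences above
  \<open>\<theta>\<close> that contain no member of \<open>\<S>\<close>; compactness of these
  members handles chains. If neither \<open>\<alpha>\<close> nor \<open>\<beta>\<close> is below
  \<open>\<phi>\<close>, their joins with \<open>\<phi>\<close> contain members of
  \<open>\<S>\<close>, but the commutator of the joins is below \<open>\<phi>\<close> when
  \<open>[\<alpha>, \<beta>]\<close> is.\<close>

lemma prime_exists:
  assumes sub: "\<S> \<subseteq> KCon S A" and ne: "\<S> \<noteq> {}"
    and mult: "\<And>s s'. s \<in> \<S> \<Longrightarrow> s' \<in> \<S> \<Longrightarrow> \<exists>s''\<in>\<S>. s'' \<subseteq> br s s'"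
    and \<theta>: "\<theta> \<in> Con S A" and avoid: "\<And>s. s \<in> \<S> \<Longrightarrow> \<not> s \<subseteq> \<theta>"
  shows "\<exists>\<phi>\<in>Spec S A. \<theta> \<subseteq> \<phi> \<and> (\<forall>s\<in>\<S>. \<not> s \<subseteq> \<phi>)"
proof -
  define P where "P = {\<phi> \<in> Con S A. \<theta> \<subseteq> \<phi> \<and> (\<forall>s\<in>\<S>. \<not> s \<subseteq> \<phi>)}"
  have "\<exists>\<phi>\<in>P. \<forall>\<psi>\<in>P. \<phi> \<subseteq> \<psi> \<longrightarrow> \<psi> = \<phi>"
  proof (rule subset_Zorn_nonempty)
    show "P \<noteq> {}" using \<theta> avoid by (auto simp: P_def)
    fix X assume X: "X \<noteq> {}" "subset.chain P X"
    then have XP: "X \<subseteq> P" by (simp add: subset.chain_def)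
    have "\<Union>X \<in> Con S A" using chain_Union_Con[OF X(1) _ X(2)] XP by (auto simp: P_def)
    moreover have "\<theta> \<subseteq> \<Union>X" using X(1) XP by (auto simp: P_def)
    moreover have "\<not> s \<subseteq> \<Union>X" if s: "s \<in> \<S>" for s
    proof
      assume "s \<subseteq> \<Union>X"
      from K_le_chain[OF _ this X] obtain \<psi> where "\<psi> \<in> X" "s \<subseteq> \<psi>"
        using s sub by (auto simp: P_def)
      with XP s show False by (auto simp: P_def)
    qed
    ultimately show "\<Union>X \<in> P" by (simp add: P_def)
  qed
  then obtain \<phi> where \<phi>: "\<phi> \<in> P" and max: "\<And>\<psi>. \<psi> \<in> P \<Longrightarrow> \<phi> \<subseteq> \<psi> \<Longrightarrow> \<psi> = \<phi>" by blast
  have con: "\<phi> \<in> Con S A" and "\<theta> \<subseteq> \<phi>" and av: "\<And>s. s \<in> \<S> \<Longrightarrow> \<not> s \<subseteq> \<phi>" using \<phi> by (auto simp: P_def)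
  have ex: "\<exists>s\<in>\<S>. s \<subseteq> J \<phi> \<alpha>" if \<alpha>: "\<alpha> \<in> Con S A" "\<not> \<alpha> \<subseteq> \<phi>" for \<alpha>
  proof (rule ccontr)
    assume "\<not> ?thesis"
    then have "J \<phi> \<alpha> \<in> P" using J_Con[OF con \<alpha>(1)] J_ge(1)[of \<phi> \<alpha>] \<open>\<theta> \<subseteq> \<phi>\<close> by (auto simp: P_def)
    from max[OF this J_ge(1)] have "J \<phi> \<alpha> = \<phi>" .
    with J_ge(2)[of \<alpha> \<phi>] \<alpha>(2) show False by simp
  qed
  have "\<phi> \<noteq> Nabla A"
  proof
    assume "\<phi> = Nabla A"
    moreover obtain s where "s \<in> \<S>" using ne by blast
    moreover have "s \<subseteq> Nabla A" using Con_Nabla[OF K_Con[of s]] \<open>s \<in> \<S>\<close> sub by blast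
    ultimately show False using av by blast
  qed
  moreover have "\<alpha> \<subseteq> \<phi> \<or> \<beta> \<subseteq> \<phi>" if \<alpha>\<beta>: "\<alpha> \<in> Con S A" "\<beta> \<in> Con S A" "br \<alpha> \<beta> \<subseteq> \<phi>" for \<alpha> \<beta>
  proof (rule ccontr)
    assume "\<not> ?thesis"
    then obtain s s' where s: "s \<in> \<S>" "s \<subseteq> J \<phi> \<alpha>" "s' \<in> \<S>" "s' \<subseteq> J \<phi> \<beta>" using ex \<alpha>\<beta> by meson
    from mult[OF s(1,3)] obtain t where t: "t \<in> \<S>" "t \<subseteq> br s s'" by blast
    have J: "J \<phi> \<alpha> \<in> Con S A" "J \<phi> \<beta> \<in> Con S A" using J_Con con \<alpha>\<beta> by auto
    have "br (J \<phi> \<beta>) \<alpha> \<subseteq> \<phi>"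
      by (rule br_join_le[OF con \<alpha>\<beta>(2,1) con br_le(1)[OF con \<alpha>\<beta>(1)]])
        (use br_comm[OF \<alpha>\<beta>(1,2)] \<alpha>\<beta>(3) in simp)
    then have "br (J \<phi> \<alpha>) (J \<phi> \<beta>) \<subseteq> \<phi>"
      using br_comm[OF J(2) \<alpha>\<beta>(1)] by (intro br_join_le[OF con \<alpha>\<beta>(1) J(2) con br_le(1)[OF con J(2)]]) simp
    moreover have "t \<subseteq> br (J \<phi> \<alpha>) (J \<phi> \<beta>)" using t(2) commutator_mono[OF s(2,4), of S A] by blast
    ultimately show False using av[OF t(1)] by blast
  qed
  ultimately have "\<phi> \<in> Spec S A" using con by (auto simp: Spec_def)
  with \<open>\<theta> \<subseteq> \<phi>\<close> av show ?thesis by blast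
qed

lemma rad_Con: "rad \<theta> \<in> Con S A"
proof -
  have "rad \<theta> = \<Inter>(insert (Nabla A) {\<phi> \<in> Spec S A. \<theta> \<subseteq> \<phi>})" by (simp add: radical_def)
  then show ?thesis using Inter_Con[of "insert (Nabla A) {\<phi> \<in> Spec S A. \<theta> \<subseteq> \<phi>}" S A] Nabla_Con[OF alg]
    by (auto simp: Spec_def)
qed

lemma rad_ge: "\<theta> \<in> Con S A \<Longrightarrow> \<theta> \<subseteq> rad \<theta>"
  using Con_Nabla[of \<theta> S A] by (auto simp: radical_def)

lemma rad_le_prime: "\<phi> \<in> Spec S A \<Longrightarrow> \<theta> \<subseteq> \<phi> \<Longrightarrow> rad \<theta> \<subseteq> \<phi>"
  by (auto simp: radical_def)

lemma le_radI: "\<alpha> \<in> Con S A \<Longrightarrow> (\<And>\<phi>. \<phi> \<in> Spec S A \<Longrightarrow> \<theta> \<subseteq> \<phi> \<Longrightarrow> \<alpha> \<subseteq> \<phi>) \<Longrightarrow> \<alpha> \<subseteq> rad \<theta>"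
  using Con_Nabla[of \<alpha> S A] unfolding radical_def by blast

lemma rad_le_iff: "\<alpha> \<in> Con S A \<Longrightarrow> rad \<alpha> \<subseteq> rad \<beta> \<longleftrightarrow> \<alpha> \<subseteq> rad \<beta>"
proof
  assume "\<alpha> \<subseteq> rad \<beta>"
  then show "rad \<alpha> \<subseteq> rad \<beta>"
    by (intro le_radI rad_Con) (metis rad_le_prime subset_trans)
qed (use rad_ge[of \<alpha>] in blast)

lemma rad_mono: "\<alpha> \<in> Con S A \<Longrightarrow> \<beta> \<in> Con S A \<Longrightarrow> \<alpha> \<subseteq> \<beta> \<Longrightarrow> rad \<alpha> \<subseteq> rad \<beta>"
  using rad_le_iff[of \<alpha> \<beta>] rad_ge[of \<beta>] by blast

lemma rad_br: 
  assumes con: "\<alpha> \<in> Con S A" "\<beta> \<in> Con S A"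
  shows "rad (br \<alpha> \<beta>) = rad \<alpha> \<inter> rad \<beta>"
proof
  show "rad (br \<alpha> \<beta>) \<subseteq> rad \<alpha> \<inter> rad \<beta>"
    using rad_mono[OF br_Con[OF con] con(1) br_le(1)[OF con]]
      rad_mono[OF br_Con[OF con] con(2) br_le(2)[OF con]] by blast
  show "rad \<alpha> \<inter> rad \<beta> \<subseteq> rad (br \<alpha> \<beta>)"
  proof (rule le_radI[OF Int_Con[OF rad_Con rad_Con]])
    fix \<phi> assume \<phi>: "\<phi> \<in> Spec S A" "br \<alpha> \<beta> \<subseteq> \<phi>"
    from SpecD[OF \<phi>(1) con \<phi>(2)] show "rad \<alpha> \<inter> rad \<beta> \<subseteq> \<phi>" using rad_le_prime[OF \<phi>(1)] by blast
  qed
qed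

lemma rad_J_le:
  assumes con: "\<alpha> \<in> Con S A" "\<beta> \<in> Con S A" "\<alpha>' \<in> Con S A" "\<beta>' \<in> Con S A"
    and eq: "rad \<alpha> \<subseteq> rad \<alpha>'" "rad \<beta> \<subseteq> rad \<beta>'"
  shows "rad (J \<alpha> \<beta>) \<subseteq> rad (J \<alpha>' \<beta>')"
proof -
  have J: "J \<alpha>' \<beta>' \<in> Con S A" "J \<alpha> \<beta> \<in> Con S A" using J_Con con by auto
  have "\<alpha> \<subseteq> rad (J \<alpha>' \<beta>')"
    using rad_ge[OF con(1)] eq(1) rad_mono[OF con(3) J(1) J_ge(1)] by blast
  moreover have "\<beta> \<subseteq> rad (J \<alpha>' \<beta>')"
    using rad_ge[OF con(2)] eq(2) rad_mono[OF con(4) J(1) J_ge(2)] by blast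
  ultimately have "J \<alpha> \<beta> \<subseteq> rad (J \<alpha>' \<beta>')" by (rule J_le[OF rad_Con])
  then show ?thesis using rad_le_iff[OF J(2)] by blast
qed

text \<open>The system \<open>{\<nabla>}\<close> is admissible in \<open>prime_exists\<close>, since
  \<open>\<nabla>\<close> is compact and \<open>[\<nabla>, \<nabla>] = \<nabla>\<close>.\<close>

lemma prime_above:
  assumes "\<theta> \<in> Con S A" "\<theta> \<noteq> Nabla A"
  shows "\<exists>\<phi>\<in>Spec S A. \<theta> \<subseteq> \<phi>"
proof -
  have "\<exists>\<phi>\<in>Spec S A. \<theta> \<subseteq> \<phi> \<and> (\<forall>s\<in>{Nabla A}. \<not> s \<subseteq> \<phi>)"
    by (rule prime_exists) (use Nabla_K br_Nabla[OF Nabla_Con[OF alg]] assms Con_Nabla[OF assms(1)] in auto)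
  then show ?thesis by blast
qed

lemma rad_eq_Nabla: "\<theta> \<in> Con S A \<Longrightarrow> rad \<theta> = Nabla A \<longleftrightarrow> \<theta> = Nabla A"
proof
  assume \<theta>: "\<theta> \<in> Con S A" and rad: "rad \<theta> = Nabla A"
  show "\<theta> = Nabla A"
  proof (rule ccontr)
    assume "\<theta> \<noteq> Nabla A"
    from prime_above[OF \<theta> this] obtain \<phi> where \<phi>: "\<phi> \<in> Spec S A" "\<theta> \<subseteq> \<phi>" by blast
    with rad_le_prime[OF \<phi>] rad Con_Nabla[OF Spec_Con[OF \<phi>(1)]] show False by (auto simp: Spec_def)
  qed
qed (use rad_ge[of \<theta>] Con_Nabla[OF rad_Con] in auto)

text \<open>Otherwise the iterated squares of \<open>\<kappa>\<close> form a system as in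
  \<open>prime_exists\<close>, and some prime above \<open>\<theta>\<close> does not contain
  \<open>\<kappa>\<close> itself, which is \<open>sq 0 \<kappa>\<close>. For
  \<open>\<theta> = \<Delta>\<close>: compact congruences below the radical are nilpotent.\<close>

lemma K_le_rad:
  assumes \<kappa>: "\<kappa> \<in> KCon S A" and \<theta>: "\<theta> \<in> Con S A" and le: "\<kappa> \<subseteq> rad \<theta>"
  shows "\<exists>n. sq n \<kappa> \<subseteq> \<theta>"
proof (rule ccontr)
  assume neg: "\<nexists>n. sq n \<kappa> \<subseteq> \<theta>"
  have "\<exists>\<phi>\<in>Spec S A. \<theta> \<subseteq> \<phi> \<and> (\<forall>s\<in>range (\<lambda>n. sq n \<kappa>). \<not> s \<subseteq> \<phi>)"
  proof (rule prime_exists[OF _ _ _ \<theta>])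
    fix s s' assume "s \<in> range (\<lambda>n. sq n \<kappa>)" "s' \<in> range (\<lambda>n. sq n \<kappa>)"
    then obtain m n where mn: "s = sq m \<kappa>" "s' = sq n \<kappa>" by blast
    have "sq (Suc (max m n)) \<kappa> \<subseteq> br s s'"
      unfolding sq_Suc mn by (intro commutator_mono sq_antimono[OF K_Con[OF \<kappa>]]) auto
    then show "\<exists>s''\<in>range (\<lambda>n. sq n \<kappa>). s'' \<subseteq> br s s'" by blast
  qed (use neg sq_K[OF \<kappa>] in auto)
  then obtain \<phi> where \<phi>: "\<phi> \<in> Spec S A" "\<theta> \<subseteq> \<phi>" "\<not> sq 0 \<kappa> \<subseteq> \<phi>" by blast
  with le rad_le_prime[OF \<phi>(1,2)] show False by auto
qed

lemma Nabla_finitary: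
  assumes sub: "X \<subseteq> Nabla A" and top: "Cg S A X = Nabla A"
  shows "\<exists>F. finite F \<and> F \<subseteq> X \<and> Cg S A F = Nabla A"
proof -
  obtain Z where Z: "finite Z" "Z \<subseteq> Nabla A" "Nabla A = Cg S A Z" using Nabla_K by (auto simp: KCon_def)
  have "\<exists>F. finite F \<and> F \<subseteq> X \<and> z \<in> Cg S A F" if "z \<in> Z" for z
    using Cg_finitary[OF alg sub, of "fst z" "snd z"] that Z(2) top by auto
  then obtain F where F: "\<And>z. z \<in> Z \<Longrightarrow> finite (F z) \<and> F z \<subseteq> X \<and> z \<in> Cg S A (F z)" by metis
  define G where "G = (\<Union>z\<in>Z. F z)"
  have G: "finite G" "G \<subseteq> X" using F Z(1) by (auto simp: G_def)
  have con: "Cg S A G \<in> Con S A" using G(2) sub by (intro Cg_Con[OF alg]) auto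
  have "z \<in> Cg S A G" if "z \<in> Z" for z
    using F[OF that] Cg_mono[of "F z" G S A] that by (auto simp: G_def)
  then have "Cg S A Z \<subseteq> Cg S A G" by (intro Cg_least con) auto
  then have "Cg S A G = Nabla A" using Z(3) Con_Nabla[OF con] by simp
  with G show ?thesis by blast
qed

text \<open>Compactness of \<open>\<nabla>\<close> leaves finitely many pairs of
  \<open>\<theta>\<close> and of \<open>\<theta>'\<close>; \<open>\<alpha>\<close> is generated by
  those from \<open>\<theta>\<close>.\<close>

lemma K_below_comax:
  assumes con: "\<theta> \<in> Con S A" "\<theta>' \<in> Con S A" and top: "J \<theta> \<theta>' = Nabla A"
  shows "\<exists>\<alpha>\<in>KCon S A. \<alpha> \<subseteq> \<theta> \<and> J \<alpha> \<theta>' = Nabla A"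
proof -
  have sub: "\<theta> \<union> \<theta>' \<subseteq> Nabla A" using con Con_Nabla by blast
  from Nabla_finitary[OF this top] obtain G where
    G: "finite G" "G \<subseteq> \<theta> \<union> \<theta>'" "Cg S A G = Nabla A" by blast
  define \<alpha> where "\<alpha> = Cg S A (G \<inter> \<theta>)"
  have \<alpha>: "\<alpha> \<in> KCon S A" "\<alpha> \<subseteq> \<theta>"
    using G sub Cg_least[OF con(1), of "G \<inter> \<theta>"] by (auto simp: \<alpha>_def KCon_def)
  have "G \<subseteq> J \<alpha> \<theta>'" using G(2) Cg_ge[of "G \<inter> \<theta>" S A] J_ge(1)[of \<alpha> \<theta>'] J_ge(2)[of \<theta>' \<alpha>] unfolding \<alpha>_def by blast
  then have "Cg S A G \<subseteq> J \<alpha> \<theta>'" by (rule Cg_least[OF J_Con[OF K_Con[OF \<alpha>(1)] con(2)]])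
  then show ?thesis using G(3) \<alpha> Con_Nabla[OF J_Con[OF K_Con[OF \<alpha>(1)] con(2)]] by blast
qed

end

section \<open>The reticulation and complemented congruences\<close>

text \<open>Stands in for the congruence lattice of the quotient by \<open>r\<close>; complements
  are thus relative to the bottom element \<open>r\<close>.\<close>

definition Con_above :: "'f signature \<Rightarrow> ('f, 'a) algebra \<Rightarrow> 'a rel \<Rightarrow> 'a rel lattice_ops" where
  "Con_above S A r = \<lparr>carrier = {\<theta> \<in> Con S A. r \<subseteq> \<theta>}, jn = (\<lambda>\<alpha> \<beta>. Cg S A (\<alpha> \<union> \<beta>)), mt = (\<inter>),
     bt = r, tp = Nabla A\<rparr>"

lemma Con_above_simps [simp]:
  "carrier (Con_above S A r) = {\<theta> \<in> Con S A. r \<subseteq> \<theta>}" "jn (Con_above S A r) \<alpha> \<beta> = Cg S A (\<alpha> \<union> \<beta>)"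
  "mt (Con_above S A r) = (\<inter>)" "bt (Con_above S A r) = r" "tp (Con_above S A r) = Nabla A"
  by (simp_all add: Con_above_def)

lemma Con_lattice_eq: "Con_lattice S A = Con_above S A (Delta A)"
  using Delta_least[of _ S A] by (auto simp: Con_above_def Con_lattice_def)

lemma complemented_above:
  "complemented (Con_above S A r) =
    {\<theta> \<in> Con S A. \<exists>\<theta>'\<in>Con S A. Cg S A (\<theta> \<union> \<theta>') = Nabla A \<and> \<theta> \<inter> \<theta>' = r}"
  by (auto simp: complemented_def)

context comm_algebra
begin

text \<open>Condition (4) in terms of compact congruences.\<close>

definition compl_mod_rad :: bool where
  "compl_mod_rad \<longleftrightarrow> (\<forall>\<alpha>\<in>KCon S A. \<exists>\<beta>\<in>KCon S A. J \<alpha> \<beta> = Nabla A \<and> br \<alpha> \<beta> \<subseteq> rad (Delta A))"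

lemma PCon_K: "\<alpha> \<in> PCon S A \<Longrightarrow> \<alpha> \<in> KCon S A"
  by (auto simp: PCon_def KCon_def Nabla_def)

text \<open>\<open>[\<alpha>, \<beta>]\<close> is compact and below the radical of
  \<open>\<Delta>\<close>, hence nilpotent, and \<open>comax_sq\<close> turns this into powers of
  \<open>\<alpha>\<close> and \<open>\<beta>\<close> with trivial intersection.\<close>

lemma comax_sq_complemented:
  assumes K: "\<alpha> \<in> KCon S A" "\<beta> \<in> KCon S A" and top: "J \<alpha> \<beta> = Nabla A"
    and le: "br \<alpha> \<beta> \<subseteq> rad (Delta A)"
  shows "\<exists>n\<ge>1. sq n \<alpha> \<in> complemented (Con_above S A (Delta A))"
proof -
  have \<gamma>: "br \<alpha> \<beta> \<in> KCon S A" by (rule br_K[OF K])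
  from K_le_rad[OF \<gamma> Delta_Con[OF alg] le] obtain n where "sq n (br \<alpha> \<beta>) \<subseteq> Delta A" by blast
  \<comment> \<open>One more square makes the exponent positive.\<close>
  then have n: "sq (Suc n) (br \<alpha> \<beta>) \<subseteq> Delta A" using sq_antimono[OF K_Con[OF \<gamma>], of n "Suc n"] by auto
  have con: "sq (Suc n) \<alpha> \<in> Con S A" "sq (Suc n) \<beta> \<in> Con S A" using K sq_Con K_Con by blast+
  have "Delta A \<subseteq> sq (Suc n) \<alpha> \<inter> sq (Suc n) \<beta>" using Delta_least con by blast
  with comax_sq[OF K top, of "Suc n"] n
  have "J (sq (Suc n) \<alpha>) (sq (Suc n) \<beta>) = Nabla A \<and> sq (Suc n) \<alpha> \<inter> sq (Suc n) \<beta> = Delta A" by blast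
  with con have "sq (Suc n) \<alpha> \<in> complemented (Con_above S A (Delta A))" unfolding complemented_above by blast
  then show ?thesis by (intro exI[of _ "Suc n"]) simp
qed

lemma compl_mod_rad_sq:
  "compl_mod_rad \<Longrightarrow> \<alpha> \<in> KCon S A \<Longrightarrow> \<exists>n\<ge>1. sq n \<alpha> \<in> complemented (Con_above S A (Delta A))"
  unfolding compl_mod_rad_def using comax_sq_complemented by blast

lemma hyperarchimedean_iff:
  "hyperarchimedean S A \<longleftrightarrow> (\<forall>\<alpha>\<in>PCon S A. \<exists>n\<ge>1. sq n \<alpha> \<in> complemented (Con_above S A (Delta A)))"
  unfolding hyperarchimedean_def Con_lattice_eq by (metis comm_pow_eq)

lemma Max_subset_Spec: "Max_Con S A \<subseteq> Spec S A"
proof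
  fix \<phi> assume "\<phi> \<in> Max_Con S A"
  then have con: "\<phi> \<in> Con S A" and ne: "\<phi> \<noteq> Nabla A"
    and max: "\<And>\<psi>. \<psi> \<in> Con S A \<Longrightarrow> \<psi> \<noteq> Nabla A \<Longrightarrow> \<phi> \<subseteq> \<psi> \<Longrightarrow> \<psi> = \<phi>" by (auto simp: Max_Con_def)
  have top: "J \<phi> \<alpha> = Nabla A" if "\<alpha> \<in> Con S A" "\<not> \<alpha> \<subseteq> \<phi>" for \<alpha>
    using max[OF J_Con[OF con that(1)] _ J_ge(1)] J_ge(2)[of \<alpha> \<phi>] that(2) by auto
  have "\<alpha> \<subseteq> \<phi> \<or> \<beta> \<subseteq> \<phi>" if \<alpha>\<beta>: "\<alpha> \<in> Con S A" "\<beta> \<in> Con S A" "br \<alpha> \<beta> \<subseteq> \<phi>" for \<alpha> \<beta>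
  proof (rule ccontr)
    assume "\<not> ?thesis"
    then have "J \<phi> \<alpha> = Nabla A" "\<not> \<beta> \<subseteq> \<phi>" using top \<alpha>\<beta> by auto
    moreover from comax_le[OF \<alpha>\<beta>(2) con \<alpha>\<beta>(1) con this(1)] have "\<beta> \<subseteq> \<phi>"
      using br_le(2)[OF \<alpha>\<beta>(2) con] \<alpha>\<beta>(3) br_comm[OF \<alpha>\<beta>(1,2)] by simp
    ultimately show False by simp
  qed
  with con ne show "\<phi> \<in> Spec S A" by (simp add: Spec_def)
qed

text \<open>If a prime \<open>\<phi>\<close> were properly below a proper \<open>\<chi>\<close>, a
  pair in \<open>\<chi>\<close> outside \<open>\<phi>\<close> would generate some
  \<open>\<alpha>\<close> with a power complemented by \<open>\<theta>\<close>. Primeness puts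
  \<open>\<theta>\<close> below \<open>\<phi>\<close>, so both the power and \<open>\<theta>\<close>
  lie below \<open>\<chi>\<close>, although their join is \<open>\<nabla>\<close>.\<close>

lemma hyperarchimedean_imp_Max:
  assumes hyp: "hyperarchimedean S A"
  shows "Max_Con S A = Spec S A"
proof (intro equalityI Max_subset_Spec subsetI)
  fix \<phi> assume \<phi>: "\<phi> \<in> Spec S A"
  have con: "\<phi> \<in> Con S A" by (rule Spec_Con[OF \<phi>])
  have "\<chi> = \<phi>" if \<chi>: "\<chi> \<in> Con S A" "\<chi> \<noteq> Nabla A" "\<phi> \<subseteq> \<chi>" for \<chi>
  proof (rule ccontr)
    assume "\<chi> \<noteq> \<phi>"
    then obtain a b where ab: "(a, b) \<in> \<chi>" "(a, b) \<notin> \<phi>" using \<chi>(3) by auto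
    define \<alpha> where "\<alpha> = Cg S A {(a, b)}"
    have "\<alpha> \<in> PCon S A" using Con_sub[OF \<chi>(1) ab(1)] by (auto simp: \<alpha>_def PCon_def)
    then have \<alpha>: "\<alpha> \<in> Con S A" by (intro K_Con PCon_K)
    have "\<alpha> \<subseteq> \<chi>" using Cg_least[OF \<chi>(1), of "{(a, b)}"] ab by (simp add: \<alpha>_def)
    have not: "\<not> \<alpha> \<subseteq> \<phi>" using Cg_ge[of "{(a, b)}" S A] ab by (auto simp: \<alpha>_def)
    obtain n \<theta> where n: "\<theta> \<in> Con S A" "J (sq n \<alpha>) \<theta> = Nabla A" "sq n \<alpha> \<inter> \<theta> = Delta A"
      using hyp \<open>\<alpha> \<in> PCon S A\<close> unfolding hyperarchimedean_iff complemented_above by blast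
    have "br (sq n \<alpha>) \<theta> \<subseteq> \<phi>"
      using commutator_le_Int[OF sq_Con[OF \<alpha>, of n] n(1)] n(3) Delta_least[OF con] by blast
    then have "\<theta> \<subseteq> \<phi>" using SpecD[OF \<phi> sq_Con[OF \<alpha>] n(1)] Spec_sq[OF \<phi> \<alpha>] not by blast
    moreover have "sq n \<alpha> \<subseteq> \<chi>" using sq_antimono[OF \<alpha>, of 0 n] \<open>\<alpha> \<subseteq> \<chi>\<close> by simp
    ultimately have "J (sq n \<alpha>) \<theta> \<subseteq> \<chi>" using \<chi> by (intro J_le) auto
    then show False using n(2) \<chi>(2) Con_Nabla[OF \<chi>(1)] by simp
  qed
  then show "\<phi> \<in> Max_Con S A" using \<phi> con by (auto simp: Max_Con_def Spec_def)
qed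

text \<open>If \<open>\<alpha>\<close> has no complement modulo the radical, then \<open>\<alpha>\<close> and its pseudocomplements lie in
  a prime \<open>\<phi>\<close>; a prime below \<open>\<phi>\<close> that does not contain \<open>\<alpha>\<close> shows that \<open>\<phi>\<close> cannot be the only
  prime below \<open>\<phi>\<close>.\<close>

lemma Max_imp_compl_mod_rad:
  assumes max: "Max_Con S A = Spec S A"
  shows "compl_mod_rad"
  unfolding compl_mod_rad_def
proof (rule ballI, rule ccontr)
  fix \<alpha> assume \<alpha>: "\<alpha> \<in> KCon S A"
    and neg: "\<not> (\<exists>\<beta>\<in>KCon S A. J \<alpha> \<beta> = Nabla A \<and> br \<alpha> \<beta> \<subseteq> rad (Delta A))"
  note \<alpha>_con = K_Con[OF \<alpha>]
  \<comment> \<open>Compact pseudocomplements of \<open>\<alpha>\<close> modulo the radical; they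
    are directed because the commutator distributes over joins (\<open>dir\<close>).\<close>
  define \<S> where "\<S> = {s \<in> KCon S A. br \<alpha> s \<subseteq> rad (Delta A)}"
  have D_S: "Delta A \<in> \<S>"
    using Delta_K br_le(2)[OF \<alpha>_con Delta_Con[OF alg]] rad_ge[OF Delta_Con[OF alg]] by (auto simp: \<S>_def)
  have dir: "\<exists>s\<in>\<S>. \<forall>x\<in>F. x \<in> s" if "finite F" "F \<subseteq> \<Union>\<S>" for F
    using that
  proof induction
    case (insert x F)
    then obtain s t where st: "s \<in> \<S>" "\<forall>x\<in>F. x \<in> s" "t \<in> \<S>" "x \<in> t" by auto
    then have con: "s \<in> Con S A" "t \<in> Con S A" by (auto simp: \<S>_def intro: K_Con)
    have "br (J s t) \<alpha> \<subseteq> rad (Delta A)"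
      using st br_comm[OF con(1) \<alpha>_con] br_comm[OF con(2) \<alpha>_con]
      by (intro br_join_le con \<alpha>_con rad_Con) (auto simp: \<S>_def)
    then have "J s t \<in> \<S>"
      using st J_K br_comm[OF \<alpha>_con J_Con[OF con]] by (auto simp: \<S>_def)
    moreover have "\<forall>y\<in>insert x F. y \<in> J s t" using st J_ge(1)[of s t] J_ge(2)[of t s] by auto
    ultimately show ?case by blast
  qed (use D_S in auto)
  define \<delta> where "\<delta> = Cg S A (\<alpha> \<union> \<Union>\<S>)"
  have sub: "\<alpha> \<union> \<Union>\<S> \<subseteq> Nabla A"
  proof (intro Un_least Union_least)
    show "s \<subseteq> Nabla A" if "s \<in> \<S>" for s using that by (intro Con_Nabla[OF K_Con]) (simp add: \<S>_def)
  qed (rule Con_Nabla[OF \<alpha>_con])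
  have \<delta>: "\<delta> \<in> Con S A" unfolding \<delta>_def by (rule Cg_Con[OF alg sub])
  have "\<delta> \<noteq> Nabla A"
  proof
    assume top: "\<delta> = Nabla A"
    then obtain F where F: "finite F" "F \<subseteq> \<alpha> \<union> \<Union>\<S>" "Cg S A F = Nabla A"
      using Nabla_finitary[OF sub] unfolding \<delta>_def by blast
    obtain s where s: "s \<in> \<S>" "\<forall>x\<in>F - \<alpha>. x \<in> s" using dir[of "F - \<alpha>"] F(1,2) by auto
    have s_K: "s \<in> KCon S A" using s(1) by (simp add: \<S>_def)
    have "Nabla A \<subseteq> J \<alpha> s" unfolding F(3)[symmetric] using s(2) by (intro Cg_mono) auto
    then have "J \<alpha> s = Nabla A" using Con_Nabla[OF J_Con[OF \<alpha>_con K_Con[OF s_K]]] by blast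
    with neg s s_K show False by (auto simp: \<S>_def)
  qed
  from prime_above[OF \<delta> this] obtain \<phi> where \<phi>: "\<phi> \<in> Spec S A" "\<delta> \<subseteq> \<phi>" by blast
  have le_\<phi>: "\<alpha> \<union> \<Union>\<S> \<subseteq> \<phi>" using \<phi>(2) unfolding \<delta>_def by (rule subset_trans[OF Cg_ge])
  \<comment> \<open>A system containing \<open>\<alpha>\<close> and all compact congruences outside
    \<open>\<phi>\<close>. The commutators \<open>[\<alpha>, s]\<close> enter only through their
    radicals: there commutators become intersections (\<open>rad_br\<close>), which makes up for the
    missing associativity.\<close>
  define \<T> where "\<T> = {x \<in> KCon S A. \<exists>s\<in>KCon S A. \<not> s \<subseteq> \<phi> \<and> rad (br \<alpha> s) \<subseteq> rad x}"
  have \<T>I: "s \<in> \<T>" if "s \<in> KCon S A" "\<not> s \<subseteq> \<phi>" for s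
    using that rad_mono[OF br_Con[OF \<alpha>_con K_Con[OF that(1)]] K_Con[OF that(1)] br_le(2)[OF \<alpha>_con K_Con[OF that(1)]]]
    by (auto simp: \<T>_def)
  have N_\<phi>: "\<not> Nabla A \<subseteq> \<phi>" using \<phi>(1) Con_Nabla[OF Spec_Con[OF \<phi>(1)]] by (auto simp: Spec_def)
  have "\<exists>\<psi>\<in>Spec S A. Delta A \<subseteq> \<psi> \<and> (\<forall>s\<in>\<T>. \<not> s \<subseteq> \<psi>)"
  proof (rule prime_exists[OF _ _ _ Delta_Con[OF alg]])
    show "\<T> \<subseteq> KCon S A" by (auto simp: \<T>_def)
    show "\<T> \<noteq> {}" using \<T>I[OF Nabla_K N_\<phi>] by blast
    fix x x' assume "x \<in> \<T>" "x' \<in> \<T>"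
    then obtain s s' where s: "x \<in> KCon S A" "s \<in> KCon S A" "\<not> s \<subseteq> \<phi>" "rad (br \<alpha> s) \<subseteq> rad x"
      and s': "x' \<in> KCon S A" "s' \<in> KCon S A" "\<not> s' \<subseteq> \<phi>" "rad (br \<alpha> s') \<subseteq> rad x'" by (auto simp: \<T>_def)
    note con = K_Con[OF s(1)] K_Con[OF s(2)] K_Con[OF s'(1)] K_Con[OF s'(2)]
    have "\<not> br s s' \<subseteq> \<phi>" using SpecD[OF \<phi>(1) con(2,4)] s(3) s'(3) by blast
    moreover have "rad (br \<alpha> (br s s')) \<subseteq> rad (br x x')"
      using s(4) s'(4) by (auto simp: rad_br con \<alpha>_con br_Con)
    ultimately have "br x x' \<in> \<T>" using br_K s(1,2) s'(1,2) by (auto simp: \<T>_def)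
    then show "\<exists>s''\<in>\<T>. s'' \<subseteq> br x x'" by blast
  next
    fix x assume "x \<in> \<T>"
    then obtain s where s: "x \<in> KCon S A" "s \<in> KCon S A" "\<not> s \<subseteq> \<phi>" "rad (br \<alpha> s) \<subseteq> rad x" by (auto simp: \<T>_def)
    show "\<not> x \<subseteq> Delta A"
    proof
      assume "x \<subseteq> Delta A"
      then have "rad x \<subseteq> rad (Delta A)" by (rule rad_mono[OF K_Con[OF s(1)] Delta_Con[OF alg]])
      then have "br \<alpha> s \<subseteq> rad (Delta A)" using s(4) rad_ge[OF br_Con[OF \<alpha>_con K_Con[OF s(2)]]] by blast
      then have "s \<in> \<S>" using s(2) by (simp add: \<S>_def)
      then show False using le_\<phi> s(3) by blast
    qed
  qed
  then obtain \<psi> where \<psi>: "\<psi> \<in> Spec S A" "\<And>s. s \<in> \<T> \<Longrightarrow> \<not> s \<subseteq> \<psi>" by blast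
  have "\<psi> \<subseteq> \<phi>"
  proof (rule subrelI, rule ccontr)
    fix a b assume ab: "(a, b) \<in> \<psi>" "(a, b) \<notin> \<phi>"
    let ?s = "Cg S A {(a, b)}"
    have "?s \<in> KCon S A" using Con_sub[OF Spec_Con[OF \<psi>(1)] ab(1)] by (auto simp: KCon_def Nabla_def)
    moreover have "\<not> ?s \<subseteq> \<phi>" using Cg_ge[of "{(a, b)}" S A] ab(2) by blast
    ultimately have "?s \<in> \<T>" by (rule \<T>I)
    moreover have "?s \<subseteq> \<psi>" using Cg_least[OF Spec_Con[OF \<psi>(1)], of "{(a, b)}"] ab(1) by simp
    ultimately show False using \<psi>(2) by blast
  qed
  moreover have "\<psi> \<in> Max_Con S A" "\<phi> \<in> Con S A" "\<phi> \<noteq> Nabla A"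
    using \<psi>(1) max \<phi>(1) by (auto simp: Spec_def)
  ultimately have "\<phi> = \<psi>" by (auto simp: Max_Con_def)
  \<comment> \<open>Take \<open>s = \<nabla>\<close>. So \<open>\<alpha>\<close> is below
    \<open>\<phi>\<close> but not below \<open>\<psi>\<close>, which equals
    \<open>\<phi>\<close>.\<close>
  moreover have "\<alpha> \<in> \<T>"
    using \<alpha> Nabla_K N_\<phi> br_Nabla[OF \<alpha>_con] by (auto simp: \<T>_def intro!: bexI[of _ "Nabla A"])
  ultimately show False using \<psi>(2) le_\<phi> by blast
qed

lemma compl_mod_rad_imp_hyperarchimedean: "compl_mod_rad \<Longrightarrow> hyperarchimedean S A"
  unfolding hyperarchimedean_iff using compl_mod_rad_sq PCon_K by blast

lemma hyperarchimedean_iff_compl: "hyperarchimedean S A \<longleftrightarrow> compl_mod_rad"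
  using hyperarchimedean_imp_Max Max_imp_compl_mod_rad compl_mod_rad_imp_hyperarchimedean by blast

lemma Max_iff_compl: "Max_Con S A = Spec S A \<longleftrightarrow> compl_mod_rad"
  using hyperarchimedean_imp_Max Max_imp_compl_mod_rad compl_mod_rad_imp_hyperarchimedean by blast

end

section \<open>Lattice operations of the reticulation in terms of representatives\<close>

lemma UN_UN_const:
  assumes "\<And>x y. x \<in> X \<Longrightarrow> y \<in> Y \<Longrightarrow> F x y = Z" "x0 \<in> X" "y0 \<in> Y"
  shows "(\<Union>x\<in>X. \<Union>y\<in>Y. F x y) = Z"
proof -
  have "(\<Union>x\<in>X. \<Union>y\<in>Y. F x y) = (\<Union>x\<in>X. \<Union>y\<in>Y. Z)" using assms(1) by (intro SUP_cong) auto
  with assms(2,3) show ?thesis by auto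
qed

context comm_algebra
begin

abbreviation (input) cl :: "'a rel \<Rightarrow> 'a rel set" where "cl \<equiv> rad_class S A"

lemma cl_eq_iff: "\<alpha> \<in> Con S A \<Longrightarrow> \<beta> \<in> Con S A \<Longrightarrow> cl \<alpha> = cl \<beta> \<longleftrightarrow> rad \<alpha> = rad \<beta>"
  by (auto simp: rad_class_def)

lemma rad_J_eq:
  "\<alpha> \<in> Con S A \<Longrightarrow> \<beta> \<in> Con S A \<Longrightarrow> \<alpha>' \<in> Con S A \<Longrightarrow> \<beta>' \<in> Con S A \<Longrightarrow>
    rad \<alpha> = rad \<alpha>' \<Longrightarrow> rad \<beta> = rad \<beta>' \<Longrightarrow> rad (J \<alpha> \<beta>) = rad (J \<alpha>' \<beta>')"
  by (intro equalityI rad_J_le) simp_all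

lemma jn_cl:
  assumes con: "\<alpha> \<in> Con S A" "\<beta> \<in> Con S A"
  shows "jn (reticulation S A) (cl \<alpha>) (cl \<beta>) = cl (J \<alpha> \<beta>)"
proof -
  have "(\<Union>\<alpha>'\<in>cl \<alpha>. \<Union>\<beta>'\<in>cl \<beta>. cl (J \<alpha>' \<beta>')) = cl (J \<alpha> \<beta>)"
  proof (rule UN_UN_const)
    fix \<alpha>' \<beta>' assume "\<alpha>' \<in> cl \<alpha>" "\<beta>' \<in> cl \<beta>"
    then have *: "\<alpha>' \<in> Con S A" "\<beta>' \<in> Con S A" "rad \<alpha>' = rad \<alpha>" "rad \<beta>' = rad \<beta>"
      by (simp_all add: rad_class_def)
    from rad_J_eq[OF *(1,2) con *(3,4)] show "cl (J \<alpha>' \<beta>') = cl (J \<alpha> \<beta>)"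
      using cl_eq_iff[OF J_Con[OF *(1,2)] J_Con[OF con]] by blast
  qed (use con in \<open>simp_all add: rad_class_def\<close>)
  then show ?thesis by (simp add: reticulation_def)
qed

lemma mt_cl:
  assumes con: "\<alpha> \<in> Con S A" "\<beta> \<in> Con S A"
  shows "mt (reticulation S A) (cl \<alpha>) (cl \<beta>) = cl (br \<alpha> \<beta>)"
proof -
  have "(\<Union>\<alpha>'\<in>cl \<alpha>. \<Union>\<beta>'\<in>cl \<beta>. cl (br \<alpha>' \<beta>')) = cl (br \<alpha> \<beta>)"
  proof (rule UN_UN_const)
    fix \<alpha>' \<beta>' assume "\<alpha>' \<in> cl \<alpha>" "\<beta>' \<in> cl \<beta>"
    then have *: "\<alpha>' \<in> Con S A" "\<beta>' \<in> Con S A" "rad \<alpha>' = rad \<alpha>" "rad \<beta>' = rad \<beta>"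
      by (simp_all add: rad_class_def)
    then have "rad (br \<alpha>' \<beta>') = rad (br \<alpha> \<beta>)" by (simp only: rad_br con)
    then show "cl (br \<alpha>' \<beta>') = cl (br \<alpha> \<beta>)"
      using cl_eq_iff[OF br_Con[OF *(1,2)] br_Con[OF con]] by blast
  qed (use con in \<open>simp_all add: rad_class_def\<close>)
  then show ?thesis by (simp add: reticulation_def)
qed

lemma ret_simps:
  "carrier (reticulation S A) = cl ` KCon S A" "bt (reticulation S A) = cl (Delta A)"
  "tp (reticulation S A) = cl (Nabla A)"
  by (simp_all add: reticulation_def)

lemma J_Delta: "\<alpha> \<in> Con S A \<Longrightarrow> J \<alpha> (Delta A) = \<alpha>"
  using Delta_least[of \<alpha> S A] J_ge(1)[of \<alpha> "Delta A"] J_le[of \<alpha> \<alpha> "Delta A"] by blast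

lemma J_assoc:
  assumes "\<alpha> \<in> Con S A" "\<beta> \<in> Con S A" "\<gamma> \<in> Con S A"
  shows "J (J \<alpha> \<beta>) \<gamma> = J \<alpha> (J \<beta> \<gamma>)"
proof
  have con: "J \<alpha> (J \<beta> \<gamma>) \<in> Con S A" "J (J \<alpha> \<beta>) \<gamma> \<in> Con S A" "J \<alpha> \<beta> \<in> Con S A" "J \<beta> \<gamma> \<in> Con S A"
    using assms by (simp_all add: J_Con)
  have "J \<alpha> (J \<beta> \<gamma>) \<subseteq> J \<alpha> (J \<beta> \<gamma>)" "J (J \<alpha> \<beta>) \<gamma> \<subseteq> J (J \<alpha> \<beta>) \<gamma>" by simp_all
  then show "J (J \<alpha> \<beta>) \<gamma> \<subseteq> J \<alpha> (J \<beta> \<gamma>)" "J \<alpha> (J \<beta> \<gamma>) \<subseteq> J (J \<alpha> \<beta>) \<gamma>"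
    unfolding J_le_iff[OF con(1)] J_le_iff[OF con(2)] J_le_iff[OF con(3)] J_le_iff[OF con(4)] by simp_all
qed

lemma br_J:
  assumes con: "\<alpha> \<in> Con S A" "\<beta> \<in> Con S A" "\<gamma> \<in> Con S A"
  shows "br \<alpha> (J \<beta> \<gamma>) = J (br \<alpha> \<beta>) (br \<alpha> \<gamma>)"
proof
  have J: "J (br \<alpha> \<beta>) (br \<alpha> \<gamma>) \<in> Con S A" by (intro J_Con br_Con con)
  show "br \<alpha> (J \<beta> \<gamma>) \<subseteq> J (br \<alpha> \<beta>) (br \<alpha> \<gamma>)"
    unfolding br_comm[OF con(1) J_Con[OF con(2,3)]]
  proof (rule br_join_le[OF con(2,3,1) J])
    show "br \<beta> \<alpha> \<subseteq> J (br \<alpha> \<beta>) (br \<alpha> \<gamma>)" unfolding br_comm[OF con(2,1)] by (rule J_ge)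
    show "br \<gamma> \<alpha> \<subseteq> J (br \<alpha> \<beta>) (br \<alpha> \<gamma>)" unfolding br_comm[OF con(3,1)] by (rule J_ge)
  qed
  show "J (br \<alpha> \<beta>) (br \<alpha> \<gamma>) \<subseteq> br \<alpha> (J \<beta> \<gamma>)"
    by (intro J_le br_Con J_Con con commutator_mono J_ge) simp_all
qed

lemma bdd_lattice_ret: "bdd_lattice (reticulation S A)"
proof -
  note simps = jn_cl mt_cl J_Con br_Con K_Con
  show ?thesis
  proof (unfold_locales, unfold ret_simps)
    fix x y assume "x \<in> cl ` KCon S A" "y \<in> cl ` KCon S A"
    then obtain \<alpha> \<beta> where [simp]: "x = cl \<alpha>" "y = cl \<beta>" and K: "\<alpha> \<in> KCon S A" "\<beta> \<in> KCon S A" by blast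
    note con = K_Con[OF K(1)] K_Con[OF K(2)]
    show "jn (reticulation S A) x y \<in> cl ` KCon S A" using con J_K[OF K] by (simp add: jn_cl)
    show "mt (reticulation S A) x y \<in> cl ` KCon S A" using con br_K[OF K] by (simp add: mt_cl)
    show "jn (reticulation S A) x y = jn (reticulation S A) y x"
      using con by (simp add: jn_cl Un_commute)
    show "mt (reticulation S A) x y = mt (reticulation S A) y x"
      using con br_comm by (simp add: mt_cl)
    have "J \<alpha> (br \<alpha> \<beta>) = \<alpha>"
      using J_ge(1) J_le[OF con(1) order_refl br_le(1)[OF con]] by blast
    then show "jn (reticulation S A) x (mt (reticulation S A) x y) = x"
      using con by (simp add: simps)
    have "rad (br \<alpha> (J \<alpha> \<beta>)) = rad \<alpha>"
      using con rad_mono[OF con(1) J_Con[OF con] J_ge(1)] by (auto simp: rad_br J_Con)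
    then show "mt (reticulation S A) x (jn (reticulation S A) x y) = x"
      using con by (simp add: simps cl_eq_iff)
    show "jn (reticulation S A) x (cl (Delta A)) = x"
      using con by (simp add: jn_cl Delta_Con[OF alg] J_Delta)
    show "mt (reticulation S A) x (cl (Nabla A)) = x"
      using con by (simp add: mt_cl Nabla_Con[OF alg] br_Nabla)
    fix z assume "z \<in> cl ` KCon S A"
    then obtain \<gamma> where [simp]: "z = cl \<gamma>" and \<gamma>: "\<gamma> \<in> Con S A" using K_Con by blast
    show "jn (reticulation S A) (jn (reticulation S A) x y) z =
        jn (reticulation S A) x (jn (reticulation S A) y z)"
      using con \<gamma> by (simp add: jn_cl J_Con J_assoc)
    show "mt (reticulation S A) (mt (reticulation S A) x y) z =
        mt (reticulation S A) x (mt (reticulation S A) y z)"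
      using con \<gamma> by (simp add: mt_cl br_Con cl_eq_iff rad_br Int_assoc)
  next
    show "cl (Delta A) \<in> cl ` KCon S A" using Delta_K by blast
    show "cl (Nabla A) \<in> cl ` KCon S A" using Nabla_K by blast
  qed
qed

text \<open>A proper congruence lies below a prime, so its radical is proper too: joins are tested
  against the top exactly, commutators against the bottom only up to the radical.\<close>

lemma complement_ret_iff:
  assumes "\<alpha> \<in> Con S A" "\<beta> \<in> Con S A"
  shows "jn (reticulation S A) (cl \<alpha>) (cl \<beta>) = tp (reticulation S A) \<longleftrightarrow> J \<alpha> \<beta> = Nabla A"
    and "mt (reticulation S A) (cl \<alpha>) (cl \<beta>) = bt (reticulation S A) \<longleftrightarrow> br \<alpha> \<beta> \<subseteq> rad (Delta A)"
proof -
  note N = Nabla_Con[OF alg] and D = Delta_Con[OF alg]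
  show "jn (reticulation S A) (cl \<alpha>) (cl \<beta>) = tp (reticulation S A) \<longleftrightarrow> J \<alpha> \<beta> = Nabla A"
  proof -
    have *: "rad (Nabla A) = Nabla A" using rad_eq_Nabla[OF N] by simp
    have "jn (reticulation S A) (cl \<alpha>) (cl \<beta>) = tp (reticulation S A) \<longleftrightarrow> rad (J \<alpha> \<beta>) = rad (Nabla A)"
      using assms by (simp add: jn_cl ret_simps cl_eq_iff J_Con N)
    then show ?thesis unfolding * rad_eq_Nabla[OF J_Con[OF assms]] .
  qed
  have "rad (Delta A) \<subseteq> rad (br \<alpha> \<beta>)" by (rule rad_mono[OF D br_Con[OF assms] Delta_least[OF br_Con[OF assms]]])
  then show "mt (reticulation S A) (cl \<alpha>) (cl \<beta>) = bt (reticulation S A) \<longleftrightarrow> br \<alpha> \<beta> \<subseteq> rad (Delta A)"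
    using assms rad_le_iff[OF br_Con[OF assms], of "Delta A"]
    by (simp only: mt_cl ret_simps cl_eq_iff br_Con D) blast
qed

lemma boolean_lattice_ret_iff: "boolean_lattice (reticulation S A) \<longleftrightarrow> compl_mod_rad"
proof -
  have "complemented (reticulation S A) = carrier (reticulation S A) \<longleftrightarrow> compl_mod_rad"
  proof -
    have "(\<exists>y\<in>cl ` KCon S A. jn (reticulation S A) (cl \<alpha>) y = tp (reticulation S A) \<and>
        mt (reticulation S A) (cl \<alpha>) y = bt (reticulation S A)) \<longleftrightarrow>
      (\<exists>\<beta>\<in>KCon S A. J \<alpha> \<beta> = Nabla A \<and> br \<alpha> \<beta> \<subseteq> rad (Delta A))" if "\<alpha> \<in> KCon S A" for \<alpha>
      using complement_ret_iff[OF K_Con[OF that] K_Con] by (simp add: bex_simps cong: bex_cong)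
    moreover have "{x \<in> X. R x} = X \<longleftrightarrow> (\<forall>x\<in>X. R x)" for X and R :: "'a rel set \<Rightarrow> bool" by blast
    ultimately show ?thesis
      unfolding complemented_def compl_mod_rad_def ret_simps(1) by simp
  qed
  moreover have "boolean_lattice (reticulation S A)"
    if "complemented (reticulation S A) = carrier (reticulation S A)"
  proof (intro boolean_lattice.intro bdd_lattice_ret boolean_lattice_axioms.intro that)
    fix x y z assume "x \<in> carrier (reticulation S A)" "y \<in> carrier (reticulation S A)" "z \<in> carrier (reticulation S A)"
    then obtain \<alpha> \<beta> \<gamma> where "x = cl \<alpha>" "y = cl \<beta>" "z = cl \<gamma>"
      "\<alpha> \<in> Con S A" "\<beta> \<in> Con S A" "\<gamma> \<in> Con S A" using K_Con by (auto simp: ret_simps)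
    then show "mt (reticulation S A) x (jn (reticulation S A) y z) =
        jn (reticulation S A) (mt (reticulation S A) x y) (mt (reticulation S A) x z)"
      by (simp add: jn_cl mt_cl J_Con br_Con br_J)
  qed
  ultimately show ?thesis using boolean_lattice.all_complemented by blast
qed

text \<open>The commutator of the joins of \<open>\<theta>\<close> and of \<open>\<theta>'\<close>
  with \<open>r\<close> is below \<open>r\<close>, and by comaximality it is their intersection.
  Modularity of the congruence lattice alone would not give this.\<close>

lemma complemented_lift:
  assumes \<theta>: "\<theta> \<in> complemented (Con_above S A (Delta A))" and r: "r \<in> Con S A"
  shows "J \<theta> r \<in> complemented (Con_above S A r)"
proof -
  obtain \<theta>' where con: "\<theta> \<in> Con S A" "\<theta>' \<in> Con S A" and top: "J \<theta> \<theta>' = Nabla A" and bot: "\<theta> \<inter> \<theta>' = Delta A"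
    using \<theta> by (auto simp: complemented_above)
  have J: "J \<theta> r \<in> Con S A" "J \<theta>' r \<in> Con S A" by (simp_all add: J_Con con r)
  have top': "J (J \<theta> r) (J \<theta>' r) = Nabla A" by (rule comax_mono[OF top J_ge(1) J_ge(1) J])
  have "br \<theta> \<theta>' \<subseteq> r" using commutator_le_Int[OF con] bot Delta_least[OF r] by blast
  then have "br (J \<theta>' r) \<theta> \<subseteq> r"
    using br_comm[OF con] by (intro br_join_le con r br_le(1)) simp
  then have "br (J \<theta> r) (J \<theta>' r) \<subseteq> r"
    using br_comm[OF con(1) J(2)] by (intro br_join_le con r br_le(1) J) simp
  then have "J \<theta> r \<inter> J \<theta>' r \<subseteq> r" unfolding comax_Int[OF J top'] .
  then have "J \<theta> r \<inter> J \<theta>' r = r" using J_ge(2)[of r] by blast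
  with J top' show ?thesis by (auto simp: complemented_above)
qed

lemma rad_join_small:
  assumes "\<theta> \<in> Con S A" "r \<in> Con S A" "r \<subseteq> rad (Delta A)"
  shows "rad (J \<theta> r) = rad \<theta>"
proof
  have "r \<subseteq> rad \<theta>"
    using assms(3) rad_mono[OF Delta_Con[OF alg] assms(1) Delta_least[OF assms(1)]] by blast
  then have "J \<theta> r \<subseteq> rad \<theta>" by (intro J_le rad_Con rad_ge assms)
  then show "rad (J \<theta> r) \<subseteq> rad \<theta>" using rad_le_iff[OF J_Con[OF assms(1,2)]] by blast
  show "rad \<theta> \<subseteq> rad (J \<theta> r)" by (rule rad_mono[OF assms(1) J_Con[OF assms(1,2)] J_ge(1)])
qed

lemma br_J_self:
  assumes a: "a \<in> Con S A" and r: "r \<in> Con S A"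
  shows "br (J a r) (J a r) \<subseteq> J (br a a) r"
proof (rule br_join_le)
  show con: "a \<in> Con S A" "r \<in> Con S A" "J a r \<in> Con S A" "J (br a a) r \<in> Con S A"
    by (intro a r J_Con br_Con)+
  have "br (J a r) a \<subseteq> J (br a a) r"
    using br_le(1)[OF r a] J_ge(2)[of r "br a a"] by (intro br_join_le con a J_ge(1)) blast
  then show "br a (J a r) \<subseteq> J (br a a) r" using br_comm[OF a con(3)] by simp
  show "br r (J a r) \<subseteq> J (br a a) r" using br_le(1)[OF r con(3)] J_ge(2) by blast
qed

section \<open>Complemented elements above a congruence \<open>r\<close> that lies below the radical
  of \<open>\<Delta>\<close>\<close>

context
  fixes r :: "'a rel"
  assumes r: "r \<in> Con S A" and r_small: "r \<subseteq> rad (Delta A)"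
begin

definition compl :: "'a rel \<Rightarrow> 'a rel \<Rightarrow> bool" where
  "compl \<theta> \<theta>' \<longleftrightarrow> \<theta> \<in> Con S A \<and> \<theta>' \<in> Con S A \<and> J \<theta> \<theta>' = Nabla A \<and> \<theta> \<inter> \<theta>' = r"

lemma complemented_iff: "\<theta> \<in> complemented (Con_above S A r) \<longleftrightarrow> (\<exists>\<theta>'. compl \<theta> \<theta>')"
  by (auto simp: complemented_above compl_def)

lemma compl_sym: "compl \<theta> \<theta>' \<Longrightarrow> compl \<theta>' \<theta>"
  by (auto simp: compl_def Un_commute)

lemma compl_le:
  assumes \<theta>: "compl \<theta> \<theta>'" and x: "x \<in> Con S A" "\<delta> \<in> Con S A" and le: "br x \<theta> \<subseteq> \<delta>" "x \<inter> \<theta>' \<subseteq> \<delta>"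
  shows "x \<subseteq> \<delta>"
  using \<theta> le(2) commutator_le_Int[OF x(1), of \<theta>']
  by (intro comax_le[OF x(1) _ _ x(2) _ le(1), of \<theta>']) (auto simp: compl_def)

text \<open>Test \<open>\<theta> \<inter> \<eta>\<close> on \<open>\<theta>\<close> and
  \<open>\<theta>'\<close>: its commutator with \<open>\<theta>\<close> is below
  \<open>[\<theta>, \<eta>]\<close>, its intersection with \<open>\<theta>'\<close> below
  \<open>r\<close>. Hence meets of complemented congruences agree with commutators up to
  \<open>r\<close>, as in the reticulation.\<close>

lemma compl_Int:
  assumes \<theta>: "compl \<theta> \<theta>'" and \<eta>: "\<eta> \<in> Con S A" "r \<subseteq> \<eta>"
  shows "\<theta> \<inter> \<eta> = J (br \<theta> \<eta>) r"
proof
  have con: "\<theta> \<in> Con S A" "r \<subseteq> \<theta>" using \<theta> by (auto simp: compl_def)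
  have J: "J (br \<theta> \<eta>) r \<in> Con S A" by (intro J_Con br_Con con \<eta> r)
  show "\<theta> \<inter> \<eta> \<subseteq> J (br \<theta> \<eta>) r"
  proof (rule compl_le[OF \<theta> Int_Con[OF con(1) \<eta>(1)] J])
    have "br (\<theta> \<inter> \<eta>) \<theta> \<subseteq> br \<eta> \<theta>" by (rule commutator_mono) auto
    then show "br (\<theta> \<inter> \<eta>) \<theta> \<subseteq> J (br \<theta> \<eta>) r" using br_comm[OF \<eta>(1) con(1)] J_ge(1) by blast
    have "\<theta> \<inter> \<eta> \<inter> \<theta>' \<subseteq> r" using \<theta> by (auto simp: compl_def)
    then show "\<theta> \<inter> \<eta> \<inter> \<theta>' \<subseteq> J (br \<theta> \<eta>) r" using J_ge(2) by blast
  qed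
  show "J (br \<theta> \<eta>) r \<subseteq> \<theta> \<inter> \<eta>"
    using commutator_le_Int[OF con(1) \<eta>(1)] con \<eta> by (intro J_le Int_Con) auto
qed

text \<open>A De Morgan law without distributivity of the lattice: \<open>\<theta>'\<close> is
  brought below the join \<open>?t\<close> by testing it on \<open>\<eta>\<close> and
  \<open>\<eta>'\<close>, and the intersection becomes a commutator by
  \<open>comax_Int\<close>.\<close>

lemma compl_join:
  assumes \<theta>: "compl \<theta> \<theta>'" and \<eta>: "compl \<eta> \<eta>'"
  shows "compl (J \<theta> \<eta>) (\<theta>' \<inter> \<eta>')"
proof -
  have con: "\<theta> \<in> Con S A" "\<theta>' \<in> Con S A" "\<eta> \<in> Con S A" "\<eta>' \<in> Con S A"
    and bot: "\<theta> \<inter> \<theta>' = r" "\<eta> \<inter> \<eta>' = r" using \<theta> \<eta> by (auto simp: compl_def)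
  have I: "\<theta>' \<inter> \<eta>' \<in> Con S A" by (rule Int_Con[OF con(2,4)])
  have J: "J \<theta> \<eta> \<in> Con S A" by (rule J_Con[OF con(1,3)])
  let ?t = "J (J \<theta> \<eta>) (\<theta>' \<inter> \<eta>')"
  have t: "?t \<in> Con S A" by (rule J_Con[OF J I])
  have ge: "\<theta> \<subseteq> ?t" "\<eta> \<subseteq> ?t" "\<theta>' \<inter> \<eta>' \<subseteq> ?t"
    using J_ge(1)[of \<theta> \<eta>] J_ge(2)[of \<eta> \<theta>] J_ge(1)[of "J \<theta> \<eta>" "\<theta>' \<inter> \<eta>'"] J_ge(2)[of "\<theta>' \<inter> \<eta>'" "J \<theta> \<eta>"] by blast+
  have "\<theta>' \<subseteq> ?t"
    by (rule compl_le[OF \<eta> con(2) t]) (use br_le(2)[OF con(2,3)] ge in blast)+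
  then have "J \<theta> \<theta>' \<subseteq> ?t" by (intro J_le t ge)
  then have top: "?t = Nabla A" using \<theta> Con_Nabla[OF t] by (auto simp: compl_def)
  have "br (J \<theta> \<eta>) (\<theta>' \<inter> \<eta>') \<subseteq> r"
    using commutator_le_Int[OF con(1) I] commutator_le_Int[OF con(3) I] bot
    by (intro br_join_le con I r) blast+
  then have "J \<theta> \<eta> \<inter> (\<theta>' \<inter> \<eta>') \<subseteq> r" unfolding comax_Int[OF J I top] .
  moreover have "r \<subseteq> J \<theta> \<eta> \<inter> (\<theta>' \<inter> \<eta>')" using bot J_ge(1)[of \<theta> \<eta>] by blast
  ultimately show ?thesis using J I top by (auto simp: compl_def)
qed

lemma compl_meet: "compl \<theta> \<theta>' \<Longrightarrow> compl \<eta> \<eta>' \<Longrightarrow> compl (\<theta> \<inter> \<eta>) (J \<theta>' \<eta>')"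
  using compl_join[OF compl_sym compl_sym] by (blast intro: compl_sym)

lemma complemented_closed:
  assumes "\<theta> \<in> complemented (Con_above S A r)" "\<eta> \<in> complemented (Con_above S A r)"
  shows "J \<theta> \<eta> \<in> complemented (Con_above S A r)" "\<theta> \<inter> \<eta> \<in> complemented (Con_above S A r)"
  using assms compl_join compl_meet unfolding complemented_iff by blast+

text \<open>\<open>\<theta>'\<close> is already comaximal with some compact \<open>\<alpha>\<close>
  below \<open>\<theta>\<close>; testing \<open>\<theta>\<close> on \<open>\<alpha>\<close> and
  \<open>\<theta>'\<close> puts it below the join of \<open>\<alpha>\<close> and
  \<open>r\<close>.\<close>

lemma compl_eq_K:
  assumes \<theta>: "compl \<theta> \<theta>'"
  shows "\<exists>\<alpha>\<in>KCon S A. \<theta> = J \<alpha> r"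
proof -
  have con: "\<theta> \<in> Con S A" "\<theta>' \<in> Con S A" "J \<theta> \<theta>' = Nabla A" "\<theta> \<inter> \<theta>' = r" using \<theta> by (auto simp: compl_def)
  from K_below_comax[OF con(1-3)] obtain \<alpha> where
    \<alpha>: "\<alpha> \<in> KCon S A" "\<alpha> \<subseteq> \<theta>" "J \<alpha> \<theta>' = Nabla A" by blast
  have J: "J \<alpha> r \<in> Con S A" by (intro J_Con K_Con \<alpha> r)
  have "\<theta> \<subseteq> J \<alpha> r"
  proof (rule comax_le[OF con(1) K_Con[OF \<alpha>(1)] con(2) J \<alpha>(3)])
    show "br \<theta> \<alpha> \<subseteq> J \<alpha> r" using br_le(2)[OF con(1) K_Con[OF \<alpha>(1)]] J_ge(1) by blast
    show "br \<theta> \<theta>' \<subseteq> J \<alpha> r" using commutator_le_Int[OF con(1,2)] con(4) J_ge(2) by blast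
  qed
  moreover have "J \<alpha> r \<subseteq> \<theta>" using \<alpha>(2) con by (intro J_le) auto
  ultimately show ?thesis using \<alpha>(1) by blast
qed

text \<open>Complemented elements are idempotent, compact ones below the radical are nilpotent.\<close>

lemma compl_small:
  assumes \<zeta>: "compl \<zeta> \<zeta>'" and small: "\<zeta> \<subseteq> rad (Delta A)"
  shows "\<zeta> \<subseteq> r"
proof -
  obtain \<alpha> where \<alpha>: "\<alpha> \<in> KCon S A" "\<zeta> = J \<alpha> r" using compl_eq_K[OF \<zeta>] by blast
  have \<zeta>_con: "\<zeta> \<in> Con S A" "r \<subseteq> \<zeta>" using \<zeta> by (auto simp: compl_def)
  have le: "\<zeta> \<subseteq> J (sq n \<alpha>) r" for n
  proof (induction n)
    case (Suc n)
    let ?a = "sq n \<alpha>" and ?J = "J (sq (Suc n) \<alpha>) r"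
    have a: "?a \<in> Con S A" and J: "?J \<in> Con S A"
      using J_Con[OF _ r] sq_Con K_Con \<alpha>(1) by blast+
    have "br (J ?a r) (J ?a r) \<subseteq> ?J" unfolding sq_Suc by (rule br_J_self[OF a r])
    moreover have "br \<zeta> \<zeta> \<subseteq> br (J ?a r) (J ?a r)" by (rule commutator_mono[OF Suc Suc])
    moreover have "\<zeta> \<subseteq> J (br \<zeta> \<zeta>) r" using compl_Int[OF \<zeta> \<zeta>_con] by simp
    moreover have "J (br \<zeta> \<zeta>) r \<subseteq> ?J" using calculation(1,2) by (intro J_le J J_ge) blast
    ultimately show ?case by blast
  qed (simp add: \<alpha>(2))
  have "\<alpha> \<subseteq> rad (Delta A)" using small \<alpha>(2) J_ge(1) by blast
  from K_le_rad[OF \<alpha>(1) Delta_Con[OF alg] this] obtain n where "sq n \<alpha> \<subseteq> Delta A" by blast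
  then have "J (sq n \<alpha>) r \<subseteq> r" using Delta_least[OF r] by (intro J_le r) auto
  then show ?thesis using le[of n] by blast
qed

text \<open>The complemented \<open>\<theta> \<inter> \<eta>'\<close> lies in
  \<open>rad \<eta> \<inter> rad \<eta>'\<close>, which is the radical of
  \<open>[\<eta>, \<eta>']\<close> and so is below that of \<open>\<Delta>\<close>; by
  \<open>compl_small\<close> it is below \<open>r\<close>. Thus complemented congruences are
  determined by their radicals.\<close>

lemma compl_rad_le:
  assumes \<theta>: "compl \<theta> \<theta>'" and \<eta>: "compl \<eta> \<eta>'" and le: "rad \<theta> \<subseteq> rad \<eta>"
  shows "\<theta> \<subseteq> \<eta>"
proof (rule compl_le[OF \<eta>])
  have con: "\<theta> \<in> Con S A" "\<eta> \<in> Con S A" "\<eta>' \<in> Con S A" "\<eta> \<inter> \<eta>' = r" using \<theta> \<eta> by (auto simp: compl_def)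
  show "\<theta> \<in> Con S A" "\<eta> \<in> Con S A" by (rule con)+
  show "br \<theta> \<eta> \<subseteq> \<eta>" by (rule br_le(2)[OF con(1,2)])
  have "\<theta> \<inter> \<eta>' \<subseteq> rad \<eta> \<inter> rad \<eta>'" using le rad_ge[OF con(1)] rad_ge[OF con(3)] by blast
  also have "\<dots> = rad (br \<eta> \<eta>')" by (rule rad_br[OF con(2,3), symmetric])
  also have "\<dots> \<subseteq> rad (Delta A)"
  proof -
    have "br \<eta> \<eta>' \<subseteq> rad (Delta A)" using commutator_le_Int[OF con(2,3)] con(4) r_small by blast
    then show ?thesis using rad_le_iff[OF br_Con[OF con(2,3)]] by blast
  qed
  finally have "\<theta> \<inter> \<eta>' \<subseteq> r" by (rule compl_small[OF compl_meet[OF \<theta> compl_sym[OF \<eta>]]])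
  then show "\<theta> \<inter> \<eta>' \<subseteq> \<eta>" using con(4) by blast
qed

text \<open>A lattice isomorphism is required to respect joins and meets only, so the bounds are
  recovered from surjectivity; then complements can be pulled back.\<close>

lemma center_imp_compl_mod_rad:
  assumes "lattice_isomorphic (reticulation S A) (boolean_center (Con_above S A r))"
  shows "compl_mod_rad"
proof -
  let ?L = "reticulation S A" and ?B = "complemented (Con_above S A r)"
  obtain h where bij: "bij_betw h (carrier ?L) ?B"
    and hom: "\<And>x y. x \<in> carrier ?L \<Longrightarrow> y \<in> carrier ?L \<Longrightarrow>
      h (jn ?L x y) = J (h x) (h y) \<and> h (mt ?L x y) = h x \<inter> h y"
    using assms by (auto simp: lattice_isomorphic_def boolean_center_def Con_above_def)
  interpret L: bdd_lattice ?L by (rule bdd_lattice_ret)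
  have B: "\<theta> \<in> ?B \<longleftrightarrow> (\<exists>x\<in>carrier ?L. h x = \<theta>)" for \<theta>
  proof -
    have "?B = h ` carrier ?L" using bij by (simp add: bij_betw_def)
    then show ?thesis by auto
  qed
  have sub: "r \<subseteq> \<theta> \<and> \<theta> \<in> Con S A" if "\<theta> \<in> ?B" for \<theta> using that by (auto simp: complemented_iff compl_def)
  have "compl r (Nabla A)"
    using r Nabla_Con[OF alg] Con_Nabla[OF r] J_Nabla[OF r] by (auto simp: compl_def)
  then have ends: "r \<in> ?B" "Nabla A \<in> ?B" unfolding complemented_iff using compl_sym by blast+
  have tp: "h (tp ?L) = Nabla A"
  proof -
    obtain x where x: "x \<in> carrier ?L" "h x = Nabla A" using B ends by blast
    then have "h x = h x \<inter> h (tp ?L)" using L.mt_tp[OF x(1)] hom[OF x(1) L.tp_closed] by simp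
    then show ?thesis using x Con_Nabla[of "h (tp ?L)"] sub B L.tp_closed by blast
  qed
  have bt: "h (bt ?L) = r"
  proof -
    obtain x where x: "x \<in> carrier ?L" "h x = r" using B ends by blast
    then have "h x = J (h x) (h (bt ?L))" using L.jn_bt[OF x(1)] hom[OF x(1) L.bt_closed] by simp
    then have "h (bt ?L) \<subseteq> r" using J_ge(2)[of "h (bt ?L)" "h x"] x(2) by simp
    then show ?thesis using sub B L.bt_closed by blast
  qed
  show ?thesis
    unfolding compl_mod_rad_def
  proof
    fix \<alpha> assume \<alpha>: "\<alpha> \<in> KCon S A"
    then have x: "cl \<alpha> \<in> carrier ?L" by (simp add: ret_simps)
    then have "h (cl \<alpha>) \<in> ?B" using B by blast
    then obtain \<theta>' where \<theta>': "compl (h (cl \<alpha>)) \<theta>'" unfolding complemented_iff by blast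
    then have "\<theta>' \<in> ?B" unfolding complemented_iff using compl_sym by blast
    then obtain y where y: "y \<in> carrier ?L" "h y = \<theta>'" using B by blast
    then obtain \<beta> where \<beta>: "\<beta> \<in> KCon S A" "y = cl \<beta>" by (auto simp: ret_simps)
    have inj: "inj_on h (carrier ?L)" using bij by (simp add: bij_betw_def)
    have "h (jn ?L (cl \<alpha>) y) = h (tp ?L)" "h (mt ?L (cl \<alpha>) y) = h (bt ?L)"
      using hom[OF x y(1)] \<theta>' y(2) tp bt by (simp_all add: compl_def)
    then have "jn ?L (cl \<alpha>) y = tp ?L" "mt ?L (cl \<alpha>) y = bt ?L"
      using inj_onD[OF inj] L.jn_closed[OF x y(1)] L.mt_closed[OF x y(1)] L.tp_closed L.bt_closed by blast+
    then show "\<exists>\<beta>\<in>KCon S A. J \<alpha> \<beta> = Nabla A \<and> br \<alpha> \<beta> \<subseteq> rad (Delta A)"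
      using complement_ret_iff[OF K_Con[OF \<alpha>] K_Con[OF \<beta>(1)]] \<beta> by blast
  qed
qed

text \<open>The isomorphism is inverse to \<open>cl\<close> on complemented congruences.
  \<open>cl\<close> is injective there by \<open>compl_rad_le\<close>; it reaches the class of a
  compact \<open>\<alpha>\<close> because a power of \<open>\<alpha>\<close> is complemented and has
  the same radical, also after joining \<open>r\<close>.\<close>

lemma compl_mod_rad_imp_center:
  assumes P: "compl_mod_rad"
  shows "lattice_isomorphic (reticulation S A) (boolean_center (Con_above S A r))"
proof -
  let ?L = "reticulation S A" and ?B = "complemented (Con_above S A r)"
  have inj: "inj_on cl ?B"
  proof (rule inj_onI)
    fix \<theta> \<eta> assume "\<theta> \<in> ?B" "\<eta> \<in> ?B" and eq: "cl \<theta> = cl \<eta>"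
    then obtain \<theta>' \<eta>' where c: "compl \<theta> \<theta>'" "compl \<eta> \<eta>'" by (auto simp: complemented_iff)
    then have "rad \<theta> = rad \<eta>" using eq cl_eq_iff by (auto simp: compl_def)
    then show "\<theta> = \<eta>" using compl_rad_le[OF c] compl_rad_le[OF c(2,1)] by simp
  qed
  have "cl ` ?B = carrier ?L"
  proof
    show "cl ` ?B \<subseteq> carrier ?L"
    proof (rule image_subsetI)
      fix \<theta> assume "\<theta> \<in> ?B"
      then obtain \<theta>' where "compl \<theta> \<theta>'" by (auto simp: complemented_iff)
      then obtain \<alpha> where \<alpha>: "\<alpha> \<in> KCon S A" "\<theta> = J \<alpha> r" using compl_eq_K by blast
      have "cl \<theta> = cl \<alpha>"
        using K_Con[OF \<alpha>(1)] r rad_join_small[OF K_Con[OF \<alpha>(1)] r r_small]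
        by (simp add: \<alpha>(2) cl_eq_iff J_Con)
      then show "cl \<theta> \<in> carrier ?L" using \<alpha>(1) by (simp add: ret_simps)
    qed
    show "carrier ?L \<subseteq> cl ` ?B"
      unfolding ret_simps
    proof (rule image_subsetI)
      fix \<alpha> assume \<alpha>: "\<alpha> \<in> KCon S A"
      obtain n where n: "sq n \<alpha> \<in> complemented (Con_above S A (Delta A))" using compl_mod_rad_sq[OF P \<alpha>] by blast
      have con: "\<alpha> \<in> Con S A" "sq n \<alpha> \<in> Con S A" using K_Con[OF \<alpha>] sq_Con by auto
      have "rad (sq n \<alpha>) = rad \<alpha>"
      proof
        show "rad (sq n \<alpha>) \<subseteq> rad \<alpha>" using rad_mono[OF con(2,1)] sq_antimono[OF con(1), of 0 n] by simp
        have "\<alpha> \<subseteq> rad (sq n \<alpha>)" by (intro le_radI con(1) Spec_sq[OF _ con(1)])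
        then show "rad \<alpha> \<subseteq> rad (sq n \<alpha>)" using rad_le_iff[OF con(1)] by blast
      qed
      then have "cl (J (sq n \<alpha>) r) = cl \<alpha>"
        using con r rad_join_small[OF con(2) r r_small] by (simp add: cl_eq_iff J_Con)
      then show "cl \<alpha> \<in> cl ` ?B" using complemented_lift[OF n r] by (metis imageI)
    qed
  qed
  with inj have bij: "bij_betw cl ?B (carrier ?L)" by (simp add: bij_betw_def)
  define g where "g = inv_into ?B cl"
  have g: "bij_betw g (carrier ?L) ?B" unfolding g_def by (rule bij_betw_inv_into[OF bij])
  have g_cl: "g (cl \<theta>) = \<theta>" if "\<theta> \<in> ?B" for \<theta>
    using bij_betw_inv_into_left[OF bij that] by (simp add: g_def)
  have "g (jn ?L x y) = J (g x) (g y) \<and> g (mt ?L x y) = g x \<inter> g y"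
    if "x \<in> carrier ?L" "y \<in> carrier ?L" for x y
  proof -
    have "x \<in> cl ` ?B" "y \<in> cl ` ?B" using that \<open>cl ` ?B = carrier ?L\<close> by simp_all
    then obtain \<theta> \<eta> where te: "\<theta> \<in> ?B" "\<eta> \<in> ?B" and xy: "x = cl \<theta>" "y = cl \<eta>" by blast
    then obtain \<theta>' \<eta>' where c: "compl \<theta> \<theta>'" "compl \<eta> \<eta>'" by (auto simp: complemented_iff)
    then have con: "\<theta> \<in> Con S A" "\<eta> \<in> Con S A" "r \<subseteq> \<eta>" by (auto simp: compl_def)
    have closed: "J \<theta> \<eta> \<in> ?B" "\<theta> \<inter> \<eta> \<in> ?B"
      by (rule complemented_closed[OF te])+
    have "cl (br \<theta> \<eta>) = cl (\<theta> \<inter> \<eta>)"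
      unfolding compl_Int[OF c(1) con(2,3)]
      using con r rad_join_small[OF br_Con[OF con(1,2)] r r_small] by (simp add: cl_eq_iff J_Con br_Con)
    then show ?thesis
      using g_cl[OF te(1)] g_cl[OF te(2)] g_cl[OF closed(1)] g_cl[OF closed(2)] con
      by (simp add: xy jn_cl mt_cl)
  qed
  with g show ?thesis
    by (auto simp: lattice_isomorphic_def boolean_center_def Con_above_def intro!: exI[of _ g])
qed

lemma center_iff: "lattice_isomorphic (reticulation S A) (boolean_center (Con_above S A r)) \<longleftrightarrow> compl_mod_rad"
  using center_imp_compl_mod_rad compl_mod_rad_imp_center by blast

end

text \<open>For the passage down to \<open>\<Delta>\<close>: a complement \<open>\<theta>\<close>
  above the radical absorbs it, so \<open>sq n \<alpha>\<close> itself is comaximal with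
  \<open>\<theta>\<close> and with some compact \<open>\<beta>\<close> below
  \<open>\<theta>\<close>. Then \<open>comax_sq_complemented\<close> supplies \<open>m\<close>
  further squares, in total \<open>m + n\<close>.\<close>

lemma complemented_above_rad_iff:
  "(\<forall>\<alpha>\<in>PCon S A. \<exists>n\<ge>1. J (sq n \<alpha>) (rad (Delta A)) \<in> complemented (Con_above S A (rad (Delta A)))) \<longleftrightarrow>
    compl_mod_rad" (is "?L \<longleftrightarrow> _")
proof
  assume compl_mod_rad
  then show ?L using compl_mod_rad_sq PCon_K complemented_lift[OF _ rad_Con] by blast
next
  assume L: ?L
  have "\<exists>n\<ge>1. sq n \<alpha> \<in> complemented (Con_above S A (Delta A))" if PC: "\<alpha> \<in> PCon S A" for \<alpha>
  proof -
    let ?\<rho> = "rad (Delta A)"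
    have \<alpha>: "\<alpha> \<in> KCon S A" by (rule PCon_K[OF PC])
    obtain n \<theta> where \<theta>: "\<theta> \<in> Con S A" "J (J (sq n \<alpha>) ?\<rho>) \<theta> = Nabla A" "J (sq n \<alpha>) ?\<rho> \<inter> \<theta> = ?\<rho>"
      using bspec[OF L PC] unfolding complemented_above by blast
    have a: "sq n \<alpha> \<in> KCon S A" by (rule sq_K[OF \<alpha>])
    have J: "J \<theta> (sq n \<alpha>) \<in> Con S A" by (rule J_Con[OF \<theta>(1) K_Con[OF a]])
    have "?\<rho> \<subseteq> \<theta>" using \<theta>(3) by auto
    then have "?\<rho> \<subseteq> J \<theta> (sq n \<alpha>)" using J_ge(1) by (rule subset_trans)
    then have le: "J (J (sq n \<alpha>) ?\<rho>) \<theta> \<subseteq> J \<theta> (sq n \<alpha>)"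
      by (intro J_le J J_ge)
    have top: "J \<theta> (sq n \<alpha>) = Nabla A"
      using le \<theta>(2) Con_Nabla[OF J_Con[OF \<theta>(1) K_Con[OF a]]] by blast
    from K_below_comax[OF \<theta>(1) K_Con[OF a] top] obtain \<beta> where
      \<beta>: "\<beta> \<in> KCon S A" "\<beta> \<subseteq> \<theta>" "J (sq n \<alpha>) \<beta> = Nabla A" by (auto simp: Un_commute)
    have "br (sq n \<alpha>) \<beta> \<subseteq> ?\<rho>"
      using commutator_le_Int[OF K_Con[OF a] K_Con[OF \<beta>(1)]] \<beta>(2) \<theta>(3) J_ge(1)[of "sq n \<alpha>" ?\<rho>] by blast
    from comax_sq_complemented[OF a \<beta>(1,3) this] obtain m where
      "m \<ge> 1" "sq (m + n) \<alpha> \<in> complemented (Con_above S A (Delta A))" by (auto simp: sq_add)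
    then show ?thesis by (intro exI[of _ "m + n"]) simp
  qed
  then show compl_mod_rad using hyperarchimedean_iff hyperarchimedean_iff_compl by blast
qed

end

section \<open>Quotient algebras and transport of lattice isomorphisms\<close>

lemma listset_map: "listset (map F xs) = {ys. list_all2 (\<lambda>x y. y \<in> F x) xs ys}"
proof (induction xs)
  case (Cons x xs)
  then show ?case by (auto simp: set_Cons_def list_all2_Cons1)
qed auto

lemma onto_hom_quot_alg:
  assumes alg: "is_algebra S A" and \<rho>: "\<rho> \<in> Con S A"
  shows "onto_hom S A (quot_alg A \<rho>) (\<lambda>x. \<rho> `` {x})" (is "onto_hom S A ?N ?\<pi>")
proof -
  have eqv: "equiv (carrier A) \<rho>" using \<rho> by (simp add: Con_def)
  have op: "opn ?N f (map ?\<pi> xs) = ?\<pi> (opn A f xs)"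
    if f: "f \<in> ops S" "length xs = arity S f" "set xs \<subseteq> carrier A" for f xs
  proof -
    \<comment> \<open>The union over a singleton only fits the shape of
      \<open>UN_UN_const\<close>.\<close>
    have "(\<Union>ys\<in>listset (map ?\<pi> xs). \<Union>z\<in>{()}. \<rho> `` {opn A f ys}) = \<rho> `` {opn A f xs}"
    proof (rule UN_UN_const)
      show "xs \<in> listset (map ?\<pi> xs)"
        using f(3) by (auto simp: listset_map list_all2_conv_all_nth subset_iff intro!: Con_refl[OF \<rho>])
      fix ys assume "ys \<in> listset (map ?\<pi> xs)"
      then have "list_all2 (\<lambda>x y. (x, y) \<in> \<rho>) xs ys" by (simp add: listset_map)
      then have "(opn A f xs, opn A f ys) \<in> \<rho>" by (rule Con_op[OF \<rho> f(1,2)])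
      then show "\<rho> `` {opn A f ys} = \<rho> `` {opn A f xs}" using equiv_class_eq[OF eqv] by blast
    qed simp
    then show ?thesis by (simp add: quot_alg_def)
  qed
  have carrier: "carrier ?N = ?\<pi> ` carrier A" by (auto simp: quot_alg_def quotient_def)
  show ?thesis
  proof
    show "is_algebra S ?N"
      unfolding is_algebra_def
    proof (intro conjI ballI allI impI)
      show "carrier ?N \<noteq> {}" using alg unfolding carrier is_algebra_def by simp
      fix f Xs assume f: "f \<in> ops S" and Xs: "length Xs = arity S f \<and> set Xs \<subseteq> carrier ?N"
      have "\<exists>xs. list_all2 (\<lambda>X x. x \<in> carrier A \<and> X = ?\<pi> x) Xs xs"
        using Xs unfolding carrier by (intro list_all_choice) blast
      then obtain xs where xs: "list_all2 (\<lambda>X x. x \<in> carrier A \<and> X = ?\<pi> x) Xs xs" by blast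
      then have "length xs = length Xs" by (simp add: list_all2_lengthD)
      with xs have *: "Xs = map ?\<pi> xs" "set xs \<subseteq> carrier A" "length xs = arity S f"
        using Xs by (auto simp: list_all2_conv_all_nth in_set_conv_nth intro!: nth_equalityI)
      show "opn ?N f Xs \<in> carrier ?N"
        unfolding *(1) op[OF f *(3,2)] carrier by (rule imageI, rule algebra_op[OF alg f *(3,2)])
    qed
    show "alg_hom S A ?N ?\<pi>" unfolding alg_hom_def using op carrier by auto
  qed (use alg carrier in auto)
qed

lemma pre_quot_Delta:
  assumes "is_algebra S A" "\<rho> \<in> Con S A"
  shows "pre A (\<lambda>x. \<rho> `` {x}) (Delta (quot_alg A \<rho>)) = \<rho>"
proof -
  interpret onto_hom S A "quot_alg A \<rho>" "\<lambda>x. \<rho> `` {x}" by (rule onto_hom_quot_alg[OF assms])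
  have "equiv (carrier A) \<rho>" using assms(2) by (simp add: Con_def)
  then show ?thesis
    using Con_sub[OF assms(2)] eq_equiv_class_iff by (intro equalityI subrelI) (fastforce simp: ker_iff)+
qed

lemma lattice_isomorphic_trans:
  "lattice_isomorphic L L' \<Longrightarrow> lattice_isomorphic L' L'' \<Longrightarrow> lattice_isomorphic L L''"
proof -
  assume "lattice_isomorphic L L'" "lattice_isomorphic L' L''"
  then obtain h k where h: "bij_betw h (carrier L) (carrier L')"
      "\<And>x y. x \<in> carrier L \<Longrightarrow> y \<in> carrier L \<Longrightarrow>
        h (jn L x y) = jn L' (h x) (h y) \<and> h (mt L x y) = mt L' (h x) (h y)"
    and k: "bij_betw k (carrier L') (carrier L'')"
      "\<And>x y. x \<in> carrier L' \<Longrightarrow> y \<in> carrier L' \<Longrightarrow>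
        k (jn L' x y) = jn L'' (k x) (k y) \<and> k (mt L' x y) = mt L'' (k x) (k y)"
    unfolding lattice_isomorphic_def by blast
  moreover have "h x \<in> carrier L'" if "x \<in> carrier L" for x using h(1) that by (auto simp: bij_betw_def)
  ultimately show "lattice_isomorphic L L''"
    unfolding lattice_isomorphic_def by (intro exI[of _ "k \<circ> h"]) (auto intro: bij_betw_trans)
qed

lemma lattice_isomorphic_inv:
  assumes k: "bij_betw k (carrier L) (carrier L')"
    and hom: "\<And>x y. x \<in> carrier L \<Longrightarrow> y \<in> carrier L \<Longrightarrow>
      k (jn L x y) = jn L' (k x) (k y) \<and> k (mt L x y) = mt L' (k x) (k y)"
    and closed: "\<And>x y. x \<in> carrier L \<Longrightarrow> y \<in> carrier L \<Longrightarrow> jn L x y \<in> carrier L \<and> mt L x y \<in> carrier L"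
  shows "lattice_isomorphic L L' \<and> lattice_isomorphic L' L"
proof
  show "lattice_isomorphic L L'" unfolding lattice_isomorphic_def using k hom by blast
  define g where "g = inv_into (carrier L) k"
  have g: "bij_betw g (carrier L') (carrier L)" unfolding g_def by (rule bij_betw_inv_into[OF k])
  have gk: "g (k x) = x" if "x \<in> carrier L" for x
    using bij_betw_inv_into_left[OF k that] by (simp add: g_def)
  have "g (jn L' x y) = jn L (g x) (g y) \<and> g (mt L' x y) = mt L (g x) (g y)"
    if "x \<in> carrier L'" "y \<in> carrier L'" for x y
  proof -
    have "x \<in> k ` carrier L" "y \<in> k ` carrier L" using that k by (simp_all add: bij_betw_def)
    then obtain u v where uv: "u \<in> carrier L" "v \<in> carrier L" "x = k u" "y = k v" by blast
    have "jn L' x y = k (jn L u v)" "mt L' x y = k (mt L u v)" using hom[OF uv(1,2)] uv(3,4) by simp_all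
    then show ?thesis using gk uv closed[OF uv(1,2)] by simp
  qed
  with g show "lattice_isomorphic L' L" unfolding lattice_isomorphic_def by blast
qed

text \<open>Commutators, powers and complements of \<open>N\<close> are read off in \<open>A\<close>
  through preimages, so the type of the elements of \<open>N\<close> is immaterial.\<close>

locale comm_quotient = comm_algebra S A + q: onto_hom S A N \<pi>
  for S :: "'f signature" and A :: "('f, 'a) algebra" and N :: "('f, 'b) algebra" and \<pi> :: "'a \<Rightarrow> 'b"
begin

text \<open>By \<open>br_le_iff\<close>, the congruences above the kernel that satisfy the term
  condition are those containing both the commutator and the kernel.\<close>

lemma pre_commutator_eq:
  assumes "\<alpha> \<in> Con S N" "\<beta> \<in> Con S N"
  shows "pre A \<pi> (commutator S N \<alpha> \<beta>) = J (br (pre A \<pi> \<alpha>) (pre A \<pi> \<beta>)) q.ker"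
proof -
  have con: "pre A \<pi> \<alpha> \<in> Con S A" "pre A \<pi> \<beta> \<in> Con S A" using pre_Con[OF alg q.hom] assms by auto
  have "{\<delta> \<in> Con S A. q.ker \<subseteq> \<delta> \<and> centralizes S A (pre A \<pi> \<alpha>) (pre A \<pi> \<beta>) \<delta>} =
      {\<delta> \<in> Con S A. br (pre A \<pi> \<alpha>) (pre A \<pi> \<beta>) \<union> q.ker \<subseteq> \<delta>}"
    using br_le_iff[OF con] by auto
  then show ?thesis unfolding q.pre_commutator[OF assms] Cg_def by simp
qed

text \<open>The kernel is absorbed after each squaring by \<open>br_J_self\<close>, so powers in
  \<open>N\<close> are powers in \<open>A\<close> joined once with the kernel.\<close>

lemma pre_comm_pow:
  assumes a: "a \<in> Con S A" and \<alpha>: "\<alpha> \<in> Con S N" "pre A \<pi> \<alpha> = J a q.ker" and n: "n \<ge> 1"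
  shows "comm_pow S N \<alpha> \<alpha> n \<in> Con S N \<and> pre A \<pi> (comm_pow S N \<alpha> \<alpha> n) = J (sq n a) q.ker"
proof -
  define sqN where "sqN n = ((\<lambda>\<gamma>. commutator S N \<gamma> \<gamma>) ^^ n) \<alpha>" for n
  have "sqN n \<in> Con S N \<and> pre A \<pi> (sqN n) = J (sq n a) q.ker" for n
  proof (induction n)
    case 0
    then show ?case using \<alpha> by (simp add: sqN_def)
  next
    case (Suc n)
    have eq: "sqN (Suc n) = commutator S N (sqN n) (sqN n)" by (simp add: sqN_def)
    have con: "sqN n \<in> Con S N" and s: "sq n a \<in> Con S A" using Suc sq_Con[OF a] by auto
    let ?J = "J (sq n a) q.ker"
    have J: "?J \<in> Con S A" by (rule J_Con[OF s q.ker_Con])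
    have "J (br ?J ?J) q.ker = J (sq (Suc n) a) q.ker"
    proof
      show "J (br ?J ?J) q.ker \<subseteq> J (sq (Suc n) a) q.ker"
        unfolding sq_Suc by (intro J_le J_Con br_Con s q.ker_Con br_J_self J_ge)
      show "J (sq (Suc n) a) q.ker \<subseteq> J (br ?J ?J) q.ker"
        unfolding sq_Suc by (intro J_mono commutator_mono J_ge) simp
    qed
    then show ?case
      using pre_commutator_eq[OF con con] commutator_Con[OF con Con_Nabla[OF con]] Suc by (simp add: eq)
  qed
  moreover have "comm_pow S N \<alpha> \<alpha> n = sqN n"
    using n funpow_swap1[of "\<lambda>\<gamma>. commutator S N \<gamma> \<gamma>" "n - 1" \<alpha>]
    by (cases n) (simp_all add: comm_pow_def sqN_def)
  ultimately show ?thesis by simp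
qed

text \<open>The preimage of a single pair may contain many pairs, but all of them are linked to
  \<open>(a, b)\<close> by the kernel.\<close>

lemma pre_Cg_pair:
  assumes ab: "a \<in> carrier A" "b \<in> carrier A"
  shows "pre A \<pi> (Cg S N {(\<pi> a, \<pi> b)}) = J (Cg S A {(a, b)}) q.ker"
proof -
  have sub: "{(\<pi> a, \<pi> b)} \<subseteq> Nabla N" using ab q.onto by (auto simp: Nabla_def)
  have c: "Cg S A {(a, b)} \<in> Con S A" using ab by (intro Cg_Con[OF alg]) (simp add: Nabla_def)
  have J: "J (Cg S A {(a, b)}) q.ker \<in> Con S A" by (rule J_Con[OF c q.ker_Con])
  have ge: "(a, b) \<in> J (Cg S A {(a, b)}) q.ker" "q.ker \<subseteq> J (Cg S A {(a, b)}) q.ker"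
    using Cg_ge[of "{(a, b)}" S A] J_ge(1)[of "Cg S A {(a, b)}" q.ker] J_ge(2)[of q.ker "Cg S A {(a, b)}"] by auto
  have P: "pre A \<pi> {(\<pi> a, \<pi> b)} \<union> q.ker \<subseteq> Nabla A" by (auto simp: pre_def Nabla_def)
  show ?thesis
    unfolding q.pre_Cg[OF sub]
  proof
    show "Cg S A (pre A \<pi> {(\<pi> a, \<pi> b)} \<union> q.ker) \<subseteq> J (Cg S A {(a, b)}) q.ker"
    proof (intro Cg_least J Un_least ge subrelI)
      fix x y assume "(x, y) \<in> pre A \<pi> {(\<pi> a, \<pi> b)}"
      then have "x \<in> carrier A" "y \<in> carrier A" "\<pi> x = \<pi> a" "\<pi> y = \<pi> b" by (auto simp: pre_def)
      then have "(x, a) \<in> q.ker" "(b, y) \<in> q.ker" using ab by (simp_all add: q.ker_iff)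
      then show "(x, y) \<in> J (Cg S A {(a, b)}) q.ker" using ge Con_trans[OF J] by blast
    qed
    have "(a, b) \<in> pre A \<pi> {(\<pi> a, \<pi> b)}" using ab by (simp add: pre_def)
    then have "Cg S A {(a, b)} \<subseteq> Cg S A (pre A \<pi> {(\<pi> a, \<pi> b)} \<union> q.ker)" by (intro Cg_mono) auto
    moreover have "q.ker \<subseteq> Cg S A (pre A \<pi> {(\<pi> a, \<pi> b)} \<union> q.ker)"
      using Cg_ge[of "pre A \<pi> {(\<pi> a, \<pi> b)} \<union> q.ker" S A] by blast
    ultimately show "J (Cg S A {(a, b)}) q.ker \<subseteq> Cg S A (pre A \<pi> {(\<pi> a, \<pi> b)} \<union> q.ker)"
      by (intro J_le Cg_Con[OF alg P])
  qed
qed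

lemma complemented_pre:
  assumes \<theta>: "\<theta> \<in> Con S N"
  shows "\<theta> \<in> complemented (Con_lattice S N) \<longleftrightarrow> pre A \<pi> \<theta> \<in> complemented (Con_above S A q.ker)"
proof
  note preC = pre_Con[OF alg q.hom]
  show "pre A \<pi> \<theta> \<in> complemented (Con_above S A q.ker)" if "\<theta> \<in> complemented (Con_lattice S N)"
  proof -
    obtain \<theta>' where \<theta>': "\<theta>' \<in> Con S N" "Cg S N (\<theta> \<union> \<theta>') = Nabla N" "\<theta> \<inter> \<theta>' = Delta N"
      using \<open>\<theta> \<in> complemented (Con_lattice S N)\<close> unfolding Con_lattice_eq complemented_above by blast
    then have "J (pre A \<pi> \<theta>) (pre A \<pi> \<theta>') = Nabla A" "pre A \<pi> \<theta> \<inter> pre A \<pi> \<theta>' = q.ker"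
      using q.pre_join[OF \<theta> \<theta>'(1)] q.pre_Nabla pre_Int[of A \<pi> \<theta> \<theta>'] by simp_all
    with \<theta> \<theta>'(1) preC show ?thesis unfolding complemented_above by blast
  qed
  show "\<theta> \<in> complemented (Con_lattice S N)" if "pre A \<pi> \<theta> \<in> complemented (Con_above S A q.ker)"
  proof -
    obtain \<eta> where \<eta>: "\<eta> \<in> Con S A" "J (pre A \<pi> \<theta>) \<eta> = Nabla A" "pre A \<pi> \<theta> \<inter> \<eta> = q.ker"
      using \<open>pre A \<pi> \<theta> \<in> complemented (Con_above S A q.ker)\<close> unfolding complemented_above by blast
    then have "q.ker \<subseteq> \<eta>" by blast
    with \<eta>(1) have i: "img \<pi> \<eta> \<in> Con S N" "pre A \<pi> (img \<pi> \<eta>) = \<eta>" using q.img_Con q.pre_img by auto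
    have J: "Cg S N (\<theta> \<union> img \<pi> \<eta>) \<in> Con S N"
      using Con_Nabla[OF \<theta>] Con_Nabla[OF i(1)] by (intro Cg_Con[OF q.algN]) auto
    have "Cg S N (\<theta> \<union> img \<pi> \<eta>) = Nabla N"
      using q.pre_inj[OF J Nabla_Con[OF q.algN]] q.pre_join[OF \<theta> i(1)] i(2) \<eta>(2) q.pre_Nabla by simp
    moreover have "\<theta> \<inter> img \<pi> \<eta> = Delta N"
      using q.pre_inj[OF Int_Con[OF \<theta> i(1)] Delta_Con[OF q.algN]] i(2) \<eta>(3) by (simp add: pre_Int)
    ultimately show ?thesis using \<theta> i(1) unfolding Con_lattice_eq complemented_above by blast
  qed
qed

lemma hyperarchimedean_quotient_iff:
  "hyperarchimedean S N \<longleftrightarrow>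
    (\<forall>a\<in>PCon S A. \<exists>n\<ge>1. J (sq n a) q.ker \<in> complemented (Con_above S A q.ker))"
proof -
  have step: "(\<exists>n\<ge>1. comm_pow S N (Cg S N {(\<pi> a, \<pi> b)}) (Cg S N {(\<pi> a, \<pi> b)}) n \<in> complemented (Con_lattice S N)) \<longleftrightarrow>
      (\<exists>n\<ge>1. J (sq n (Cg S A {(a, b)})) q.ker \<in> complemented (Con_above S A q.ker))"
    if ab: "a \<in> carrier A" "b \<in> carrier A" for a b
  proof -
    have c: "Cg S A {(a, b)} \<in> Con S A" using ab by (intro Cg_Con[OF alg]) (simp add: Nabla_def)
    have "Cg S N {(\<pi> a, \<pi> b)} \<in> Con S N"
      using ab q.onto by (intro Cg_Con[OF q.algN]) (auto simp: Nabla_def)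
    note * = pre_comm_pow[OF c this pre_Cg_pair[OF ab]]
    show ?thesis using * complemented_pre by metis
  qed
  have "PCon S N = {Cg S N {(\<pi> a, \<pi> b)} | a b. a \<in> carrier A \<and> b \<in> carrier A}"
    unfolding PCon_def q.onto[symmetric] by blast
  moreover have ball: "(\<forall>\<alpha>\<in>{F a b | a b. a \<in> carrier A \<and> b \<in> carrier A}. P \<alpha>) \<longleftrightarrow>
      (\<forall>a\<in>carrier A. \<forall>b\<in>carrier A. P (F a b))" for F :: "'a \<Rightarrow> 'a \<Rightarrow> 'c" and P by blast
  ultimately have "hyperarchimedean S N \<longleftrightarrow> (\<forall>a\<in>carrier A. \<forall>b\<in>carrier A. \<exists>n\<ge>1.
      comm_pow S N (Cg S N {(\<pi> a, \<pi> b)}) (Cg S N {(\<pi> a, \<pi> b)}) n \<in> complemented (Con_lattice S N))"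
    unfolding hyperarchimedean_def by (simp only: ball)
  also have "\<dots> \<longleftrightarrow> (\<forall>a\<in>carrier A. \<forall>b\<in>carrier A. \<exists>n\<ge>1.
      J (sq n (Cg S A {(a, b)})) q.ker \<in> complemented (Con_above S A q.ker))"
    by (intro ball_cong refl step)
  also have "\<dots> \<longleftrightarrow> (\<forall>a\<in>PCon S A. \<exists>n\<ge>1. J (sq n a) q.ker \<in> complemented (Con_above S A q.ker))"
    unfolding PCon_def by (simp only: ball)
  finally show ?thesis .
qed

lemma center_quotient_iff:
  assumes small: "q.ker \<subseteq> rad (Delta A)"
  shows "lattice_isomorphic L (boolean_center (Con_lattice S N)) \<longleftrightarrow>
    lattice_isomorphic L (boolean_center (Con_above S A q.ker))"
proof -
  let ?C = "complemented (Con_lattice S N)" and ?B = "complemented (Con_above S A q.ker)"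
  have con: "\<theta> \<in> Con S N" if "\<theta> \<in> ?C" for \<theta> using that by (simp add: Con_lattice_eq complemented_above)
  note closed = complemented_closed[OF q.ker_Con small]
  have pre_C: "pre A \<pi> \<theta> \<in> ?B" if "\<theta> \<in> ?C" for \<theta> using that complemented_pre[OF con] by blast
  have "lattice_isomorphic (boolean_center (Con_lattice S N)) (boolean_center (Con_above S A q.ker)) \<and>
    lattice_isomorphic (boolean_center (Con_above S A q.ker)) (boolean_center (Con_lattice S N))"
  proof (rule lattice_isomorphic_inv)
    show "bij_betw (pre A \<pi>) (carrier (boolean_center (Con_lattice S N)))
        (carrier (boolean_center (Con_above S A q.ker)))"
      unfolding boolean_center_def
    proof (simp, rule bij_betw_imageI)
      show "inj_on (pre A \<pi>) ?C" using con q.pre_inj by (auto simp: inj_on_def)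
      show "pre A \<pi> ` ?C = ?B"
      proof (intro equalityI subsetI)
        fix \<eta> assume \<eta>: "\<eta> \<in> ?B"
        then have "\<eta> \<in> Con S A" "q.ker \<subseteq> \<eta>" by (auto simp: complemented_above)
        then have i: "img \<pi> \<eta> \<in> Con S N" "pre A \<pi> (img \<pi> \<eta>) = \<eta>" using q.img_Con q.pre_img by auto
        then have "img \<pi> \<eta> \<in> ?C" using complemented_pre[OF i(1)] \<eta> by simp
        with i(2) show "\<eta> \<in> pre A \<pi> ` ?C" by (metis imageI)
      qed (use pre_C in auto)
    qed
    fix x y
    assume xy: "x \<in> carrier (boolean_center (Con_lattice S N))" "y \<in> carrier (boolean_center (Con_lattice S N))"
    then have C: "x \<in> ?C" "y \<in> ?C" by (simp_all add: boolean_center_def)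
    note c = con[OF C(1)] con[OF C(2)]
    have ops: "jn (boolean_center (Con_lattice S N)) x y = Cg S N (x \<union> y)"
      "mt (boolean_center (Con_lattice S N)) x y = x \<inter> y"
      by (simp_all add: boolean_center_def Con_lattice_def)
    have ops': "jn (boolean_center (Con_above S A q.ker)) \<alpha> \<beta> = J \<alpha> \<beta>"
      "mt (boolean_center (Con_above S A q.ker)) \<alpha> \<beta> = \<alpha> \<inter> \<beta>" for \<alpha> \<beta>
      by (simp_all add: boolean_center_def Con_above_def)
    show "pre A \<pi> (jn (boolean_center (Con_lattice S N)) x y) =
          jn (boolean_center (Con_above S A q.ker)) (pre A \<pi> x) (pre A \<pi> y) \<and>
        pre A \<pi> (mt (boolean_center (Con_lattice S N)) x y) =
          mt (boolean_center (Con_above S A q.ker)) (pre A \<pi> x) (pre A \<pi> y)"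
      unfolding ops ops' by (simp add: q.pre_join[OF c] pre_Int)
    have J: "Cg S N (x \<union> y) \<in> Con S N"
      using Con_Nabla[OF c(1)] Con_Nabla[OF c(2)] by (intro Cg_Con[OF q.algN]) auto
    have "Cg S N (x \<union> y) \<in> ?C" "x \<inter> y \<in> ?C"
      unfolding complemented_pre[OF J] complemented_pre[OF Int_Con[OF c]] q.pre_join[OF c] pre_Int
      by (rule closed[OF pre_C[OF C(1)] pre_C[OF C(2)]])+
    then show "jn (boolean_center (Con_lattice S N)) x y \<in> carrier (boolean_center (Con_lattice S N)) \<and>
        mt (boolean_center (Con_lattice S N)) x y \<in> carrier (boolean_center (Con_lattice S N))"
      unfolding ops by (simp add: boolean_center_def)
  qed
  then show ?thesis 
    using lattice_isomorphic_trans[of L "boolean_center (Con_lattice S N)" "boolean_center (Con_above S A q.ker)"]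
      lattice_isomorphic_trans[of L "boolean_center (Con_above S A q.ker)" "boolean_center (Con_lattice S N)"]
    by blast
qed

end

lemma (in cm_variety) comm_algebra:
  assumes "A \<in> \<C>"
  shows "comm_algebra S A"
proof -
  have "embeds TYPE('u) (carrier A)" unfolding embeds_def by (rule exI[of _ id]) simp
  with assms variety have M: "member S E TYPE('u) A" by simp
  show ?thesis
    by (intro comm_algebra.intro mem_algebra[OF M] commutator_commute[OF M] commutator_le_iff[OF M]
        commutator_join_le[OF M] commutator_Nabla[OF M] commutator_KCon[OF M] Nabla_KCon[OF M]
        commutator_squares_le[OF M])
qed

theorem proposition9p10:
  fixes S :: "'f signature"
    and E :: "'f identities"
    and \<C> :: "('f, 'u) algebra set"
    and A :: "('f, 'u) algebra"
  assumes universe: "large_universe S TYPE('u)"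
    and identities: "wf_identities S E"
    and variety: "\<C> = variety S E"
    and congruence_modular: "\<forall>M\<in>\<C>. modular_lattice (Con_lattice S M)"
    and semi_degenerate: "semi_degenerate S \<C>"
    and commutator_closed:
      "\<forall>M\<in>\<C>. \<forall>\<alpha>\<in>KCon S M. \<forall>\<beta>\<in>KCon S M. commutator S M \<alpha> \<beta> \<in> KCon S M"
    and member: "A \<in> \<C>"
  shows
    "(hyperarchimedean S A \<longleftrightarrow> hyperarchimedean S (quot_alg A (radical S A (Delta A)))) \<and>
     (hyperarchimedean S A \<longleftrightarrow> Max_Con S A = Spec S A) \<and>
     (hyperarchimedean S A \<longleftrightarrow> boolean_lattice (reticulation S A)) \<and>
     (hyperarchimedean S A \<longleftrightarrow>
        lattice_isomorphic (reticulation S A) (boolean_center (Con_lattice S A))) \<and>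
     (hyperarchimedean S A \<longleftrightarrow>
        lattice_isomorphic (reticulation S A)
          (boolean_center (Con_lattice S (quot_alg A (radical S A (Delta A))))))"
proof -
  interpret cm_variety S E \<C>
    by (rule cm_variety.intro) (fact assms)+
  interpret comm_algebra S A by (rule comm_algebra[OF member])
  let ?\<rho> = "radical S A (Delta A)"
  interpret Q: comm_quotient S A "quot_alg A ?\<rho>" "\<lambda>x. ?\<rho> `` {x}"
    by (intro comm_quotient.intro comm_algebra_axioms onto_hom_quot_alg alg rad_Con)
  note ker = pre_quot_Delta[OF alg rad_Con, of "Delta A"]
  have "hyperarchimedean S (quot_alg A ?\<rho>) \<longleftrightarrow> compl_mod_rad"
    using Q.hyperarchimedean_quotient_iff complemented_above_rad_iff unfolding ker by simp
  moreover have "lattice_isomorphic (reticulation S A) (boolean_center (Con_lattice S (quot_alg A ?\<rho>))) \<longleftrightarrow>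
      compl_mod_rad"
    using Q.center_quotient_iff[of "reticulation S A"] center_iff[OF rad_Con order_refl] unfolding ker by simp
  moreover have "lattice_isomorphic (reticulation S A) (boolean_center (Con_lattice S A)) \<longleftrightarrow> compl_mod_rad"
    unfolding Con_lattice_eq by (rule center_iff[OF Delta_Con[OF alg] rad_ge[OF Delta_Con[OF alg]]])
  ultimately show ?thesis
    using hyperarchimedean_iff_compl Max_iff_compl boolean_lattice_ret_iff by simp
qed

end
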